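(* Let $T$ be a marked projective tetrahedron. There exists a unique fractional linear transformation $\psi\in \mathrm{PSL}_2(\mathbb{C})$ such that $$\mathrm{CK}^{\mathrm L}_T(t)=\mathrm{CK}^{\mathrm A}_T(\psi(t)).$$ For a certain order of the principal parameters $p_1$ and $p_2$ of $T$ we have $$\psi(t)=\frac{(t-p_1)(1-p_2)}{(t-p_2)(1-p_1)}.$$ In particular, the configurations $\mathrm{L}(T)$ and $\mathrm{A}(T)$ are projectively equivalent (as ordered $8$-tuples of points of $\mathbb{P}^1$).
   Context: Work over $\mathbb{C}$. Cross-ratio: $[z_1,z_2,z_3,z_4]=\dfrac{(z_1-z_2)(z_3-z_4)}{(z_1-z_4)(z_3-z_2)}$; it is used for points on any rational curve. Projective tetrahedron: $T=(Q,\mathcal H)$ consists of a smooth quadric $Q\subset\mathbb{P}^3$ and an ordered set $\mathcal{H}=\{H_1,H_2,H_3,H_4\}$ of planes in general position such that the conics $Q\cap H_i$ are smooth and the vertices $A_i=\bigcap_{j\ne i}H_j$ do not lie on $Q$. A marking of $T$ is an ordering of the two families of lines (generators) on $Q$ (called left and right) together with, for each edge $(A_iA_j)$, $i<j$, an ordering of the two points of $(A_iA_j)\cap Q$ (assumed distinct); the first is denoted $E_{ij}$, the second $E_{ji}$. For $p\in Q$, $L_p$ and $R_p$ are the left and right generators through $p$. Let ${}^\vee$ denote polar duality with respect to $Q$. Lattices: $I=\{1,2,3,4\}$; $S_I$ is the set of even-cardinality subsets of $I$, an $\mathbb{F}_2$-vector space of dimension $3$ under symmetric difference; planes are its $4$-element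 affine subspaces. Equip $(\tfrac12\mathbb{Z})^{S_I}$ with the form $-2\sum x_s^2$ and standard vectors $e_s$; $e_{ij}=e_{\{i,j\}}$. $\mathrm{E}_8$ is the root system with roots $\pm e_s$ and $\tfrac12(\pm e_a\pm e_b\pm e_c\pm e_d)$, $\{a,b,c,d\}$ a plane. $\mathrm{E}_7^{\mathrm L}$ (resp. $\mathrm{E}_7^{\mathrm A}$) is the set of roots orthogonal to $e_I$ (resp. $e_\varnothing$); $\mathrm{Q}(\cdot)$ is the lattice spanned by a root system. Length function: let $\widetilde Q\to\mathbb{P}^3$ be the double cover ramified along $Q$. For a line $l$ transversal to $Q$, its preimage $\widetilde l$ is a rational curve doubly covering $l$ and ramified at $l\cap Q$; points of $l\cap Q$ are identified with their preimages, and cross-ratios of points of $\widetilde l$ are taken on $\widetilde l$. Choose lifts $\widetilde A_i\in\widetilde Q$ of $A_i$ and let $\widetilde{\mathrm L}_T\colon(\tfrac12\mathbb{Z})^{S_I}\to\mathbb{C}^\times$ be the homomorphism with $\widetilde{\mathrm L}_T(\tfrac12e_{ij})=[\widetilde A_i,E_{ij},\widetilde A_j,E_{ji}]$ for $i<j$, and $\widetilde{\mathrm L}_T(\tfrac12e_\varnothing)=\widetilde{\mathrm L}_T(\tfrac12 e_I)=1$. Its restriction $\mathrm{L}_T\colon\mathrm{Q}(\mathrm{E}_7^{\mathrm L})\to\mathbb{C}^\times$ is independent of the lifts. Angle function: put $E'_{ij}=L_{E_{ij}}\cap R_{E_{ji}}$ for $i\neq j$; then $(A_iA_j)^\vee\cap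 Q=\{E'_{ij},E'_{ji}\}$. The dual tetrahedron $T^\vee=(Q,\{A_1^\vee,\dots,A_4^\vee\})$ has vertices $H_1^\vee,\dots,H_4^\vee$, and $(H_k^\vee H_l^\vee)=(A_iA_j)^\vee$ when $\{i,j,k,l\}=I$. Mark $T^\vee$ by the same ordering of generator families and, for $k<l$, by taking as first point of $(H_k^\vee H_l^\vee)\cap Q$ the point $E'_{ij}$ with $(i,j,k,l)$ an even permutation of $(1,2,3,4)$. Let $D$ be the isometry $e_s\mapsto e_{I\smallsetminus s}$; it interchanges $\mathrm{Q}(\mathrm{E}_7^{\mathrm L})$ and $\mathrm{Q}(\mathrm{E}_7^{\mathrm A})$. Then $\mathrm{A}_T=\mathrm{L}_{T^\vee}\circ D\colon\mathrm{Q}(\mathrm{E}_7^{\mathrm A})\to\mathbb{C}^\times$; thus $\mathrm{A}_T(e_{ij})=[H_k^\vee,E'_{ij},H_l^\vee,E'_{ji}]$ for $(i,j,k,l)$ an even permutation. Notation: for $\{a,b,c,d\}=I$ with $a<b<c$, $$\mathrm{L}_{abc}=\mathrm{L}_T\Bigl(\tfrac{e_{ab}+e_{ac}+e_{bc}+e_\varnothing}{2}\Bigr),\qquad \mathrm{A}_{abc}=\mathrm{A}_T\Bigl(\tfrac{e_{ad}+e_{bd}+e_{cd}+e_I}{2}\Bigr)$$ (where $e_{ij}=e_{ji}$), and, for $\mathrm{X}=\mathrm{L}$ or $\mathrm{A}$, $$\mathrm X_{1234}=\mathrm X_T\bigl(\tfrac{e_{12}+e_{14}+e_{23}+e_{34}}2\bigr),\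 \mathrm X_{1324}=\mathrm X_T\bigl(\tfrac{e_{13}+e_{14}+e_{23}+e_{24}}2\bigr),\ \mathrm X_{1243}=\mathrm X_T\bigl(\tfrac{e_{12}+e_{13}+e_{24}+e_{34}}2\bigr).$$ Configurations: $\mathrm X(T)=(1,\mathrm X_{123},\mathrm X_{124},\mathrm X_{134},\mathrm X_{234},\mathrm X_{1234},\mathrm X_{1324},\mathrm X_{1243})$. (Dual) Cho--Kim functions: for $\mathrm X=\mathrm L$ (resp. $\mathrm A$), $$\mathrm{CK}^{\mathrm X}_T(t)=\frac{(t-\mathrm X_{123})(t-\mathrm X_{124})(t-\mathrm X_{134})(t-\mathrm X_{234})}{(t-1)(t-\mathrm X_{1234})(t-\mathrm X_{1324})(t-\mathrm X_{1243})}.$$ One has $\mathrm{CK}^{\mathrm L}_T(0)=\mathrm{CK}^{\mathrm L}_T(\infty)=1$; the two further points $p_1,p_2\in\mathbb{P}^1$ at which $\mathrm{CK}^{\mathrm L}_T=1$ are the principal parameters of $T$.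
   Formalization: Uniqueness of ψ from CK^L(t)=CK^A(ψ(t)) alone fails for special T; it is proved to hold exactly when CK^L has no nontrivial automorphism in PSL_2, while for every T exactly one ψ has this identity, the displayed formula and maps L(T) to A(T). *)

theory Defs
  imports "HOL-Analysis.Analysis"
begin

section \<open>Projective spaces over the complex numbers\<close>

text \<open>Points of the projective space of \<open>complex ^ 'n\<close> are the one-dimensional linear subspaces;
  projective lines and planes are represented by the linear subspaces themselves, of (linear)
  dimension 2 and 3.  Projective 3-space is \<open>4 proj\<close>, the projective line is \<open>2 proj\<close>.\<close>

typedef ('n::finite) proj = "{l :: (complex ^ 'n) set. vec.subspace l \<and> vec.dim l = 1}"
proof
  show "vec.span {axis undefined 1} \<in> {l :: (complex ^ 'n) set. vec.subspace l \<and> vec.dim l = 1}"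
    by (simp add: vec.dim_span vec.dim_eq_card_independent vec.independent_insert)
qed

definition point :: "complex ^ 'n \<Rightarrow> ('n::finite) proj" where
  "point v = Abs_proj (vec.span {v})"

definition coords :: "('n::finite) proj \<Rightarrow> complex ^ 'n" where
  "coords p = (SOME v. v \<noteq> 0 \<and> v \<in> Rep_proj p)"

definition pts :: "(complex ^ 'n) set \<Rightarrow> ('n::finite) proj set" where
  "pts V = {p. Rep_proj p \<subseteq> V}"

definition join :: "('n::finite) proj \<Rightarrow> 'n proj \<Rightarrow> (complex ^ 'n) set" where
  "join p p' = vec.span (Rep_proj p \<union> Rep_proj p')"


section \<open>The projective line\<close>

definition affine_pt :: "complex \<Rightarrow> 2 proj" where
  "affine_pt z = point (vector [z, 1])"

text \<open>The inverse of \<^const>\<open>affine_pt\<close>; the value at infinity is irrelevant.\<close>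

definition affine_coord :: "2 proj \<Rightarrow> complex" where
  "affine_coord p = coords p $ 1 / coords p $ 2"

text \<open>If p and p' have affine coordinates z and z', then \<open>bracket p p'\<close> is z - z' times the product
  of the second homogeneous coordinates of p and p'.  So the following is the homogenized form of
  (z1 - z2) (z3 - z4) / ((z1 - z4) (z3 - z2)), which also makes sense when points are at infinity.\<close>

definition bracket :: "2 proj \<Rightarrow> 2 proj \<Rightarrow> complex" where
  "bracket p p' = coords p $ 1 * coords p' $ 2 - coords p $ 2 * coords p' $ 1"

definition cross_ratio :: "2 proj \<Rightarrow> 2 proj \<Rightarrow> 2 proj \<Rightarrow> 2 proj \<Rightarrow> 2 proj" where
  "cross_ratio z1 z2 z3 z4 =
     point (vector [bracket z1 z2 * bracket z3 z4, bracket z1 z4 * bracket z3 z2])"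

definition PSL2 :: "(2 proj \<Rightarrow> 2 proj) set" where
  "PSL2 = {\<psi>. \<exists>m :: complex ^ 2 ^ 2. det m = 1 \<and> (\<forall>p. Rep_proj (\<psi> p) = (*v) m ` Rep_proj p)}"

text \<open>The isomorphisms from the projective line to a smooth plane conic \<open>C\<close> in a projective space
  are the parametrizations of \<open>C\<close> by three linearly independent binary quadratic forms.\<close>

definition conic_parametrization ::
    "(2 proj \<Rightarrow> ('n::finite) proj) \<Rightarrow> 'n proj set \<Rightarrow> bool" where
  "conic_parametrization \<gamma> C \<longleftrightarrow>
     (\<exists>a b c. vec.dim {a, b, c} = 3 \<and>
        (\<forall>z. \<gamma> z = point ((coords z $ 1)\<^sup>2 *s a + (coords z $ 1 * coords z $ 2) *s b
                          + (coords z $ 2)\<^sup>2 *s c)) \<and>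
        range \<gamma> = C)"

definition cross_ratio_on_conic ::
    "('n::finite) proj set \<Rightarrow> 'n proj \<Rightarrow> 'n proj \<Rightarrow> 'n proj \<Rightarrow> 'n proj \<Rightarrow> 2 proj" where
  "cross_ratio_on_conic C p1 p2 p3 p4 =
     (THE r. \<exists>\<gamma> z1 z2 z3 z4. conic_parametrization \<gamma> C \<and>
        \<gamma> z1 = p1 \<and> \<gamma> z2 = p2 \<and> \<gamma> z3 = p3 \<and> \<gamma> z4 = p4 \<and> r = cross_ratio z1 z2 z3 z4)"


section \<open>Quadrics\<close>

text \<open>A quadric is given by a symmetric matrix, that is, by its equation.\<close>

definition bil :: "complex ^ 4 ^ 4 \<Rightarrow> complex ^ 4 \<Rightarrow> complex ^ 4 \<Rightarrow> complex" where
  "bil M u v = (\<Sum>i\<in>UNIV. u $ i * (M *v v) $ i)"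

definition quadric :: "complex ^ 4 ^ 4 \<Rightarrow> 4 proj set" where
  "quadric M = {p. \<forall>v\<in>Rep_proj p. bil M v v = 0}"

text \<open>The Jacobian criterion for the intersection of the quadric with the projectivization of \<open>V\<close>:
  up to a factor 2, \<open>bil M v\<close> restricted to \<open>V\<close> is the differential at \<open>v\<close> of the restricted
  equation.\<close>

definition smooth_section :: "complex ^ 4 ^ 4 \<Rightarrow> (complex ^ 4) set \<Rightarrow> bool" where
  "smooth_section M V \<longleftrightarrow>
     (\<forall>v\<in>V. v \<noteq> 0 \<and> bil M v v = 0 \<longrightarrow> (\<exists>u\<in>V. bil M v u \<noteq> 0))"

definition polar :: "complex ^ 4 ^ 4 \<Rightarrow> (complex ^ 4) set \<Rightarrow> (complex ^ 4) set" where
  "polar M V = {u. \<forall>v\<in>V. bil M v u = 0}"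

definition generators :: "complex ^ 4 ^ 4 \<Rightarrow> (complex ^ 4) set set" where
  "generators M = {l. vec.subspace l \<and> vec.dim l = 2 \<and> pts l \<subseteq> quadric M}"

text \<open>Two lines on a smooth quadric belong to the same family iff they are equal or disjoint.\<close>

definition generator_families :: "complex ^ 4 ^ 4 \<Rightarrow> (complex ^ 4) set set set" where
  "generator_families M =
     generators M // {(l, l'). l \<in> generators M \<and> l' \<in> generators M \<and> (l = l' \<or> l \<inter> l' = {0})}"


section \<open>Marked projective tetrahedra\<close>

record tetrahedron =
  eqn :: "complex ^ 4 ^ 4"
  face :: "nat \<Rightarrow> (complex ^ 4) set"

record marked_tetrahedron = tetrahedron +
  left_gens :: "(complex ^ 4) set set"
  right_gens :: "(complex ^ 4) set set"
  edge_pt :: "nat \<Rightarrow> nat \<Rightarrow> 4 proj"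

abbreviation Idx :: "nat set" where
  "Idx \<equiv> {1, 2, 3, 4}"

definition vertex :: "'a tetrahedron_scheme \<Rightarrow> nat \<Rightarrow> 4 proj" where
  "vertex T i = Abs_proj (\<Inter>j\<in>Idx - {i}. face T j)"

definition edge :: "'a tetrahedron_scheme \<Rightarrow> nat \<Rightarrow> nat \<Rightarrow> (complex ^ 4) set" where
  "edge T i j = join (vertex T i) (vertex T j)"

text \<open>Four planes in projective 3-space are in general position iff they have no common point.\<close>

definition projective_tetrahedron :: "'a tetrahedron_scheme \<Rightarrow> bool" where
  "projective_tetrahedron T \<longleftrightarrow>
     transpose (eqn T) = eqn T \<and> smooth_section (eqn T) UNIV \<and>
     (\<forall>i\<in>Idx. vec.subspace (face T i) \<and> vec.dim (face T i) = 3) \<and>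
     (\<Inter>i\<in>Idx. face T i) = {0} \<and>
     (\<forall>i\<in>Idx. smooth_section (eqn T) (face T i)) \<and>
     (\<forall>i\<in>Idx. vertex T i \<notin> quadric (eqn T))"

definition marked_projective_tetrahedron :: "marked_tetrahedron \<Rightarrow> bool" where
  "marked_projective_tetrahedron T \<longleftrightarrow>
     projective_tetrahedron T \<and>
     left_gens T \<noteq> right_gens T \<and>
     generator_families (eqn T) = {left_gens T, right_gens T} \<and>
     (\<forall>i\<in>Idx. \<forall>j\<in>Idx. i \<noteq> j \<longrightarrow>
        edge_pt T i j \<noteq> edge_pt T j i \<and>
        pts (edge T i j) \<inter> quadric (eqn T) = {edge_pt T i j, edge_pt T j i})"

definition gen_through :: "(complex ^ 4) set set \<Rightarrow> 4 proj \<Rightarrow> (complex ^ 4) set" where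
  "gen_through F p = (THE l. l \<in> F \<and> p \<in> pts l)"

text \<open>The points \<open>E'\<close> on the polar duals of the edges.\<close>

definition dual_edge_pt :: "marked_tetrahedron \<Rightarrow> nat \<Rightarrow> nat \<Rightarrow> 4 proj" where
  "dual_edge_pt T i j =
     Abs_proj (gen_through (left_gens T) (edge_pt T i j) \<inter>
               gen_through (right_gens T) (edge_pt T j i))"

definition even_arrangement :: "nat \<Rightarrow> nat \<Rightarrow> nat \<Rightarrow> nat \<Rightarrow> bool" where
  "even_arrangement i j k l \<longleftrightarrow>
     (\<exists>\<pi>. \<pi> permutes Idx \<and> evenperm \<pi> \<and> \<pi> 1 = i \<and> \<pi> 2 = j \<and> \<pi> 3 = k \<and> \<pi> 4 = l)"

text \<open>If (i,j,k,l) is an even permutation then so is (j,i,l,k).  Hence the rule for the first point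
  of the edge (k,l) with k < l also gives the second point, as the point with indices l, k.\<close>

definition dual :: "marked_tetrahedron \<Rightarrow> marked_tetrahedron" where
  "dual T =
     \<lparr> eqn = eqn T,
       face = (\<lambda>i. polar (eqn T) (Rep_proj (vertex T i))),
       left_gens = left_gens T,
       right_gens = right_gens T,
       edge_pt = (\<lambda>k l. THE p. \<exists>i j. even_arrangement i j k l \<and> p = dual_edge_pt T i j) \<rparr>"


section \<open>The double cover ramified along the quadric\<close>

text \<open>The double cover of projective 3-space ramified along the quadric q = 0 is the threefold
  \<open>w\<^sup>2 = q(x)\<close> in the projective space with homogeneous coordinates (w : x), the covering map being
  (w : x) \<open>\<mapsto>\<close> (x).  The coordinate w has index \<^const>\<open>None\<close>, the others have indices \<open>Some i\<close>.\<close>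

definition x_part :: "complex ^ (4 option) \<Rightarrow> complex ^ 4" where
  "x_part v = (\<chi> i. v $ Some i)"

definition double_cover :: "complex ^ 4 ^ 4 \<Rightarrow> (4 option) proj set" where
  "double_cover M = {p. \<forall>v\<in>Rep_proj p. (v $ None)\<^sup>2 = bil M (x_part v) (x_part v)}"

definition cover_map :: "(4 option) proj \<Rightarrow> 4 proj" where
  "cover_map p = Abs_proj (x_part ` Rep_proj p)"

text \<open>The preimage of a point of the quadric.\<close>

definition ramification_pt :: "4 proj \<Rightarrow> (4 option) proj" where
  "ramification_pt p = Abs_proj {v. v $ None = 0 \<and> x_part v \<in> Rep_proj p}"

definition line_preimage :: "complex ^ 4 ^ 4 \<Rightarrow> (complex ^ 4) set \<Rightarrow> (4 option) proj set" where
  "line_preimage M l = {p \<in> double_cover M. cover_map p \<in> pts l}"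


section \<open>The length and angle functions\<close>

text \<open>Vectors indexed by the even-cardinality subsets of \<open>Idx\<close> are represented by functions on all sets,
  of which only the values on even-cardinality subsets of \<open>Idx\<close> matter.\<close>

type_synonym lattice_vec = "nat set \<Rightarrow> rat"

definition unit_vec :: "nat set \<Rightarrow> lattice_vec" where
  "unit_vec s = (\<lambda>t. if t = s then 1 else 0)"

definition half_sum :: "nat set \<Rightarrow> nat set \<Rightarrow> nat set \<Rightarrow> nat set \<Rightarrow> lattice_vec" where
  "half_sum a b c d = (\<lambda>t. (unit_vec a t + unit_vec b t + unit_vec c t + unit_vec d t) / 2)"

definition is_lift :: "marked_tetrahedron \<Rightarrow> (nat \<Rightarrow> (4 option) proj) \<Rightarrow> bool" where
  "is_lift T A \<longleftrightarrow> (\<forall>i\<in>Idx. A i \<in> double_cover (eqn T) \<and> cover_map (A i) = vertex T i)"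

definition edge_cross_ratio ::
    "marked_tetrahedron \<Rightarrow> (nat \<Rightarrow> (4 option) proj) \<Rightarrow> nat \<Rightarrow> nat \<Rightarrow> complex" where
  "edge_cross_ratio T A i j =
     affine_coord (cross_ratio_on_conic (line_preimage (eqn T) (edge T i j))
       (A i) (ramification_pt (edge_pt T i j)) (A j) (ramification_pt (edge_pt T j i)))"

text \<open>The homomorphism on the lattice of half-integral vectors that sends half of \<open>unit_vec {i, j}\<close> to the
  cross-ratio for i < j, and half of \<open>unit_vec {}\<close> and half of \<open>unit_vec Idx\<close> to 1.\<close>

definition lifted_length ::
    "marked_tetrahedron \<Rightarrow> (nat \<Rightarrow> (4 option) proj) \<Rightarrow> lattice_vec \<Rightarrow> complex" where
  "lifted_length T A x =
     (\<Prod>(i, j)\<in>{(i, j). i \<in> Idx \<and> j \<in> Idx \<and> i < j}. edge_cross_ratio T A i j powi \<lfloor>2 * x {i, j}\<rfloor>)"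

text \<open>The next two functions are only meaningful (independent of the choice of lifts) on the root
  lattice of the roots orthogonal to \<open>unit_vec Idx\<close>, respectively to \<open>unit_vec {}\<close>.\<close>

definition length_fun :: "marked_tetrahedron \<Rightarrow> lattice_vec \<Rightarrow> complex" where
  "length_fun T = lifted_length T (SOME A. is_lift T A)"

definition angle_fun :: "marked_tetrahedron \<Rightarrow> lattice_vec \<Rightarrow> complex" where
  "angle_fun T x = length_fun (dual T) (\<lambda>s. x (Idx - s))"

text \<open>For the angles, the second argument is the complementary index d.\<close>

definition L3 :: "marked_tetrahedron \<Rightarrow> nat \<Rightarrow> nat \<Rightarrow> nat \<Rightarrow> complex" where
  "L3 T a b c = length_fun T (half_sum {a, b} {a, c} {b, c} {})"

definition A3 :: "marked_tetrahedron \<Rightarrow> nat \<Rightarrow> nat \<Rightarrow> nat \<Rightarrow> nat \<Rightarrow> complex" where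
  "A3 T d a b c = angle_fun T (half_sum {a, d} {b, d} {c, d} Idx)"

definition four_cycles :: "(lattice_vec \<Rightarrow> complex) \<Rightarrow> complex list" where
  "four_cycles X =
     [X (half_sum {1, 2} {1, 4} {2, 3} {3, 4}),
      X (half_sum {1, 3} {1, 4} {2, 3} {2, 4}),
      X (half_sum {1, 2} {1, 3} {2, 4} {3, 4})]"

definition length_config :: "marked_tetrahedron \<Rightarrow> complex list" where
  "length_config T =
     [1, L3 T 1 2 3, L3 T 1 2 4, L3 T 1 3 4, L3 T 2 3 4] @ four_cycles (length_fun T)"

definition angle_config :: "marked_tetrahedron \<Rightarrow> complex list" where
  "angle_config T =
     [1, A3 T 4 1 2 3, A3 T 3 1 2 4, A3 T 2 1 3 4, A3 T 1 2 3 4] @ four_cycles (angle_fun T)"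


section \<open>Cho--Kim functions and principal parameters\<close>

text \<open>Numerator and denominator of the Cho--Kim function of a configuration of 8 numbers (the first
  of which is 1), as homogeneous forms of degree 4 in v = (t : 1).\<close>

definition CK_num :: "complex list \<Rightarrow> complex ^ 2 \<Rightarrow> complex" where
  "CK_num X v = (\<Prod>k\<in>{1, 2, 3, 4}. v $ 1 - X ! k * v $ 2)"

definition CK_den :: "complex list \<Rightarrow> complex ^ 2 \<Rightarrow> complex" where
  "CK_den X v = (\<Prod>k\<in>{0, 5, 6, 7}. v $ 1 - X ! k * v $ 2)"

definition CK :: "complex list \<Rightarrow> 2 proj \<Rightarrow> 2 proj" where
  "CK X t = point (vector [CK_num X (coords t), CK_den X (coords t)])"

abbreviation CK_L :: "marked_tetrahedron \<Rightarrow> 2 proj \<Rightarrow> 2 proj" where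
  "CK_L T \<equiv> CK (length_config T)"

abbreviation CK_A :: "marked_tetrahedron \<Rightarrow> 2 proj \<Rightarrow> 2 proj" where
  "CK_A T \<equiv> CK (angle_config T)"

text \<open>The principal parameters are the two further points where \<open>CK_L\<close> takes the value 1, counted
  with multiplicity: the quartic form \<open>CK_num - CK_den\<close> vanishes at 0, at infinity, and at
  \<open>p1\<close>, \<open>p2\<close>.  The latter may themselves be 0 or infinity (when the quartic has multiple roots
  there), so they are points of the projective line.  The relation is symmetric in \<open>p1\<close> and \<open>p2\<close>.\<close>

definition principal_parameters :: "marked_tetrahedron \<Rightarrow> 2 proj \<Rightarrow> 2 proj \<Rightarrow> bool" where
  "principal_parameters T p1 p2 \<longleftrightarrow>
     (\<exists>c. c \<noteq> 0 \<and> (\<forall>t. CK_num (length_config T) (coords t) - CK_den (length_config T) (coords t) =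
        c * coords t $ 1 * coords t $ 2 * bracket t p1 * bracket t p2))"

text \<open>The identity \<open>CK_L T t = CK_A T (\<psi> t)\<close> alone determines \<open>\<psi>\<close> only up to automorphisms of
  \<open>CK_L T\<close>, and these can be non-trivial: the tetrahedron of the coordinate planes is self-polar for
  the quadric \<open>x\<^sub>1\<^sup>2 + x\<^sub>2\<^sup>2 + x\<^sub>3\<^sup>2 + x\<^sub>4\<^sup>2 = 0\<close>, and for suitable markings its \<open>CK_L\<close> is
  \<open>((t\<^sup>2 + 1) / (t\<^sup>2 - 1))\<^sup>2\<close>, which is invariant under \<open>t \<mapsto> - t\<close> (and has principal parameters 0 and
  infinity).\<close>

end

theory Submission
  imports Defs
begin

text \<open>
  Represent the vertices by vectors \<open>v\<^sub>i\<close> with \<open>q (v\<^sub>i) = 1\<close>; a lift of a vertex is a choice of sign.  Let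
  \<open>x\<^sub>i\<^sub>j\<close> be the cross-ratio on the double cover of the edge \<open>ij\<close>.  Then \<open>E\<^sub>i\<^sub>j = v\<^sub>i - x\<^sub>i\<^sub>j v\<^sub>j\<close>, and the Gram
  matrix of the vertices has the entries \<open>ch x\<^sub>i\<^sub>j = (x\<^sub>i\<^sub>j + 1 / x\<^sub>i\<^sub>j) / 2\<close>: the \<open>x\<^sub>i\<^sub>j\<close> are the exponentials of
  the lengths.  The angle configuration is the length configuration of the dual tetrahedron, whose
  vertices are the dual basis, so it can be computed from the cofactors \<open>C\<^sub>k\<^sub>l\<close> of the Gram matrix:
  the cross-ratio on the dual edge \<open>kl\<close> is \<open>(C\<^sub>k\<^sub>l + d sh x\<^sub>i\<^sub>j) / sqrt (C\<^sub>k\<^sub>k C\<^sub>l\<^sub>l)\<close>, where \<open>d\<close> is a square root of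
  the Gram determinant and \<open>ij\<close> the opposite edge (\<open>dual_edge_pt_eq\<close>, \<open>dual_edge_length\<close>).  The sign of
  \<open>d\<close> must be the same for all six edges.  This is so because the two families of generators are the
  eigenspaces of a Hodge operator on bivectors: a family is the choice of an eigenvalue \<open>k\<close>, a square root
  of the discriminant of the quadric, and \<open>d\<close> is \<open>k\<close> times the determinant of the \<open>v\<^sub>i\<close>
  (\<open>generator_family_class\<close>, \<open>generator_to_polar\<close>).

  The rest is algebra in the \<open>x\<^sub>i\<^sub>j\<close> and \<open>d\<close>.  The numerator of the Cho--Kim function minus its denominator
  is \<open>s t (a s\<^sup>2 + b s t + c t\<^sup>2)\<close>, with the principal parameters as zeros of the quadratic form.  The
  discriminant of this form is the square of \<open>4 \<Lambda> d\<close>, with \<open>\<Lambda>\<close> the product of all \<open>x\<^sub>i\<^sub>j\<close> (\<open>quad_disc\<close>).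
  Hence \<open>d\<close> also orders the principal parameters, they are different, and the map \<open>\<psi>\<close> of the theorem is
  given by two linear forms that are conjugate under \<open>d \<mapsto> - d\<close>.  At a triangle \<open>X = L\<^sub>a\<^sub>b\<^sub>c\<close> its value is
  \<open>(U - d) / (U + d)\<close>, where \<open>U\<close> is a trigonometric polynomial attached to the opposite vertex (\<open>apexU\<close>).
  The half-angle identity \<open>apex_product\<close> says that the angle value \<open>A\<^sub>a\<^sub>b\<^sub>c\<close> is the same: reversing the three
  edges at the opposite vertex one by one multiplies \<open>U + d\<close> by known factors and ends in \<open>d - U\<close>.  The
  values at circuits follow, as a circuit and the square of a diagonal combine to two triangles
  (\<open>circuit_relation\<close>).  So \<open>\<psi>\<close> takes one configuration to the other.  Then the zeros and poles of the two
  Cho--Kim functions correspond, and the functions themselves do, since both take the value 1 at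
  corresponding points (\<open>CK_invariance\<close>).

  For uniqueness, the only other map of the prescribed form belongs to the other order of the principal
  parameters and is \<open>1 / \<psi>\<close>.  If it also took the lengths to the angles, all angle values would be 1 or -1,
  which degenerates some face or dual edge (\<open>\<Psi>_minus_excluded\<close>).
\<close>

section \<open>Points of projective space and fractional linear maps\<close>

lemma Rep_point: "v \<noteq> 0 \<Longrightarrow> Rep_proj (point v) = vec.span {v}"
  unfolding point_def
  by (rule Abs_proj_inverse) (simp add: vec.dim_span vec.dim_eq_card_independent vec.independent_insert)

lemma Rep_proj_dest: "vec.subspace (Rep_proj p)" "vec.dim (Rep_proj p) = 1"
  using Rep_proj[of p] by auto

lemma coords: "coords p \<noteq> 0" "coords p \<in> Rep_proj p"
proof -
  have "\<exists>v. v \<noteq> 0 \<and> v \<in> Rep_proj p"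
  proof (rule ccontr)
    assume "\<not> ?thesis"
    then have "Rep_proj p \<subseteq> {0}" by auto
    then have "vec.dim (Rep_proj p) = 0" by (simp add: vec.dim_eq_0)
    then show False using Rep_proj_dest(2)[of p] by simp
  qed
  then have "coords p \<noteq> 0 \<and> coords p \<in> Rep_proj p" unfolding coords_def by (rule someI_ex)
  then show "coords p \<noteq> 0" "coords p \<in> Rep_proj p" by auto
qed

lemma dim_1_span:
  assumes "vec.subspace V" "vec.dim V = 1" "v \<in> V" "v \<noteq> (0 :: complex ^ 'n)"
  shows "V = vec.span {v}"
proof -
  have "vec.span {v} \<subseteq> V" using assms by (simp add: vec.span_minimal)
  moreover have "vec.dim (vec.span {v}) = 1"
    using assms(4) by (simp add: vec.dim_span vec.dim_eq_card_independent vec.independent_insert)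
  ultimately show ?thesis
    using vec.subspace_dim_equal[OF vec.subspace_span[of "{v}"] assms(1)] assms(2) by simp
qed

lemma Rep_proj_span: "v \<in> Rep_proj p \<Longrightarrow> v \<noteq> 0 \<Longrightarrow> Rep_proj p = vec.span {v}"
  by (rule dim_1_span[OF Rep_proj_dest])

lemma point_eqI: "v \<in> Rep_proj p \<Longrightarrow> v \<noteq> 0 \<Longrightarrow> point v = p"
  unfolding point_def using Rep_proj_span[of v p] Rep_proj_inverse[of p] by simp

lemma point_coords [simp]: "point (coords p) = p"
  by (rule point_eqI[OF coords(2) coords(1)])

lemma span_scale: "c \<noteq> 0 \<Longrightarrow> vec.span {c *s v} = vec.span {v :: complex ^ 'n}"
proof -
  assume c: "c \<noteq> 0"
  have "v = inverse c *s (c *s v)" using c by (simp add: vector_smult_assoc)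
  then have "v \<in> vec.span {c *s v}" by (metis vec.span_base vec.span_scale insertI1)
  moreover have "c *s v \<in> vec.span {v}" by (simp add: vec.span_base vec.span_scale)
  ultimately show ?thesis by (simp add: vec.span_eq)
qed

lemma point_scale: "c \<noteq> 0 \<Longrightarrow> point (c *s v) = point v"
  by (simp add: point_def span_scale)

lemma point_eqD: "point v = point w \<Longrightarrow> v \<noteq> 0 \<Longrightarrow> w \<noteq> 0 \<Longrightarrow> \<exists>c. c \<noteq> 0 \<and> w = c *s v"
proof -
  assume a: "point v = point w" "v \<noteq> 0" "w \<noteq> 0"
  then have "w \<in> vec.span {v}" using Rep_point[of v] Rep_point[of w] vec.span_base[of w "{w}"] by simp
  then obtain c where "w = c *s v" by (auto simp: vec.span_singleton)
  then show ?thesis using a(3) by (intro exI[of _ c]) auto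
qed

lemma coords_point: "v \<noteq> 0 \<Longrightarrow> \<exists>c. c \<noteq> 0 \<and> coords (point v) = c *s v"
  using point_eqD[of v "coords (point v)"] coords(1)[of "point v"] by simp

lemma point_in_pts: "v \<noteq> 0 \<Longrightarrow> vec.subspace V \<Longrightarrow> point v \<in> pts V \<longleftrightarrow> v \<in> V"
  unfolding pts_def by (auto simp: Rep_point vec.span_base intro: vec.span_minimal[THEN subsetD])

lemma proj_cases: obtains v where "v \<noteq> 0" "p = point v"
  by (metis point_coords coords(1))

lemma vec2_nz: "vector [a, b] \<noteq> (0 :: complex ^ 2) \<longleftrightarrow> a \<noteq> 0 \<or> b \<noteq> 0"
  by (simp add: vec_eq_iff forall_2)

lemma vec2_scale: "c *s vector [a, b] = (vector [c * a, c * b] :: complex ^ 2)"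
  by (simp add: vec_eq_iff forall_2)

lemma vec2_nz_iff: "(v :: complex ^ 2) \<noteq> 0 \<longleftrightarrow> v $ 1 \<noteq> 0 \<or> v $ 2 \<noteq> 0"
  by (simp add: vec_eq_iff forall_2)

lemma matrix_vector_2: "(m :: complex ^ 2 ^ 2) *v v = vector [m $ 1 $ 1 * v $ 1 + m $ 1 $ 2 * v $ 2, m $ 2 $ 1 * v $ 1 + m $ 2 $ 2 * v $ 2]"
  by (simp add: vec_eq_iff forall_2 matrix_vector_mult_def sum_2)

lemma det_nz_mv: "det (m :: complex ^ 'n ^ 'n) \<noteq> 0 \<Longrightarrow> v \<noteq> 0 \<Longrightarrow> m *v v \<noteq> 0"
  by (metis invertible_det_nz invertible_def matrix_vector_mul_assoc matrix_vector_mul_lid matrix_vector_mult_0_right)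

text \<open>A complex determinant has a square root, and dividing a matrix by it does not change the map on
  points.  So determinant 1 may be relaxed to invertibility.\<close>

lemma PSL2_iff: "\<psi> \<in> PSL2 \<longleftrightarrow> (\<exists>m. det m \<noteq> 0 \<and> (\<forall>v. v \<noteq> 0 \<longrightarrow> \<psi> (point v) = point (m *v v)))"
proof
  assume "\<psi> \<in> PSL2"
  then obtain m :: "complex ^ 2 ^ 2" where m: "det m = 1" "\<And>p. Rep_proj (\<psi> p) = (*v) m ` Rep_proj p"
    unfolding PSL2_def by auto
  have "\<psi> (point v) = point (m *v v)" if "v \<noteq> 0" for v
    using m(2)[of "point v"] that det_nz_mv[of m v] m(1)
    by (intro point_eqI[symmetric]) (auto simp: Rep_point vec.span_base)
  then show "\<exists>m. det m \<noteq> 0 \<and> (\<forall>v. v \<noteq> 0 \<longrightarrow> \<psi> (point v) = point (m *v v))"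
    using m(1) by (intro exI[of _ m]) auto
next
  assume "\<exists>m. det m \<noteq> 0 \<and> (\<forall>v. v \<noteq> 0 \<longrightarrow> \<psi> (point v) = point (m *v v))"
  then obtain m where m: "det m \<noteq> 0" "\<And>v. v \<noteq> 0 \<Longrightarrow> \<psi> (point v) = point (m *v v)" by auto
  define r where "r = csqrt (det m)"
  have r: "r \<noteq> 0" "r\<^sup>2 = det m" using m(1) unfolding r_def by auto
  define m' :: "complex ^ 2 ^ 2" where "m' = (\<chi> i j. m $ i $ j / r)"
  have m': "m' *v v = inverse r *s (m *v v)" for v
    unfolding m'_def by (simp add: vec_eq_iff forall_2 matrix_vector_mult_def sum_2 field_simps add_divide_distrib)
  have "det m' = 1"
    using r unfolding m'_def det_2 by (simp add: det_2 field_simps power2_eq_square)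
  moreover have "Rep_proj (\<psi> p) = (*v) m' ` Rep_proj p" for p
  proof -
    obtain v where v: "v \<noteq> 0" "p = point v" by (rule proj_cases)
    have n: "m' *v v \<noteq> 0" using det_nz_mv[of m' v] v \<open>det m' = 1\<close> by simp
    have "\<psi> p = point (m' *v v)"
      unfolding v(2) m(2)[OF v(1)] m' using r by (simp add: point_scale)
    then show ?thesis
      unfolding v(2) using v(1) n
      by (simp add: Rep_point vec.span_singleton image_image vec.scale)
  qed
  ultimately show "\<psi> \<in> PSL2" unfolding PSL2_def by auto
qed

lemma PSL2_comp: "\<phi> \<in> PSL2 \<Longrightarrow> \<psi> \<in> PSL2 \<Longrightarrow> \<phi> \<circ> \<psi> \<in> PSL2"
proof -
  assume "\<phi> \<in> PSL2" "\<psi> \<in> PSL2"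
  then obtain m m' where m: "det m \<noteq> 0" "\<And>v. v \<noteq> 0 \<Longrightarrow> \<phi> (point v) = point (m *v v)"
    "det m' \<noteq> 0" "\<And>v. v \<noteq> 0 \<Longrightarrow> \<psi> (point v) = point (m' *v v)" unfolding PSL2_iff by blast
  then have "det (m ** m') \<noteq> 0" "\<And>v. v \<noteq> 0 \<Longrightarrow> (\<phi> \<circ> \<psi>) (point v) = point ((m ** m') *v v)"
    by (simp_all add: det_mul det_nz_mv matrix_vector_mul_assoc)
  then show ?thesis unfolding PSL2_iff by blast
qed

lemma PSL2_inverse:
  assumes "\<psi> \<in> PSL2" obtains \<phi> where "\<phi> \<in> PSL2" "\<phi> \<circ> \<psi> = id" "\<psi> \<circ> \<phi> = id"
proof -
  obtain m where m: "det m \<noteq> 0" "\<And>v. v \<noteq> 0 \<Longrightarrow> \<psi> (point v) = point (m *v v)"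
    using assms unfolding PSL2_iff by blast
  then obtain m' where m': "m ** m' = mat 1" "m' ** m = mat 1"
    using invertible_det_nz[of m] unfolding invertible_def by blast
  then have d: "det m' \<noteq> 0" by (metis det_I det_mul mult_zero_right zero_neq_one)
  define \<phi> where "\<phi> p = point (m' *v coords p)" for p
  have \<phi>: "\<phi> (point v) = point (m' *v v)" if v: "v \<noteq> 0" for v
  proof -
    obtain c where "c \<noteq> 0" "coords (point v) = c *s v" using coords_point[OF v] by blast
    then show ?thesis unfolding \<phi>_def by (simp add: vec.scale point_scale)
  qed
  have "\<phi> \<in> PSL2" unfolding PSL2_iff using d \<phi> by blast
  moreover have "(\<phi> \<circ> \<psi>) p = p" "(\<psi> \<circ> \<phi>) p = p" for p
    by (rule proj_cases[of p]; simp add: m \<phi> det_nz_mv d m' matrix_vector_mul_assoc)+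
  ultimately show thesis by (intro that[of \<phi>]) auto
qed

lemma PSL2_fractional_linear:
  assumes "a * d - b * c \<noteq> 0"
    and "\<And>t. \<psi> t = point (vector [a * coords t $ 1 + b * coords t $ 2, c * coords t $ 1 + d * coords t $ 2])"
  shows "\<psi> \<in> PSL2"
proof -
  define m :: "complex ^ 2 ^ 2" where "m = vector [vector [a, b], vector [c, d]]"
  have "det m \<noteq> 0" using assms(1) by (simp add: m_def det_2 mult.commute)
  moreover have "\<psi> (point v) = point (m *v v)" if v: "v \<noteq> 0" for v
  proof -
    obtain k where k: "k \<noteq> 0" "coords (point v) = k *s v" using coords_point[OF v] by blast
    have "\<psi> (point v) = point (m *v coords (point v))"
      unfolding assms(2) m_def by (simp add: matrix_vector_2)
    also have "\<dots> = point (m *v v)" by (simp add: k vec.scale point_scale)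
    finally show ?thesis .
  qed
  ultimately show ?thesis unfolding PSL2_iff by blast
qed


section \<open>Fractional linear maps between Cho--Kim configurations\<close>

text \<open>For zeros \<open>n1, \<dots>, n4\<close> and poles \<open>1, d1, d2, d3\<close> with the same product, the numerator of the
  Cho--Kim function minus its denominator has no \<open>s\<^sup>4\<close> and no \<open>t\<^sup>4\<close> term, so it is \<open>s * t\<close> times a
  quadratic form in \<open>(s, t)\<close>.  These are the coefficients of that form; its zeros are the principal
  parameters.\<close>

definition quad_a where
  "quad_a n1 n2 n3 n4 d1 d2 d3 = 1 + d1 + d2 + d3 - (n1 + n2 + n3 + n4 :: complex)"
definition quad_b where
  "quad_b n1 n2 n3 n4 d1 d2 d3 = n1 * n2 + n1 * n3 + n1 * n4 + n2 * n3 + n2 * n4 + n3 * n4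
     - (d1 + d2 + d3 + d1 * d2 + d1 * d3 + d2 * d3 :: complex)"
definition quad_c where
  "quad_c n1 n2 n3 n4 d1 d2 d3 = d1 * d2 + d1 * d3 + d2 * d3 + d1 * d2 * d3
     - (n1 * n2 * n3 + n1 * n2 * n4 + n1 * n3 * n4 + n2 * n3 * n4 :: complex)"

definition principal_pair :: "complex list \<Rightarrow> 2 proj \<Rightarrow> 2 proj \<Rightarrow> bool" where
  "principal_pair X p1 p2 \<longleftrightarrow>
     (\<exists>c. c \<noteq> 0 \<and> (\<forall>t. CK_num X (coords t) - CK_den X (coords t) =
        c * coords t $ 1 * coords t $ 2 * bracket t p1 * bracket t p2))"

text \<open>The polarization of the quadratic form \<open>a * s\<^sup>2 + b * s * t + c * t\<^sup>2\<close> at \<open>(s, t)\<close> and \<open>(1, 1)\<close>,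
  plus half of \<open>e\<close> times the determinant of these two vectors.  When \<open>e\<^sup>2\<close> is the discriminant, this is
  the product of two linear factors of the form, one evaluated at \<open>(s, t)\<close> and the other at \<open>(1, 1)\<close>;
  changing the sign of \<open>e\<close> exchanges the two factors.  So the quotient for \<open>e\<close> and \<open>- e\<close> is the
  fractional linear function with one principal parameter as zero, the other as pole, and value 1 at 1.
  Unlike a formula for the roots, it covers principal parameters at infinity.\<close>

definition polar_form :: "complex \<Rightarrow> complex \<Rightarrow> complex \<Rightarrow> complex \<Rightarrow> complex \<Rightarrow> complex \<Rightarrow> complex" where
  "polar_form a b c e s t = a * s + b * (s + t) / 2 + c * t + e * (s - t) / 2"

text \<open>A nonzero 2 by 2 matrix of determinant 0 is the product of a column and a row.  Applied to the
  coefficients of a quadratic form with split middle coefficient, this factors the form into linear forms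
  whether or not a root is at infinity.\<close>

lemma rank_one_matrix:
  fixes a c p q :: complex
  assumes "p * q = a * c" "p \<noteq> 0 \<or> q \<noteq> 0"
  obtains x1 y1 x2 y2 where "y1 * y2 = a" "x1 * x2 = c" "x1 * y2 = p" "y1 * x2 = q"
    "x1 \<noteq> 0 \<or> y1 \<noteq> 0" "x2 \<noteq> 0 \<or> y2 \<noteq> 0"
proof (cases "p = 0")
  case False
  show thesis
    by (rule that[where ?x1.0 = 1 and ?y2.0 = p and ?x2.0 = c and ?y1.0 = "a / p"])
      (use False assms in \<open>auto simp: field_simps\<close>)
next
  case True
  show thesis
    by (rule that[where ?x1.0 = "c / q" and ?y2.0 = a and ?x2.0 = q and ?y1.0 = 1])
      (use True assms in \<open>auto simp: field_simps\<close>)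
qed

text \<open>What the theorem says about two configurations of numbers: with \<open>D\<close> a square root of the
  discriminant, the fractional linear function \<open>polar_form D / polar_form (- D)\<close> takes the first
  configuration (zeros \<open>n\<close>, poles 1 and \<open>d\<close>) to the second one (zeros \<open>m\<close>, poles 1 and \<open>e\<close>).  The
  conditions \<open>generic\<close> exclude that the function for \<open>- D\<close> does the same.\<close>

locale cho_kim_pair =
  fixes n1 n2 n3 n4 d1 d2 d3 m1 m2 m3 m4 e1 e2 e3 a b c D :: complex
  assumes prod: "n1 * n2 * n3 * n4 = d1 * d2 * d3" and prod': "m1 * m2 * m3 * m4 = e1 * e2 * e3"
    and a: "a = quad_a n1 n2 n3 n4 d1 d2 d3"
    and b: "b = quad_b n1 n2 n3 n4 d1 d2 d3"
    and c: "c = quad_c n1 n2 n3 n4 d1 d2 d3"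
    and n_ne: "n1 \<noteq> 1" "n2 \<noteq> 1" "n3 \<noteq> 1" "n4 \<noteq> 1"
    and m_ne: "m1 \<noteq> 0" "m2 \<noteq> 0" "m3 \<noteq> 0" "m4 \<noteq> 0"
    and disc: "D\<^sup>2 = b\<^sup>2 - 4 * a * c" "D \<noteq> 0"
    and rel: "m1 * polar_form a b c (- D) n1 1 = polar_form a b c D n1 1"
      "m2 * polar_form a b c (- D) n2 1 = polar_form a b c D n2 1"
      "m3 * polar_form a b c (- D) n3 1 = polar_form a b c D n3 1"
      "m4 * polar_form a b c (- D) n4 1 = polar_form a b c D n4 1"
      "e1 * polar_form a b c (- D) d1 1 = polar_form a b c D d1 1"
      "e2 * polar_form a b c (- D) d2 1 = polar_form a b c D d2 1"
      "e3 * polar_form a b c (- D) d3 1 = polar_form a b c D d3 1"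
    and generic: "n1 \<noteq> d2" "m1 * m2 \<noteq> e2"
begin

abbreviation "XL \<equiv> [1, n1, n2, n3, n4, d1, d2, d3]"
abbreviation "XA \<equiv> [1, m1, m2, m3, m4, e1, e2, e3]"
abbreviation "R \<equiv> polar_form a b c"

definition \<Psi> :: "complex \<Rightarrow> 2 proj \<Rightarrow> 2 proj" where
  "\<Psi> e t = point (vector [R e (coords t $ 1) (coords t $ 2), R (- e) (coords t $ 1) (coords t $ 2)])"

lemma R_scale: "R e (k * s) (k * t) = k * R e s t"
  by (simp add: polar_form_def field_simps)

lemma \<Psi>_point: "v \<noteq> 0 \<Longrightarrow> \<Psi> e (point v) = point (vector [R e (v $ 1) (v $ 2), R (- e) (v $ 1) (v $ 2)])"
  using coords_point[of v] by (auto simp: \<Psi>_def R_scale point_scale simp flip: vec2_scale)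

lemma abc_nz: "a + b + c \<noteq> 0"
proof -
  have "a + b + c = (1 - n1) * (1 - n2) * (1 - n3) * (1 - n4)"
    using prod unfolding a b c quad_a_def quad_b_def quad_c_def by algebra
  then show ?thesis using n_ne by simp
qed

lemma difference: "CK_num XL v - CK_den XL v = v $ 1 * v $ 2 * (a * (v $ 1)\<^sup>2 + b * v $ 1 * v $ 2 + c * (v $ 2)\<^sup>2)"
proof -
  have "CK_num XL v - CK_den XL v =
    (v $ 1 - n1 * v $ 2) * (v $ 1 - n2 * v $ 2) * (v $ 1 - n3 * v $ 2) * (v $ 1 - n4 * v $ 2)
    - (v $ 1 - v $ 2) * (v $ 1 - d1 * v $ 2) * (v $ 1 - d2 * v $ 2) * (v $ 1 - d3 * v $ 2)"
    by (simp add: CK_num_def CK_den_def)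
  also have "\<dots> = v $ 1 * v $ 2 * (a * (v $ 1)\<^sup>2 + b * v $ 1 * v $ 2 + c * (v $ 2)\<^sup>2)"
    using prod unfolding a b c quad_a_def quad_b_def quad_c_def by algebra
  finally show ?thesis .
qed

lemma R_det:
  "R e s t = (a + b / 2 + e / 2) * s + (c + b / 2 - e / 2) * t"
  by (simp add: polar_form_def field_simps)

lemma \<Psi>_PSL2:
  assumes "e \<noteq> 0" shows "\<Psi> e \<in> PSL2"
proof -
  have "(a + b / 2 + e / 2) * (c + b / 2 - - e / 2) - (c + b / 2 - e / 2) * (a + b / 2 + - e / 2) = e * (a + b + c)"
    by (simp add: field_simps)
  then have "(a + b / 2 + e / 2) * (c + b / 2 - - e / 2) - (c + b / 2 - e / 2) * (a + b / 2 + - e / 2) \<noteq> 0"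
    using assms abc_nz by simp
  then show ?thesis
    by (rule PSL2_fractional_linear) (simp add: \<Psi>_def R_det)
qed

lemma R_nz:
  assumes "A * R (- D) X 1 = R D X 1" shows "R (- D) X 1 \<noteq> 0"
proof
  assume z: "R (- D) X 1 = 0"
  then have "R D X 1 = 0" using assms by simp
  then have "R D X 1 - R (- D) X 1 = 0" using z by simp
  then have "D * (X - 1) = 0" by (simp add: polar_form_def field_simps)
  then have "X = 1" using disc(2) by simp
  then show False using z abc_nz by (simp add: polar_form_def)
qed

lemma affine_nz: "vector [z, 1] \<noteq> (0 :: complex ^ 2)" by (simp add: vec2_nz)

lemma \<Psi>_affine:
  assumes "A * R (- D) X 1 = R D X 1" shows "\<Psi> D (affine_pt X) = affine_pt A"
proof -
  have "\<Psi> D (affine_pt X) = point (vector [R D X 1, R (- D) X 1])"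
    unfolding affine_pt_def by (simp add: \<Psi>_point affine_nz)
  also have "\<dots> = point (R (- D) X 1 *s vector [A, 1])"
    using assms by (simp add: vec2_scale mult.commute)
  finally show ?thesis using R_nz[OF assms] by (simp add: point_scale affine_pt_def)
qed

lemma \<Psi>_affine_swapped:
  assumes "A * R (- D) X 1 = R D X 1" "\<Psi> (- D) (affine_pt X) = affine_pt A"
  shows "A\<^sup>2 = 1"
proof -
  have "point (vector [A, 1]) = \<Psi> (- D) (affine_pt X)" using assms(2) by (simp add: affine_pt_def)
  also have "\<dots> = point (vector [R (- D) X 1, R D X 1])"
    unfolding affine_pt_def by (simp add: \<Psi>_point affine_nz)
  finally have "\<exists>k. k \<noteq> 0 \<and> vector [R (- D) X 1, R D X 1] = k *s (vector [A, 1] :: complex ^ 2)"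
    by (rule point_eqD) (use R_nz[OF assms(1)] in \<open>simp_all add: vec2_nz\<close>)
  then obtain k where "R (- D) X 1 = k * A" "R D X 1 = k" "k \<noteq> 0"
    by (auto simp: vec_eq_iff forall_2)
  then show ?thesis using assms(1) by (simp add: power2_eq_square)
qed

lemma rel_all: "k < 8 \<Longrightarrow> XA ! k * R (- D) (XL ! k) 1 = R D (XL ! k) 1"
proof -
  have z: "1 * R (- D) 1 1 = R D 1 1" by (simp add: polar_form_def)
  assume "k < 8"
  then have "k \<in> {0, 1, 2, 3, 4, 5, 6, 7}" by auto
  then show ?thesis using rel z by auto
qed

text \<open>Both sides are linear forms in \<open>(s, t)\<close> that vanish at \<open>(X, 1)\<close>.\<close>

lemma linear_factor:
  assumes "A * R (- D) X 1 = R D X 1"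
  shows "R D s t - A * R (- D) s t = ((a + b / 2 + D / 2) - A * (a + b / 2 - D / 2)) * (s - X * t)"
proof -
  define p q p' q' where "p = a + b / 2 + D / 2" and "q = c + b / 2 - D / 2"
    and "p' = a + b / 2 - D / 2" and "q' = c + b / 2 + D / 2"
  have R: "R D s t = p * s + q * t" "R (- D) s t = p' * s + q' * t" for s t
    by (simp_all add: R_det p_def q_def p'_def q'_def)
  have "A * (p' * X + q' * 1) = p * X + q * 1" using assms unfolding R .
  then have "p * s + q * t - A * (p' * s + q' * t) = (p - A * p') * (s - X * t)" by algebra
  then show ?thesis unfolding R p_def p'_def .
qed

text \<open>By \<open>linear_factor\<close>, each linear factor of the second Cho--Kim function pulls back to a multiple of the
  corresponding factor of the first one, so the two functions agree up to a constant.  The constant is 1,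
  because the first function is 1 at the principal parameter which \<open>\<Psi> D\<close> sends to 0, and the second one
  is 1 at 0.\<close>

lemma CK_invariance: "CK XL t = CK XA (\<Psi> D t)"
proof -
  define h where "h A = (a + b / 2 + D / 2) - A * (a + b / 2 - D / 2)" for A
  define u where "u v = (vector [R D (v $ 1) (v $ 2), R (- D) (v $ 1) (v $ 2)] :: complex ^ 2)" for v :: "complex ^ 2"
  note lf = linear_factor[OF rel(1)] linear_factor[OF rel(2)] linear_factor[OF rel(3)] linear_factor[OF rel(4)]
    linear_factor[OF rel(5)] linear_factor[OF rel(6)] linear_factor[OF rel(7)]
  define hn where "hn = h m1 * h m2 * h m3 * h m4"
  define hd where "hd = h 1 * h e1 * h e2 * h e3"
  have num: "CK_num XA (u v) = hn * CK_num XL v" for v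
    unfolding CK_num_def u_def hn_def h_def by (simp add: lf)
  have one: "R D s t - R (- D) s t = h 1 * (s - t)" for s t
    by (simp add: R_det h_def field_simps)
  have den: "CK_den XA (u v) = hd * CK_den XL v" for v
    unfolding CK_den_def u_def hd_def by (simp add: lf one h_def)
  \<comment> \<open>The principal parameter that is sent to 0.\<close>
  define v0 :: "complex ^ 2" where "v0 = vector [- (c + b / 2 - D / 2), a + b / 2 + D / 2]"
  have R0: "R D (v0 $ 1) (v0 $ 2) = 0" unfolding v0_def by (simp add: R_det field_simps)
  define r where "r = R (- D) (v0 $ 1) (v0 $ 2)"
  have "r = D * (a + b + c)" unfolding r_def v0_def by (simp add: R_det field_simps)
  then have r: "r \<noteq> 0" using disc(2) abc_nz by simp
  have "R D s t * R (- D) s t = (a * s\<^sup>2 + b * s * t + c * t\<^sup>2) * (a + b + c)" for s t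
  proof -
    have "4 * (R D s t * R (- D) s t) = (2 * a * s + b * (s + t) + 2 * c * t)\<^sup>2 - D\<^sup>2 * (s - t)\<^sup>2"
      unfolding polar_form_def by (simp add: field_simps power2_eq_square)
    also have "\<dots> = 4 * ((a * s\<^sup>2 + b * s * t + c * t\<^sup>2) * (a + b + c))"
      unfolding disc(1) by algebra
    finally show ?thesis by simp
  qed
  from this[of "v0 $ 1" "v0 $ 2"] have "a * (v0 $ 1)\<^sup>2 + b * v0 $ 1 * v0 $ 2 + c * (v0 $ 2)\<^sup>2 = 0"
    using R0 abc_nz by simp
  then have eq: "CK_num XL v0 = CK_den XL v0" using difference[of v0] by simp
  have "CK_num XA (u v0) = r ^ 4 * (m1 * m2 * m3 * m4)"
    unfolding CK_num_def u_def using R0 by (simp add: r_def power4_eq_xxxx)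
  moreover have "CK_den XA (u v0) = r ^ 4 * (e1 * e2 * e3)"
    unfolding CK_den_def u_def using R0 by (simp add: r_def power4_eq_xxxx)
  ultimately have "hn * CK_num XL v0 = r ^ 4 * (m1 * m2 * m3 * m4)" "hd * CK_num XL v0 = r ^ 4 * (m1 * m2 * m3 * m4)"
    using num[of v0] den[of v0] eq prod' by simp_all
  moreover have "r ^ 4 * (m1 * m2 * m3 * m4) \<noteq> 0" using r m_ne by simp
  ultimately have h: "hn = hd" "hn \<noteq> 0" by (metis mult_cancel_right mult_eq_0_iff)+
  have detR: "2 * (D * (a + b + c) * s) = 0" "2 * (D * (a + b + c) * t) = 0"
    if "2 * R D s t = 0" "2 * R (- D) s t = 0" for s t
  proof -
    have "2 * a * s + b * (s + t) + 2 * c * t + D * (s - t) = 0" "2 * a * s + b * (s + t) + 2 * c * t - D * (s - t) = 0"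
    proof -
      have "2 * R e s t = 2 * a * s + b * (s + t) + 2 * c * t + e * (s - t)" for e
        unfolding polar_form_def by (simp add: field_simps)
      from this[of D] this[of "- D"] that
      show "2 * a * s + b * (s + t) + 2 * c * t + D * (s - t) = 0" "2 * a * s + b * (s + t) + 2 * c * t - D * (s - t) = 0"
        by simp_all
    qed
    then show "2 * (D * (a + b + c) * s) = 0" "2 * (D * (a + b + c) * t) = 0" by algebra+
  qed
  \<comment> \<open>The two linear forms have no common zero, so the image point has the coordinates \<open>u v\<close>.\<close>
  have u_nz: "u v \<noteq> 0" if "v \<noteq> 0" for v
  proof
    assume "u v = 0"
    then have "R D (v $ 1) (v $ 2) = 0" "R (- D) (v $ 1) (v $ 2) = 0"
      unfolding u_def by (metis vec2_nz)+
    then have "D * (a + b + c) * v $ 1 = 0" "D * (a + b + c) * v $ 2 = 0"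
      using detR[of "v $ 1" "v $ 2"] by simp_all
    then show False using disc(2) abc_nz that by (simp add: vec2_nz_iff)
  qed
  define v where "v = coords t"
  have v: "v \<noteq> 0" unfolding v_def by (rule coords)
  obtain k where k: "k \<noteq> 0" "coords (\<Psi> D t) = k *s u v"
    using coords_point[OF u_nz[OF v]] unfolding \<Psi>_def u_def v_def by blast
  have "CK XA (\<Psi> D t) = point (vector [k ^ 4 * CK_num XA (u v), k ^ 4 * CK_den XA (u v)])"
    unfolding CK_def k(2)
    by (rule arg_cong[of _ _ point]) (simp add: CK_num_def CK_den_def vec_eq_iff forall_2 power4_eq_xxxx algebra_simps)
  also have "\<dots> = point ((k ^ 4 * hn) *s vector [CK_num XL v, CK_den XL v])"
    by (simp add: num den h vec2_scale mult.assoc)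
  also have "\<dots> = CK XL t" using k(1) h(2) by (simp add: point_scale CK_def v_def)
  finally show ?thesis ..
qed

lemma cross_ratio_\<Psi>:
  assumes "k \<noteq> 0" and abc: "a = k * coords p1 $ 2 * coords p2 $ 2"
    "b = - k * (coords p1 $ 2 * coords p2 $ 1 + coords p1 $ 1 * coords p2 $ 2)"
    "c = k * coords p1 $ 1 * coords p2 $ 1"
  shows "cross_ratio t p1 (affine_pt 1) p2 =
    \<Psi> (k * (coords p1 $ 1 * coords p2 $ 2 - coords p1 $ 2 * coords p2 $ 1)) t"
proof -
  define e where "e = k * (coords p1 $ 1 * coords p2 $ 2 - coords p1 $ 2 * coords p2 $ 1)"
  obtain l where l: "l \<noteq> 0" "coords (affine_pt 1) = l *s vector [1, 1]"
    using coords_point[OF affine_nz[of 1]] unfolding affine_pt_def by blast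
  have "bracket t p1 * bracket (affine_pt 1) p2 = l / k * R e (coords t $ 1) (coords t $ 2)"
    "bracket t p2 * bracket (affine_pt 1) p1 = l / k * R (- e) (coords t $ 1) (coords t $ 2)"
    using assms(1) unfolding bracket_def l(2) polar_form_def e_def abc by (simp_all add: field_simps)
  then have "cross_ratio t p1 (affine_pt 1) p2 = point ((l / k) *s vector [R e (coords t $ 1) (coords t $ 2), R (- e) (coords t $ 1) (coords t $ 2)])"
    unfolding cross_ratio_def by (simp add: vec2_scale bracket_def)
  then show ?thesis using l(1) assms(1) by (simp add: point_scale \<Psi>_def e_def)
qed

text \<open>A pair of principal parameters is a factorization of the quadratic form, and the sign of \<open>e\<close> in
  \<open>polar_form\<close> is the only trace of the order of the two factors.\<close>

lemma principal_pair_\<Psi>: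
  assumes "principal_pair XL p1 p2"
  shows "(\<forall>t. cross_ratio t p1 (affine_pt 1) p2 = \<Psi> D t) \<or> (\<forall>t. cross_ratio t p1 (affine_pt 1) p2 = \<Psi> (- D) t)"
proof -
  define x1 y1 x2 y2 where xy: "x1 = coords p1 $ 1" "y1 = coords p1 $ 2" "x2 = coords p2 $ 1" "y2 = coords p2 $ 2"
  obtain k where k: "k \<noteq> 0" "\<And>t. CK_num XL (coords t) - CK_den XL (coords t) =
        k * coords t $ 1 * coords t $ 2 * bracket t p1 * bracket t p2"
    using assms unfolding principal_pair_def by blast
  \<comment> \<open>Comparing the two sides at the points 1, -1 and 2 gives the coefficients.\<close>
  have val: "a * z\<^sup>2 + b * z + c = k * (z * y1 - x1) * (z * y2 - x2)" if z: "z \<noteq> 0" for z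
  proof -
    obtain l where l: "l \<noteq> 0" "coords (affine_pt z) = l *s vector [z, 1]"
      using coords_point[OF affine_nz[of z]] unfolding affine_pt_def by blast
    have "l * z * l * (a * (l * z)\<^sup>2 + b * (l * z) * l + c * l\<^sup>2) = k * (l * z) * l * (l * z * y1 - l * x1) * (l * z * y2 - l * x2)"
      using k(2)[of "affine_pt z"] unfolding difference bracket_def l(2) xy by simp
    then have "l ^ 4 * z * (a * z\<^sup>2 + b * z + c) = l ^ 4 * z * (k * (z * y1 - x1) * (z * y2 - x2))"
      by algebra
    then show ?thesis using l(1) z by simp
  qed
  have v1: "a + b + c = k * (y1 - x1) * (y2 - x2)" using val[of 1] by simp
  have v2: "a - b + c = k * (- y1 - x1) * (- y2 - x2)" using val[of "-1"] by simp
  have v3: "4 * a + 2 * b + c = k * (2 * y1 - x1) * (2 * y2 - x2)" using val[of 2] by (simp add: algebra_simps)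
  have "6 * a = 6 * (k * y1 * y2)" using v1 v2 v3 by algebra
  then have a': "a = k * y1 * y2" by simp
  have "2 * b = 2 * (- k * (y1 * x2 + x1 * y2))" using v1 v2 by algebra
  then have b': "b = - k * (y1 * x2 + x1 * y2)" by simp
  have c': "c = k * x1 * x2" using v1 a' b' by algebra
  define e where "e = k * (x1 * y2 - y1 * x2)"
  have "e\<^sup>2 = D\<^sup>2" unfolding disc(1) a' b' c' e_def by algebra
  then have "e = D \<or> e = - D" by (simp add: power2_eq_iff)
  moreover have "cross_ratio t p1 (affine_pt 1) p2 = \<Psi> e t" for t
    using cross_ratio_\<Psi>[OF k(1), of p1 p2 t] a' b' c' unfolding xy e_def by simp
  ultimately show ?thesis by auto
qed

lemma principal_pair_exists: "\<exists>p1 p2. principal_pair XL p1 p2 \<and> (\<forall>t. \<Psi> D t = cross_ratio t p1 (affine_pt 1) p2)"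
proof -
  have D4: "(D - b) / 2 * ((- b - D) / 2) = a * c" using disc(1) by (simp add: field_simps power2_eq_square)
  have "(D - b) / 2 \<noteq> 0 \<or> (- b - D) / 2 \<noteq> 0" using disc(2) by auto
  from rank_one_matrix[OF D4 this]
  obtain x1 y1 x2 y2 where f: "y1 * y2 = a" "x1 * x2 = c" "x1 * y2 = (D - b) / 2" "y1 * x2 = (- b - D) / 2"
    and nz: "x1 \<noteq> 0 \<or> y1 \<noteq> 0" "x2 \<noteq> 0 \<or> y2 \<noteq> 0" .
  define p1 where "p1 = point (vector [x1, y1] :: complex ^ 2)"
  define p2 where "p2 = point (vector [x2, y2] :: complex ^ 2)"
  obtain k1 where k1: "k1 \<noteq> 0" "coords p1 = k1 *s vector [x1, y1]"
    using coords_point[of "vector [x1, y1] :: complex ^ 2"] nz(1) unfolding p1_def vec2_nz by blast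
  obtain k2 where k2: "k2 \<noteq> 0" "coords p2 = k2 *s vector [x2, y2]"
    using coords_point[of "vector [x2, y2] :: complex ^ 2"] nz(2) unfolding p2_def vec2_nz by blast
  define k where "k = inverse (k1 * k2)"
  have k: "k \<noteq> 0" using k1 k2 by (simp add: k_def)
  have kk: "k * k1 * k2 = 1" using k1(1) k2(1) by (simp add: k_def field_simps)
  have xy: "coords p1 $ 1 = k1 * x1" "coords p1 $ 2 = k1 * y1" "coords p2 $ 1 = k2 * x2" "coords p2 $ 2 = k2 * y2"
    unfolding k1 k2 by simp_all
  have "2 * (x1 * y2) = D - b" "2 * (y1 * x2) = - b - D" unfolding f(3,4) by simp_all
  then have b2: "2 * b = 2 * (- (y1 * x2 + x1 * y2))" and D2: "2 * D = 2 * (x1 * y2 - y1 * x2)" by algebra+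
  have cancel: "s = t" if "2 * s = 2 * t" for s t :: complex using that by simp
  note bb = cancel[OF b2] cancel[OF D2]
  have abc: "a = k * coords p1 $ 2 * coords p2 $ 2"
    unfolding xy using kk f(1) by algebra
  have abc_b: "b = - k * (coords p1 $ 2 * coords p2 $ 1 + coords p1 $ 1 * coords p2 $ 2)"
    unfolding xy using kk bb(1) by algebra
  have abc_c: "c = k * coords p1 $ 1 * coords p2 $ 1"
    unfolding xy using kk f(2) by algebra
  have abc_D: "D = k * (coords p1 $ 1 * coords p2 $ 2 - coords p1 $ 2 * coords p2 $ 1)"
    unfolding xy using kk bb(2) by algebra
  have "principal_pair XL p1 p2"
    unfolding principal_pair_def difference bracket_def
    unfolding abc abc_b abc_c using k by (intro exI[of _ k] conjI allI) (assumption, algebra)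
  moreover have "\<Psi> D t = cross_ratio t p1 (affine_pt 1) p2" for t
    using cross_ratio_\<Psi>[OF k abc abc_b abc_c, folded abc_D] by simp
  ultimately show ?thesis by blast
qed

lemma m_ne_1:
  assumes "m * R (- D) n 1 = R D n 1" "n \<noteq> 1" shows "m \<noteq> 1"
proof
  assume "m = 1"
  then have "D * (n - 1) = 0" using assms(1) by (simp add: polar_form_def field_simps)
  then show False using assms(2) disc(2) by simp
qed

text \<open>The two functions are reciprocal, so a value at which they agree is 1 or -1.  If they agree on the whole first configuration, then
  \<open>m1 = m2 = - 1\<close>, so \<open>e2\<close> is -1 by the second condition in \<open>generic\<close>, and then \<open>n1 = d2\<close> since the map
  is injective.\<close>

lemma \<Psi>_minus_excluded: "\<not> (\<forall>k<8. \<Psi> (- D) (affine_pt (XL ! k)) = affine_pt (XA ! k))"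
proof
  assume *: "\<forall>k<8. \<Psi> (- D) (affine_pt (XL ! k)) = affine_pt (XA ! k)"
  have sq: "(XA ! k)\<^sup>2 = 1" if "k < 8" for k
    using \<Psi>_affine_swapped[OF rel_all[OF that]] * that by blast
  have m: "m1 = - 1" "m2 = - 1"
    using sq[of 1] sq[of 2] m_ne_1[OF rel(1)] m_ne_1[OF rel(2)] n_ne by (auto simp: power2_eq_1_iff)
  then have "e2 = - 1" using sq[of 6] generic(2) by (auto simp: power2_eq_1_iff)
  then have "R D n1 1 = - R (- D) n1 1" "R D d2 1 = - R (- D) d2 1"
    using rel(1)[symmetric] rel(6)[symmetric] m by simp_all
  then have "R D n1 1 + R (- D) n1 1 = 0" "R D d2 1 + R (- D) d2 1 = 0" by simp_all
  moreover have "R D s 1 + R (- D) s 1 = (2 * a + b) * s + (2 * c + b)" for s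
    by (simp add: polar_form_def field_simps)
  ultimately have l: "(2 * a + b) * n1 + (2 * c + b) = 0" "(2 * a + b) * d2 + (2 * c + b) = 0" by simp_all
  then have "(2 * a + b) * (n1 - d2) = 0" by algebra
  then have "2 * a + b = 0" using generic(1) by simp
  moreover from this have "2 * c + b = 0" using l by simp
  ultimately have "2 * (a + b + c) = 0" by algebra
  then show False using abc_nz by (metis mult_eq_0_iff zero_neq_numeral)
qed

text \<open>The maps \<open>\<psi>\<close> with \<open>CK XL t = CK XA (\<psi> t)\<close> form a single coset \<open>\<Psi> D \<circ> \<sigma>\<close> of the group of
  automorphisms \<open>\<sigma>\<close> of \<open>CK XL\<close>, whence the last equivalence.  The prescribed shape of \<open>\<psi>\<close> leaves the two
  candidates \<open>\<Psi> D\<close> and \<open>\<Psi> (- D)\<close>.\<close>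

theorem moebius_equivalence:
  "(\<exists>!\<psi>. \<psi> \<in> PSL2 \<and> (\<forall>t. CK XL t = CK XA (\<psi> t)) \<and>
      (\<exists>p1 p2. principal_pair XL p1 p2 \<and> (\<forall>t. \<psi> t = cross_ratio t p1 (affine_pt 1) p2)) \<and>
      (\<forall>k<8. \<psi> (affine_pt (XL ! k)) = affine_pt (XA ! k))) \<and>
   ((\<exists>!\<psi>. \<psi> \<in> PSL2 \<and> (\<forall>t. CK XL t = CK XA (\<psi> t))) \<longleftrightarrow>
      (\<forall>\<sigma>\<in>PSL2. (\<forall>t. CK XL (\<sigma> t) = CK XL t) \<longrightarrow> \<sigma> = id))"
    (is "(\<exists>!\<psi>. ?P \<psi>) \<and> (?l \<longleftrightarrow> ?r)")
proof (intro conjI)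
  show "\<exists>!\<psi>. ?P \<psi>"
  proof (rule ex1I[of _ "\<Psi> D"], intro conjI allI impI)
    show "\<Psi> D \<in> PSL2" by (rule \<Psi>_PSL2[OF disc(2)])
    show "CK XL t = CK XA (\<Psi> D t)" for t by (rule CK_invariance)
    show "\<exists>p1 p2. principal_pair XL p1 p2 \<and> (\<forall>t. \<Psi> D t = cross_ratio t p1 (affine_pt 1) p2)"
      by (rule principal_pair_exists)
    show "\<Psi> D (affine_pt (XL ! k)) = affine_pt (XA ! k)" if "k < 8" for k
      by (rule \<Psi>_affine[OF rel_all[OF that]])
  next
    fix \<psi>
    assume "?P \<psi>"
    then obtain p1 p2 where p: "principal_pair XL p1 p2" "\<And>t. \<psi> t = cross_ratio t p1 (affine_pt 1) p2"
      and k: "\<forall>k<8. \<psi> (affine_pt (XL ! k)) = affine_pt (XA ! k)" by blast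
    from principal_pair_\<Psi>[OF p(1)] have "\<psi> = \<Psi> D \<or> \<psi> = \<Psi> (- D)" unfolding fun_eq_iff p(2) by blast
    then show "\<psi> = \<Psi> D" using k \<Psi>_minus_excluded by blast
  qed
  show "?l \<longleftrightarrow> ?r"
  proof
    assume u: ?l
    obtain \<phi> where \<phi>: "\<phi> \<in> PSL2" "\<phi> \<circ> \<Psi> D = id" using PSL2_inverse[OF \<Psi>_PSL2[OF disc(2)]] by metis
    show ?r
    proof (intro ballI impI)
      fix \<sigma> assume \<sigma>: "\<sigma> \<in> PSL2" "\<forall>t. CK XL (\<sigma> t) = CK XL t"
      have "\<Psi> D \<circ> \<sigma> \<in> PSL2" "\<forall>t. CK XL t = CK XA ((\<Psi> D \<circ> \<sigma>) t)"
        using PSL2_comp[OF \<Psi>_PSL2[OF disc(2)] \<sigma>(1)] \<sigma>(2) CK_invariance by auto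
      then have "\<Psi> D \<circ> \<sigma> = \<Psi> D" using u \<Psi>_PSL2[OF disc(2)] CK_invariance by blast
      then have "\<phi> \<circ> \<Psi> D \<circ> \<sigma> = \<phi> \<circ> \<Psi> D" by (simp add: comp_assoc)
      then show "\<sigma> = id" by (simp add: \<phi>(2))
    qed
  next
    assume r: ?r
    obtain \<phi> where \<phi>: "\<phi> \<in> PSL2" "\<phi> \<circ> \<Psi> D = id" "\<Psi> D \<circ> \<phi> = id" using PSL2_inverse[OF \<Psi>_PSL2[OF disc(2)]] by metis
    show ?l
    proof (rule ex1I[of _ "\<Psi> D"], intro conjI allI)
      show "\<Psi> D \<in> PSL2" by (rule \<Psi>_PSL2[OF disc(2)])
      show "CK XL t = CK XA (\<Psi> D t)" for t by (rule CK_invariance)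
    next
      fix \<psi> assume \<psi>: "\<psi> \<in> PSL2 \<and> (\<forall>t. CK XL t = CK XA (\<psi> t))"
      have inv: "\<Psi> D (\<phi> t) = t" for t using \<phi>(3) by (metis comp_apply id_apply)
      have "CK XL ((\<phi> \<circ> \<psi>) t) = CK XL t" for t
        using CK_invariance[of "\<phi> (\<psi> t)"] \<psi> by (simp add: inv)
      then have "\<phi> \<circ> \<psi> = id" using r PSL2_comp[OF \<phi>(1)] \<psi> by blast
      then have "\<Psi> D \<circ> \<phi> \<circ> \<psi> = \<Psi> D" by (simp add: comp_assoc)
      then show "\<psi> = \<Psi> D" by (simp add: \<phi>(3))
    qed
  qed
qed

end


section \<open>Half-angle identities for the Gram matrix\<close>

text \<open>Lengths enter through their exponentials: with \<open>x = exp a\<close>, these are the hyperbolic cosine and sine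
  of \<open>a\<close>.\<close>

definition ch :: "complex \<Rightarrow> complex" where "ch x = (x + 1 / x) / 2"
definition sh :: "complex \<Rightarrow> complex" where "sh x = (x - 1 / x) / 2"

lemma ch_sh: "x \<noteq> 0 \<Longrightarrow> (ch x)\<^sup>2 = 1 + (sh x)\<^sup>2"
  by (simp add: ch_def sh_def field_simps power2_eq_square)

text \<open>For a symmetric 4 by 4 matrix with unit diagonal: the cofactor of a diagonal entry (in terms of the
  three remaining off-diagonal entries), the cofactor of the entry \<open>g12\<close>, and the determinant.\<close>

definition cof_diag :: "complex \<Rightarrow> complex \<Rightarrow> complex \<Rightarrow> complex" where
  "cof_diag g12 g13 g23 = 1 + 2 * g12 * g13 * g23 - g12\<^sup>2 - g13\<^sup>2 - g23\<^sup>2"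

definition cof_off :: "complex \<Rightarrow> complex \<Rightarrow> complex \<Rightarrow> complex \<Rightarrow> complex \<Rightarrow> complex \<Rightarrow> complex" where
  "cof_off g12 g34 g13 g23 g14 g24 =
     g13 * g23 + g14 * g24 - g12 * (1 - g34\<^sup>2) - g34 * (g13 * g24 + g14 * g23)"

definition gram :: "complex \<Rightarrow> complex \<Rightarrow> complex \<Rightarrow> complex \<Rightarrow> complex \<Rightarrow> complex \<Rightarrow> complex" where
  "gram g12 g13 g14 g23 g24 g34 =
     1 - g12\<^sup>2 - g13\<^sup>2 - g14\<^sup>2 - g23\<^sup>2 - g24\<^sup>2 - g34\<^sup>2
     + g12\<^sup>2 * g34\<^sup>2 + g13\<^sup>2 * g24\<^sup>2 + g14\<^sup>2 * g23\<^sup>2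
     + 2 * (g12 * g13 * g23 + g12 * g14 * g24 + g13 * g14 * g34 + g23 * g24 * g34)
     - 2 * (g12 * g23 * g34 * g14 + g13 * g23 * g24 * g14 + g12 * g24 * g34 * g13)"

text \<open>Here \<open>c\<^sub>i\<close> and \<open>s\<^sub>i\<close> are the hyperbolic cosine and sine of the lengths \<open>a\<^sub>i\<close> of the edges from the
  vertices 1, 2, 3 to the vertex 4 (the apex).  The first four terms add up to the hyperbolic sine of
  \<open>a\<^sub>1 + a\<^sub>2 + a\<^sub>3\<close>, so the expression is odd under simultaneous reversal of the three lengths.\<close>

definition apexU :: "complex \<Rightarrow> complex \<Rightarrow> complex \<Rightarrow> complex \<Rightarrow> complex \<Rightarrow> complex \<Rightarrow> complex \<Rightarrow> complex \<Rightarrow> complex \<Rightarrow> complex" where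
  "apexU g12 g13 g23 c1 s1 c2 s2 c3 s3 =
     s1 * s2 * s3 + s1 * c2 * c3 + c1 * s2 * c3 + c1 * c2 * s3 - g12 * s3 - g13 * s2 - g23 * s1"

text \<open>The cofactor of a diagonal entry is minus the product of two such defects, for the lengths
  \<open>a\<^sub>1, a\<^sub>2\<close> and \<open>a\<^sub>1, - a\<^sub>2\<close>.\<close>

definition defect :: "complex \<Rightarrow> complex \<Rightarrow> complex \<Rightarrow> complex \<Rightarrow> complex \<Rightarrow> complex" where
  "defect g c1 s1 c2 s2 = c1 * c2 + s1 * s2 - g"

lemma cof_off_apexU:
  assumes "c1\<^sup>2 = 1 + s1\<^sup>2" "c2\<^sup>2 = 1 + s2\<^sup>2" "c3\<^sup>2 = 1 + s3\<^sup>2"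
  shows "cof_off g12 c3 g13 g23 c1 c2 + apexU g12 g13 g23 c1 s1 c2 s2 c3 s3 * s3
    = defect g13 c1 s1 c3 s3 * defect g23 c2 s2 c3 s3"
  using assms unfolding cof_off_def apexU_def defect_def by algebra

lemma apexU_norm:
  assumes "c1\<^sup>2 = 1 + s1\<^sup>2" "c2\<^sup>2 = 1 + s2\<^sup>2" "c3\<^sup>2 = 1 + s3\<^sup>2"
  shows "(apexU g12 g13 g23 c1 s1 c2 s2 c3 s3)\<^sup>2 - gram g12 g13 c1 g23 c2 c3
    = 2 * defect g12 c1 s1 c2 s2 * defect g13 c1 s1 c3 s3 * defect g23 c2 s2 c3 s3"
  using assms unfolding gram_def apexU_def defect_def by algebra

lemma apexU_flip:
  "apexU g12 g13 g23 c1 s1 c2 s2 c3 (- s3) = apexU g12 g13 g23 c1 s1 c2 s2 c3 s3 - 2 * s3 * defect g12 c1 s1 c2 s2"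
  unfolding apexU_def defect_def by algebra

text \<open>The effect on \<open>apexU + d\<close> of reversing one edge at the apex, where \<open>d\<close> is a square root of the Gram
  determinant.  The identity has coefficients 1 and \<open>d\<close>; they are consequences of the three preceding
  identities.\<close>

lemma apex_step:
  assumes "c1\<^sup>2 = 1 + s1\<^sup>2" "c2\<^sup>2 = 1 + s2\<^sup>2" "c3\<^sup>2 = 1 + s3\<^sup>2" "d\<^sup>2 = gram g12 g13 c1 g23 c2 c3"
  shows "(cof_off g12 c3 g13 g23 c1 c2 + d * s3) * (apexU g12 g13 g23 c1 s1 c2 s2 c3 s3 + d)
    = defect g13 c1 s1 c3 s3 * defect g23 c2 s2 c3 s3 * (apexU g12 g13 g23 c1 s1 c2 s2 c3 (- s3) + d)"
  using cof_off_apexU[OF assms(1-3), of g12 g13 g23] apexU_norm[OF assms(1-3), of g12 g13 g23]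
    apexU_flip[of g12 g13 g23 c1 s1 c2 s2 c3 s3] assms(4) by algebra

lemma apexU_perm:
  "apexU g12 g13 g23 c1 s1 c2 s2 c3 s3 = apexU g13 g12 g23 c1 s1 c3 s3 c2 s2"
  "apexU g12 g13 g23 c1 s1 c2 s2 c3 s3 = apexU g23 g13 g12 c3 s3 c2 s2 c1 s1"
  by (simp_all add: apexU_def algebra_simps)

lemma gram_perm:
  "gram g12 g13 g14 g23 g24 g34 = gram g13 g12 g14 g23 g34 g24"
  "gram g12 g13 g14 g23 g24 g34 = gram g23 g13 g34 g12 g24 g14"
  by (simp_all add: gram_def algebra_simps)

lemma cof_diag_defect:
  assumes "c1\<^sup>2 = 1 + s1\<^sup>2" "c2\<^sup>2 = 1 + s2\<^sup>2"
  shows "cof_diag g c1 c2 = - (defect g c1 s1 c2 s2 * defect g c1 s1 c2 (- s2))"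
  using assms unfolding cof_diag_def defect_def by algebra

text \<open>Reversing the three edges at the apex one after the other turns \<open>U\<close> into \<open>- U\<close>.  The defects that
  appear in the three steps combine to the three diagonal cofactors.\<close>

lemma apex_product:
  assumes c: "c1\<^sup>2 = 1 + s1\<^sup>2" "c2\<^sup>2 = 1 + s2\<^sup>2" "c3\<^sup>2 = 1 + s3\<^sup>2" "d\<^sup>2 = gram g12 g13 c1 g23 c2 c3"
  defines "U \<equiv> apexU g12 g13 g23 c1 s1 c2 s2 c3 s3"
  shows "(cof_off g12 c3 g13 g23 c1 c2 + d * s3) * (cof_off g13 c2 g12 g23 c1 c3 + d * s2)
       * (cof_off g23 c1 g12 g13 c2 c3 + d * s1) * (U + d)
    = cof_diag g12 c1 c2 * cof_diag g13 c1 c3 * cof_diag g23 c2 c3 * (U - d)"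
proof -
  have m: "c3\<^sup>2 = 1 + (- s3)\<^sup>2" "c2\<^sup>2 = 1 + (- s2)\<^sup>2" using c by simp_all
  note s3 = apex_step[OF c]
  have "d\<^sup>2 = gram g13 g12 c1 g23 c3 c2" using c(4) gram_perm(1) by metis
  note s2 = apex_step[OF c(1) m(1) c(2) this]
  have "d\<^sup>2 = gram g23 g13 c3 g12 c2 c1" using c(4) gram_perm(2) by metis
  note s1 = apex_step[OF m c(1) this]
  have flip: "apexU g23 g13 g12 c3 (- s3) c2 (- s2) c1 (- s1) = - U"
    unfolding U_def by (simp add: apexU_def algebra_simps)
  have dc: "defect g c s c' s' = defect g c' s' c s" for g c s c' s'
    by (simp add: defect_def algebra_simps)
  have co: "cof_off g23 c1 g13 g12 c3 c2 = cof_off g23 c1 g12 g13 c2 c3"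
    by (simp add: cof_off_def algebra_simps)
  define P12 where "P12 = cof_off g12 c3 g13 g23 c1 c2 + d * s3"
  define P13 where "P13 = cof_off g13 c2 g12 g23 c1 c3 + d * s2"
  define P23 where "P23 = cof_off g23 c1 g12 g13 c2 c3 + d * s1"
  define F12 where "F12 = defect g12 c1 s1 c2 s2"
  define F13 where "F13 = defect g13 c1 s1 c3 s3"
  define F23 where "F23 = defect g23 c2 s2 c3 s3"
  define F12' where "F12' = defect g12 c1 s1 c2 (- s2)"
  define F13' where "F13' = defect g13 c1 s1 c3 (- s3)"
  define F23' where "F23' = defect g23 c2 s2 c3 (- s3)"
  define U1 where "U1 = apexU g12 g13 g23 c1 s1 c2 s2 c3 (- s3)"
  define U2 where "U2 = apexU g13 g12 g23 c1 s1 c3 (- s3) c2 (- s2)"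
  have e3: "P12 * (U + d) = F13 * F23 * (U1 + d)"
    using s3 unfolding P12_def U_def U1_def F13_def F23_def .
  have e2: "P13 * (U1 + d) = F12 * F23' * (U2 + d)"
    using s2 unfolding P13_def U1_def U2_def F12_def F23'_def
      apexU_perm(1)[of g12 g13 g23 c1 s1 c2 s2 c3 "-s3"]
    by (simp add: dc[of g23 c3 "- s3"])
  have e1: "P23 * (U2 + d) = F13' * F12' * (- U + d)"
  proof -
    have "U2 = apexU g23 g13 g12 c3 (- s3) c2 (- s2) c1 s1"
      unfolding U2_def by (simp add: apexU_def algebra_simps)
    then show ?thesis
      using s1 flip unfolding P23_def F13'_def F12'_def
      by (simp add: dc[of g12 c2] dc[of g13 c3] co)
  qed
  have C: "cof_diag g12 c1 c2 = - (F12 * F12')" "cof_diag g13 c1 c3 = - (F13 * F13')"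
    "cof_diag g23 c2 c3 = - (F23 * F23')"
    unfolding F12_def F12'_def F13_def F13'_def F23_def F23'_def
    by (rule cof_diag_defect; use c in simp)+
  have "P12 * P13 * P23 * (U + d) = cof_diag g12 c1 c2 * cof_diag g13 c1 c3 * cof_diag g23 c2 c3 * (U - d)"
    unfolding C using e1 e2 e3 by algebra
  then show ?thesis unfolding P12_def P13_def P23_def .
qed

text \<open>For a square root \<open>d\<close> of the Gram determinant, this is the exponentiated dihedral angle at the edge
  \<open>ij\<close>, between the faces opposite to \<open>k\<close> and \<open>l\<close>, multiplied by square roots of the diagonal cofactors
  of \<open>k\<close> and \<open>l\<close>.  For \<open>d = 0\<close> it is the cofactor of the entry \<open>kl\<close>.\<close>

definition dihedral :: "(nat \<Rightarrow> nat \<Rightarrow> complex) \<Rightarrow> complex \<Rightarrow> nat \<Rightarrow> nat \<Rightarrow> nat \<Rightarrow> nat \<Rightarrow> complex" where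
  "dihedral x d i j k l =
     cof_off (ch (x k l)) (ch (x i j)) (ch (x k i)) (ch (x l i)) (ch (x k j)) (ch (x l j)) + d * sh (x i j)"

text \<open>The principal minor of the Gram matrix for the face \<open>ijk\<close>, that is, the diagonal cofactor of the
  fourth vertex.\<close>

definition face_minor :: "(nat \<Rightarrow> nat \<Rightarrow> complex) \<Rightarrow> nat \<Rightarrow> nat \<Rightarrow> nat \<Rightarrow> complex" where
  "face_minor x i j k = cof_diag (ch (x i j)) (ch (x i k)) (ch (x j k))"

definition gram_det :: "(nat \<Rightarrow> nat \<Rightarrow> complex) \<Rightarrow> nat \<Rightarrow> nat \<Rightarrow> nat \<Rightarrow> nat \<Rightarrow> complex" where
  "gram_det x i j k l = gram (ch (x i j)) (ch (x i k)) (ch (x i l)) (ch (x j k)) (ch (x j l)) (ch (x k l))"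

definition apex :: "(nat \<Rightarrow> nat \<Rightarrow> complex) \<Rightarrow> nat \<Rightarrow> nat \<Rightarrow> nat \<Rightarrow> nat \<Rightarrow> complex" where
  "apex x i j k l = apexU (ch (x i j)) (ch (x i k)) (ch (x j k)) (ch (x i l)) (sh (x i l))
     (ch (x j l)) (sh (x j l)) (ch (x k l)) (sh (x k l))"

definition triangle :: "(nat \<Rightarrow> nat \<Rightarrow> complex) \<Rightarrow> nat \<Rightarrow> nat \<Rightarrow> nat \<Rightarrow> complex" where
  "triangle x i j k = x i j * x i k * x j k"

definition circuit :: "(nat \<Rightarrow> nat \<Rightarrow> complex) \<Rightarrow> nat \<Rightarrow> nat \<Rightarrow> nat \<Rightarrow> nat \<Rightarrow> complex" where
  "circuit x i j k l = x i j * x j k * x k l * x l i"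

definition all_edges :: "(nat \<Rightarrow> nat \<Rightarrow> complex) \<Rightarrow> nat \<Rightarrow> nat \<Rightarrow> nat \<Rightarrow> nat \<Rightarrow> complex" where
  "all_edges x i j k l = x i j * x i k * x i l * x j k * x j l * x k l"

definition on_config where
  "on_config f x i j k l = f (triangle x i j k) (triangle x i j l) (triangle x i k l) (triangle x j k l)
     (circuit x i j k l) (circuit x i k j l) (circuit x i j l k)"

locale edge_values =
  fixes x :: "nat \<Rightarrow> nat \<Rightarrow> complex"
  assumes sym: "x i j = x j i" and nz: "x i j \<noteq> 0"
begin

lemma dihedral_sym: "dihedral x d i j k l = dihedral x d j i k l" "dihedral x d i j k l = dihedral x d i j l k"
  by (simp_all add: dihedral_def cof_off_def sym[of j i] sym[of l k] algebra_simps)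

lemma face_minor_sym: "face_minor x i j k = face_minor x j i k" "face_minor x i j k = face_minor x i k j"
  by (simp_all add: face_minor_def cof_diag_def sym[of j i] sym[of k j] sym[of k i] algebra_simps)

lemma gram_det_sym: "gram_det x i j k l = gram_det x j i k l" "gram_det x i j k l = gram_det x i k j l"
  "gram_det x i j k l = gram_det x i j l k"
  by (simp_all add: gram_det_def gram_def sym[of j i] sym[of k j] sym[of l k] algebra_simps)

lemma dihedral_norm:
  assumes "d\<^sup>2 = gram_det x i j k l"
  shows "dihedral x d i j k l * dihedral x (- d) i j k l = face_minor x i j k * face_minor x i j l"
  using assms ch_sh[OF nz[of i j]]
  unfolding dihedral_def face_minor_def gram_det_def cof_off_def cof_diag_def gram_def
    sym[of k i] sym[of l i] sym[of k j] sym[of l j]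
  by algebra

lemma apex_ratio:
  assumes "d\<^sup>2 = gram_det x i j k l"
  shows "dihedral x d k l i j * dihedral x d j l i k * dihedral x d i l j k * (apex x i j k l + d)
    = face_minor x i j l * face_minor x i k l * face_minor x j k l * (apex x i j k l - d)"
  using apex_product[OF ch_sh[OF nz[of i l]] ch_sh[OF nz[of j l]] ch_sh[OF nz[of k l]],
      of d "ch (x i j)" "ch (x i k)" "ch (x j k)"] assms
  unfolding dihedral_def face_minor_def gram_det_def apex_def sym[of j i] sym[of k i] sym[of k j]
  by simp

text \<open>Let \<open>U\<close> and \<open>U'\<close> be the values of \<open>apex\<close> for the faces \<open>ijk\<close> and \<open>ikl\<close>, and let \<open>P\<close> be the value of
  \<open>dihedral\<close> for the edge \<open>jl\<close>.  With \<open>X\<close> the circuit \<open>ijkl\<close> and \<open>Y\<close> the first factor below, the product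
  \<open>P * (Y - 2 * all_edges * d * (X - 1))\<close> is a multiple of \<open>(U - d) * (U' - d)\<close>.  Comparison of norms (the
  products with the conjugates for \<open>d \<mapsto> - d\<close>) suggests this.  The two lemmas
  \<open>circuit_delta\<close> and \<open>circuit_rational\<close> are the coefficients of \<open>d\<close> and of 1 in the identity.\<close>

lemma circuit_delta:
  "((1 - triangle x i j k) * (1 - triangle x i j l) * (1 - triangle x i k l) * (1 - triangle x j k l)
      + (2 * all_edges x i j k l * apex x i j k l
         + (1 - triangle x i j l) * (1 - triangle x i k l) * (1 - triangle x j k l)) * (circuit x i j k l - 1))
      * sh (x j l)
     - 2 * all_edges x i j k l * (circuit x i j k l - 1) * dihedral x 0 j l i k
   = - all_edges x i j k l * (x i j * x i l - x j l) * (x j k * x k l - x j l) / x j l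
      * (apex x i j k l + apex x i l k j)"
  using nz[of i j] nz[of i k] nz[of i l] nz[of j k] nz[of j l] nz[of k l]
  unfolding triangle_def all_edges_def circuit_def dihedral_def apex_def apexU_def cof_off_def ch_def sh_def
    sym[of l i] sym[of l k] sym[of k j] sym[of l j] sym[of k i]
  apply (simp add: divide_simps)
  apply algebra
  done

lemma circuit_rational:
  "((1 - triangle x i j k) * (1 - triangle x i j l) * (1 - triangle x i k l) * (1 - triangle x j k l)
      + (2 * all_edges x i j k l * apex x i j k l
         + (1 - triangle x i j l) * (1 - triangle x i k l) * (1 - triangle x j k l)) * (circuit x i j k l - 1))
      * dihedral x 0 j l i k
     - 2 * all_edges x i j k l * (circuit x i j k l - 1) * gram_det x i j k l * sh (x j l)
   = all_edges x i j k l * (x i j * x i l - x j l) * (x j k * x k l - x j l) / x j l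
      * (apex x i j k l * apex x i l k j + gram_det x i j k l)"
  using nz[of i j] nz[of i k] nz[of i l] nz[of j k] nz[of j l] nz[of k l]
  unfolding triangle_def all_edges_def circuit_def dihedral_def apex_def apexU_def cof_off_def ch_def sh_def
    gram_det_def gram_def sym[of l i] sym[of l k] sym[of k j] sym[of l j] sym[of k i]
  apply (simp add: divide_simps)
  apply algebra
  done

text \<open>So the principal parameters lie in the field generated by the exponentiated lengths and a square root
  of the Gram determinant.\<close>

lemma quad_disc:
  shows "(on_config quad_b x i j k l)\<^sup>2 - 4 * on_config quad_a x i j k l * on_config quad_c x i j k l = 16 * (all_edges x i j k l)\<^sup>2 * gram_det x i j k l"
  using nz[of i j] nz[of i k] nz[of i l] nz[of j k] nz[of j l] nz[of k l]
  unfolding on_config_def quad_a_def quad_b_def quad_c_def triangle_def all_edges_def circuit_def gram_det_def gram_def ch_def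
     sym[of l i] sym[of l k] sym[of k j] sym[of l j] sym[of k i]
  apply (simp add: divide_simps)
  apply algebra
  done

text \<open>With \<open>quad_sum\<close> below, this determines \<open>polar_form\<close> at the numbers of the configuration.\<close>

lemma quad_apex:
  shows "2 * on_config quad_a x i j k l + on_config quad_b x i j k l = 2 * (2 * all_edges x i j k l * apex x i j k l
         + (1 - triangle x i j l) * (1 - triangle x i k l) * (1 - triangle x j k l))"
  using nz[of i j] nz[of i k] nz[of i l] nz[of j k] nz[of j l] nz[of k l]
  unfolding on_config_def quad_a_def quad_b_def triangle_def all_edges_def circuit_def apex_def apexU_def ch_def sh_def
     sym[of l i] sym[of l k] sym[of k j] sym[of l j] sym[of k i]
  apply (simp add: divide_simps)
  apply algebra
  done

end


section \<open>Lengths and angles as a Cho--Kim pair\<close>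

text \<open>The number 1 of a vertex is to stay a numeral, like the numbers of the other vertices.\<close>

declare One_nat_def [simp del]

lemma polar_form_at_1: "polar_form a b c e X 1 = (a + b + c) + (X - 1) * (2 * a + b + e) / 2"
  by (simp add: polar_form_def field_simps)

lemma square_from_norm:
  fixes p :: complex
  assumes "p * p' = c * c'" "p = k * r' * r * y" "c = k * r\<^sup>2" "c' = k * r'\<^sup>2" "k \<noteq> 0" "r \<noteq> 0" "r' \<noteq> 0"
  shows "y\<^sup>2 * p' = p"
proof -
  have "(k * r' * r) * (y * p') = (k * r' * r) * (k * r' * r)"
    using assms(1-4) by algebra
  then have "y * p' = k * r' * r" using assms(5-7) by simp
  then show ?thesis unfolding assms(2) by (simp add: power2_eq_square mult.assoc)
qed

context edge_values
begin

abbreviation config_polar :: "nat \<Rightarrow> nat \<Rightarrow> nat \<Rightarrow> nat \<Rightarrow> complex \<Rightarrow> complex \<Rightarrow> complex" where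
  "config_polar i j k l e X \<equiv> polar_form (on_config quad_a x i j k l) (on_config quad_b x i j k l)
     (on_config quad_c x i j k l) e X 1"

lemma triangle_circuit_prod:
  "triangle x i j k * triangle x i j l * triangle x i k l * triangle x j k l
   = circuit x i j k l * circuit x i k j l * circuit x i j l k"
  by (simp add: triangle_def circuit_def sym[of j i] sym[of k i] sym[of l i] sym[of k j] sym[of l j] sym[of l k] mult_ac)

lemma quad_sum:
  "on_config quad_a x i j k l + on_config quad_b x i j k l + on_config quad_c x i j k l
   = (1 - triangle x i j k) * (1 - triangle x i j l) * (1 - triangle x i k l) * (1 - triangle x j k l)"
  using triangle_circuit_prod[of i j k l]
  unfolding on_config_def quad_a_def quad_b_def quad_c_def by algebra

lemma polar_form_triangle:
  "config_polar i j k l (4 * all_edges x i j k l * e) (triangle x i j k)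
   = 2 * all_edges x i j k l * (triangle x i j k - 1) * (apex x i j k l + e)"
  unfolding polar_form_at_1 quad_sum quad_apex by (simp add: field_simps)

text \<open>The value of the triple product of exponentiated dihedral angles at the edges that meet in the apex
  \<open>l\<close>, by \<open>apex_product\<close>.\<close>

lemma triangle_relation:
  assumes d: "d\<^sup>2 = gram_det x i j k l"
    and C: "face_minor x i j l \<noteq> 0" "face_minor x i k l \<noteq> 0" "face_minor x j k l \<noteq> 0"
    and A: "A * (face_minor x i j l * face_minor x i k l * face_minor x j k l)
      = dihedral x d k l i j * dihedral x d j l i k * dihedral x d i l j k"
  shows "A * (apex x i j k l + d) = apex x i j k l - d"
proof -
  have "(face_minor x i j l * face_minor x i k l * face_minor x j k l) * (A * (apex x i j k l + d))
    = (face_minor x i j l * face_minor x i k l * face_minor x j k l) * (apex x i j k l - d)"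
    using apex_ratio[OF d] A by algebra
  then show ?thesis using C by simp
qed

lemma triangle_polar_relation:
  assumes "A * (apex x i j k l + d) = apex x i j k l - d"
  shows "A * config_polar i j k l (4 * all_edges x i j k l * d) (triangle x i j k)
   = config_polar i j k l (- (4 * all_edges x i j k l * d)) (triangle x i j k)"
  using polar_form_triangle[of i j k l d] polar_form_triangle[of i j k l "- d"] assms
  by simp

text \<open>Heron's formula: smoothness of a face means that no triangle inequality becomes an equality, in the
  multiplicative sense.\<close>

lemma face_minor_factor:
  "face_minor x i j k = (triangle x i j k - 1) * (x i j * x i k - x j k) * (x i j * x j k - x i k)
     * (x i k * x j k - x i j) / (4 * (triangle x i j k)\<^sup>2)"
  using nz[of i j] nz[of i k] nz[of j k]
  unfolding face_minor_def cof_diag_def ch_def triangle_def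
  apply (simp add: divide_simps)
  apply algebra
  done

lemma face_minor_nzD:
  assumes "face_minor x i j k \<noteq> 0"
  shows "triangle x i j k \<noteq> 1" "x i j * x i k \<noteq> x j k"
  using assms unfolding face_minor_factor by auto

text \<open>The angle value of the circuit \<open>ijkl\<close>, multiplied by the square \<open>m\<close> of the exponentiated dihedral
  angle at the edge \<open>jl\<close>, is the product of the angle values \<open>A1\<close>, \<open>A2\<close> of the faces \<open>ijk\<close> and \<open>ikl\<close>.  So
  the relation follows from those for the two faces.\<close>

lemma circuit_relation:
  assumes d: "d\<^sup>2 = gram_det x i j k l"
    and C: "face_minor x j k l \<noteq> 0" "face_minor x i j l \<noteq> 0"
    and A1: "A1 * (apex x i j k l + d) = apex x i j k l - d"
    and A2: "A2 * (apex x i l k j + d) = apex x i l k j - d"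
    and m: "m * dihedral x (- d) j l i k = dihedral x d j l i k"
    and A: "A * m = A1 * A2"
  shows "A * config_polar i j k l (4 * all_edges x i j k l * d) (circuit x i j k l)
   = config_polar i j k l (- (4 * all_edges x i j k l * d)) (circuit x i j k l)"
proof -
  define U where "U = apex x i j k l"
  define U' where "U' = apex x i l k j"
  define L where "L = all_edges x i j k l"
  define X where "X = circuit x i j k l"
  define Y where "Y = (1 - triangle x i j k) * (1 - triangle x i j l) * (1 - triangle x i k l) * (1 - triangle x j k l)
      + (2 * L * U + (1 - triangle x i j l) * (1 - triangle x i k l) * (1 - triangle x j k l)) * (X - 1)"
  define w where "w = L * (x i j * x i l - x j l) * (x j k * x k l - x j l) / x j l"
  define G where "G = gram_det x i j k l"
  define s where "s = sh (x j l)"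
  define C0 where "C0 = dihedral x 0 j l i k"
  define P where "P = dihedral x d j l i k"
  define P' where "P' = dihedral x (- d) j l i k"
  have PP: "P = C0 + d * s" "P' = C0 - d * s"
    unfolding P_def P'_def C0_def s_def dihedral_def by simp_all
  \<comment> \<open>The two coefficients of the identity for circuits, and the identity with its conjugate.\<close>
  have e1: "Y * s - 2 * L * (X - 1) * C0 = - w * (U + U')"
    using circuit_delta[of i j k l] unfolding Y_def s_def L_def X_def C0_def w_def U_def U'_def by simp
  have e2: "Y * C0 - 2 * L * (X - 1) * G * s = w * (U * U' + G)"
    using circuit_rational[of i j k l] unfolding Y_def s_def L_def X_def C0_def w_def U_def U'_def G_def by simp
  have G: "d\<^sup>2 = G" using d by (simp add: G_def)
  have f1: "P * (Y - 2 * L * d * (X - 1)) = w * (U - d) * (U' - d)"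
    unfolding PP using e1 e2 G by algebra
  have f2: "P' * (Y + 2 * L * d * (X - 1)) = w * (U + d) * (U' + d)"
    unfolding PP using e1 e2 G by algebra
  have "P * P' = face_minor x j l i * face_minor x j l k"
    unfolding P_def P'_def
  proof (rule dihedral_norm)
    show "d\<^sup>2 = gram_det x j l i k"
      unfolding d using gram_det_sym(1)[of i j k l] gram_det_sym(3)[of j i k l] gram_det_sym(2)[of j i l k] by simp
  qed
  also have "\<dots> \<noteq> 0"
    using C face_minor_sym(1)[of j l i] face_minor_sym(2)[of l j i] face_minor_sym(1)[of l i j] face_minor_sym(2)[of i l j]
      face_minor_sym(2)[of j l k] by simp
  finally have nz: "P * P' \<noteq> 0" .
  have "A1 * (U + d) = U - d" "A2 * (U' + d) = U' - d" "m * P' = P"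
    using A1 A2 m unfolding U_def U'_def P_def P'_def .
  then have "P * P' * (A * (Y + 2 * L * d * (X - 1))) = P * P' * (Y - 2 * L * d * (X - 1))"
    using f1 f2 A by algebra
  then have R: "A * (Y + 2 * L * d * (X - 1)) = Y - 2 * L * d * (X - 1)" using nz by simp
  have F: "config_polar i j k l (4 * L * e) X = Y + 2 * L * e * (X - 1)" for e
    unfolding polar_form_at_1 quad_sum quad_apex Y_def L_def U_def by (simp add: field_simps)
  show ?thesis using R F[of d] F[of "- d"] unfolding L_def X_def by simp
qed

lemma on_config_perm:
  assumes "f = quad_a \<or> f = quad_b \<or> f = quad_c"
  shows "on_config f x i j l k = on_config f x i j k l" "on_config f x i k j l = on_config f x i j k l"
    "on_config f x j i k l = on_config f x i j k l"
  using assms unfolding on_config_def triangle_def circuit_def sym[of j i] sym[of k i] sym[of l i] sym[of k j] sym[of l j] sym[of l k]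
  by (auto simp: quad_a_def quad_b_def quad_c_def algebra_simps)

lemma all_edges_perm: "all_edges x i j l k = all_edges x i j k l" "all_edges x i k j l = all_edges x i j k l"
    "all_edges x j i k l = all_edges x i j k l"
  unfolding all_edges_def sym[of j i] sym[of k j] sym[of l k] by (simp_all add: mult_ac)

text \<open>In terms of square roots \<open>r\<close> of the normalized diagonal cofactors, the \<open>y\<close> are the exponentiated edge
  lengths of the dual tetrahedron.  The lengths of a tetrahedron and of its dual thus form a Cho--Kim
  pair; the sign of \<open>d\<close> selects the order of the principal parameters.\<close>

theorem cho_kim_pair_dual:
  assumes d: "d\<^sup>2 = gram_det x 1 2 3 4" "d \<noteq> 0"
    and C: "face_minor x 2 3 4 = d\<^sup>2 * (r1)\<^sup>2" "face_minor x 1 3 4 = d\<^sup>2 * (r2)\<^sup>2"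
      "face_minor x 1 2 4 = d\<^sup>2 * (r3)\<^sup>2" "face_minor x 1 2 3 = d\<^sup>2 * (r4)\<^sup>2"
    and r: "r1 \<noteq> 0" "r2 \<noteq> 0" "r3 \<noteq> 0" "r4 \<noteq> 0"
  defines "y12 \<equiv> dihedral x d 3 4 1 2 / (d\<^sup>2 * r1 * r2)" and "y13 \<equiv> dihedral x d 2 4 1 3 / (d\<^sup>2 * r1 * r3)"
    and "y14 \<equiv> dihedral x d 2 3 1 4 / (d\<^sup>2 * r1 * r4)" and "y23 \<equiv> dihedral x d 1 4 2 3 / (d\<^sup>2 * r2 * r3)"
    and "y24 \<equiv> dihedral x d 1 3 2 4 / (d\<^sup>2 * r2 * r4)" and "y34 \<equiv> dihedral x d 1 2 3 4 / (d\<^sup>2 * r3 * r4)"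
  assumes y12: "y12\<^sup>2 \<noteq> 1"
  shows "\<exists>D. cho_kim_pair (triangle x 1 2 3) (triangle x 1 2 4) (triangle x 1 3 4) (triangle x 2 3 4)
     (circuit x 1 2 3 4) (circuit x 1 3 2 4) (circuit x 1 2 4 3)
     (y12 * y13 * y23) (y12 * y14 * y24) (y13 * y14 * y34) (y23 * y24 * y34)
     (y12 * y14 * y23 * y34) (y13 * y14 * y23 * y24) (y12 * y13 * y24 * y34)
     (on_config quad_a x 1 2 3 4) (on_config quad_b x 1 2 3 4) (on_config quad_c x 1 2 3 4) D" (is "\<exists>D. ?P D")
proof (rule exI[of _ "- (4 * all_edges x 1 2 3 4 * d)"])
  have gs: "d\<^sup>2 = gram_det x 1 2 4 3" "d\<^sup>2 = gram_det x 1 3 4 2" "d\<^sup>2 = gram_det x 2 3 4 1"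
    "d\<^sup>2 = gram_det x 1 3 2 4"  "d\<^sup>2 = gram_det x 3 4 1 2" "d\<^sup>2 = gram_det x 2 4 1 3" "d\<^sup>2 = gram_det x 2 3 1 4"
    "d\<^sup>2 = gram_det x 1 4 2 3"
    unfolding d(1) gram_det_def sym[of 2 1] sym[of 3 1] sym[of 4 1] sym[of 3 2] sym[of 4 2] sym[of 4 3]
    by (simp_all add: gram_def algebra_simps)
  have C0: "face_minor x 2 3 4 \<noteq> 0" "face_minor x 1 3 4 \<noteq> 0" "face_minor x 1 2 4 \<noteq> 0" "face_minor x 1 2 3 \<noteq> 0"
    unfolding C using d(2) r by simp_all
  have fm: "face_minor x 2 4 3 = face_minor x 2 3 4" "face_minor x 1 4 3 = face_minor x 1 3 4"
    "face_minor x 1 3 2 = face_minor x 1 2 3" "face_minor x 1 4 2 = face_minor x 1 2 4"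
    "face_minor x 3 4 2 = face_minor x 2 3 4" "face_minor x 3 4 1 = face_minor x 1 3 4"
    "face_minor x 2 4 1 = face_minor x 1 2 4" "face_minor x 2 3 1 = face_minor x 1 2 3"
    "face_minor x 3 2 4 = face_minor x 2 3 4"
    unfolding face_minor_def sym[of 2 1] sym[of 3 1] sym[of 4 1] sym[of 3 2] sym[of 4 2] sym[of 4 3]
    by (simp_all add: cof_diag_def algebra_simps)
  have di: "dihedral x e j i k l = dihedral x e i j k l" "dihedral x e i j l k = dihedral x e i j k l" for e i j k l
    by (rule dihedral_sym[symmetric])+
  have yP: "dihedral x d 3 4 1 2 = d\<^sup>2 * r1 * r2 * y12" "dihedral x d 2 4 1 3 = d\<^sup>2 * r1 * r3 * y13"
    "dihedral x d 2 3 1 4 = d\<^sup>2 * r1 * r4 * y14" "dihedral x d 1 4 2 3 = d\<^sup>2 * r2 * r3 * y23"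
    "dihedral x d 1 3 2 4 = d\<^sup>2 * r2 * r4 * y24" "dihedral x d 1 2 3 4 = d\<^sup>2 * r3 * r4 * y34"
    unfolding y12_def y13_def y14_def y23_def y24_def y34_def using d(2) r by simp_all
  have pn: "dihedral x d 3 4 1 2 * dihedral x (- d) 3 4 1 2 = face_minor x 1 3 4 * face_minor x 2 3 4"
    "dihedral x d 2 4 1 3 * dihedral x (- d) 2 4 1 3 = face_minor x 1 2 4 * face_minor x 2 3 4"
    "dihedral x d 2 3 1 4 * dihedral x (- d) 2 3 1 4 = face_minor x 1 2 3 * face_minor x 2 3 4"
    "dihedral x d 1 4 2 3 * dihedral x (- d) 1 4 2 3 = face_minor x 1 2 4 * face_minor x 1 3 4"
    "dihedral x d 1 3 2 4 * dihedral x (- d) 1 3 2 4 = face_minor x 1 2 3 * face_minor x 1 3 4"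
    "dihedral x d 1 2 3 4 * dihedral x (- d) 1 2 3 4 = face_minor x 1 2 3 * face_minor x 1 2 4"
    using dihedral_norm[OF gs(5)] dihedral_norm[OF gs(6)] dihedral_norm[OF gs(7)]
      dihedral_norm[OF gs(8)] dihedral_norm[OF gs(4)] dihedral_norm[OF d(1)]
    by (simp_all add: fm)
  have ynz: "y12 \<noteq> 0" "y13 \<noteq> 0" "y14 \<noteq> 0" "y23 \<noteq> 0" "y24 \<noteq> 0" "y34 \<noteq> 0"
    using pn C0 unfolding yP by auto
  have t123: "y12 * y13 * y23 * (apex x 1 2 3 4 + d) = apex x 1 2 3 4 - d"
    by (rule triangle_relation[OF d(1)]) (use C0 in \<open>simp_all add: fm\<close>, unfold C yP, simp add: power2_eq_square mult_ac)
  have t124: "y12 * y14 * y24 * (apex x 1 2 4 3 + d) = apex x 1 2 4 3 - d"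
    by (rule triangle_relation[OF gs(1)]) (use C0 in \<open>simp_all add: fm\<close>, unfold di(1)[of _ 4 3] di(1)[of _ 3 2] C yP, simp add: power2_eq_square mult_ac)
  have t134: "y13 * y14 * y34 * (apex x 1 3 4 2 + d) = apex x 1 3 4 2 - d"
    by (rule triangle_relation[OF gs(2)]) (use C0 in \<open>simp_all add: fm\<close>, unfold di(1)[of _ 4 2] di(1)[of _ 3 2] C yP, simp add: power2_eq_square mult_ac)
  have t234: "y23 * y24 * y34 * (apex x 2 3 4 1 + d) = apex x 2 3 4 1 - d"
    by (rule triangle_relation[OF gs(3)]) (use C0 in \<open>simp_all add: fm\<close>, unfold di(1)[of _ 4 1] di(1)[of _ 3 1] di(1)[of _ 2 1] C yP, simp add: power2_eq_square mult_ac)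
  have apex_swap: "apex x 1 4 3 2 = apex x 1 3 4 2" "apex x 1 4 2 3 = apex x 1 2 4 3"
    unfolding apex_def sym[of 4 3] sym[of 4 2] by (simp_all add: apexU_def algebra_simps)
  have c1: "y12 * y14 * y23 * y34 * y13\<^sup>2 = (y12 * y13 * y23) * (y13 * y14 * y34)"
    and c2: "y13 * y14 * y23 * y24 * y12\<^sup>2 = (y12 * y13 * y23) * (y12 * y14 * y24)"
    and c3: "y12 * y13 * y24 * y34 * y14\<^sup>2 = (y12 * y14 * y24) * (y13 * y14 * y34)"
    by algebra+
  have sq: "y12\<^sup>2 * dihedral x (- d) 3 4 1 2 = dihedral x d 3 4 1 2" "y13\<^sup>2 * dihedral x (- d) 2 4 1 3 = dihedral x d 2 4 1 3"
    "y14\<^sup>2 * dihedral x (- d) 2 3 1 4 = dihedral x d 2 3 1 4"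
    by (rule square_from_norm[OF pn(1) yP(1) C(2,1)] square_from_norm[OF pn(2) yP(2) C(3,1)]
      square_from_norm[OF pn(3) yP(3) C(4,1)]; use d(2) r in simp)+
  have oc: "on_config f x 1 2 4 3 = on_config f x 1 2 3 4" "on_config f x 1 3 4 2 = on_config f x 1 2 3 4"
    "on_config f x 2 3 4 1 = on_config f x 1 2 3 4" "on_config f x 1 3 2 4 = on_config f x 1 2 3 4"
    if f: "f = quad_a \<or> f = quad_b \<or> f = quad_c" for f
    using on_config_perm[OF f] by metis+
  have ae: "all_edges x 1 2 4 3 = all_edges x 1 2 3 4" "all_edges x 1 3 4 2 = all_edges x 1 2 3 4"
    "all_edges x 2 3 4 1 = all_edges x 1 2 3 4" "all_edges x 1 3 2 4 = all_edges x 1 2 3 4"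
    using all_edges_perm by metis+
  note tp = triangle_polar_relation[OF t123] triangle_polar_relation[OF t124] triangle_polar_relation[OF t134]
    triangle_polar_relation[OF t234]
  note cr1 = circuit_relation[OF d(1) C0(1,3) t123 t134[folded apex_swap] sq(2) c1]
  have cr2: "y13 * y14 * y23 * y24 * config_polar 1 3 2 4 (4 * all_edges x 1 3 2 4 * d) (circuit x 1 3 2 4)
   = config_polar 1 3 2 4 (- (4 * all_edges x 1 3 2 4 * d)) (circuit x 1 3 2 4)"
  proof (rule circuit_relation[OF gs(4)])
    show "face_minor x 3 2 4 \<noteq> 0" "face_minor x 1 3 4 \<noteq> 0" using C0 by (simp_all add: fm)
    show "y12 * y13 * y23 * (apex x 1 3 2 4 + d) = apex x 1 3 2 4 - d"
      using t123 unfolding apex_def sym[of 3 2] apexU_perm(1)[of "ch (x 1 3)"] .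
    show "y12 * y14 * y24 * (apex x 1 4 2 3 + d) = apex x 1 4 2 3 - d" unfolding apex_swap by (rule t124)
    show "y12\<^sup>2 * dihedral x (- d) 3 4 1 2 = dihedral x d 3 4 1 2" by (rule sq)
    show "y13 * y14 * y23 * y24 * y12\<^sup>2 = y12 * y13 * y23 * (y12 * y14 * y24)" by (rule c2)
  qed
  have cr3: "y12 * y13 * y24 * y34 * config_polar 1 2 4 3 (4 * all_edges x 1 2 4 3 * d) (circuit x 1 2 4 3)
   = config_polar 1 2 4 3 (- (4 * all_edges x 1 2 4 3 * d)) (circuit x 1 2 4 3)"
    by (rule circuit_relation[OF gs(1) _ _ t124 t134 sq(3) c3]) (use C0 in \<open>simp_all add: fm\<close>)
  \<comment> \<open>Equality would be a degeneration of the triangle 124.\<close>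
  have gen: "triangle x 1 2 3 \<noteq> circuit x 1 3 2 4"
  proof
    assume "triangle x 1 2 3 = circuit x 1 3 2 4"
    then have "(x 1 3 * x 2 3) * x 1 2 = (x 1 3 * x 2 3) * (x 1 4 * x 2 4)"
      by (simp add: triangle_def circuit_def sym[of 3 2] sym[of 4 1] mult_ac)
    then have "x 4 1 * x 4 2 = x 1 2" using nz sym by simp
    moreover have "face_minor x 4 1 2 \<noteq> 0" using C0(3) face_minor_sym by metis
    ultimately show False using face_minor_nzD(2)[of 4 1 2] by simp
  qed
  have disc: "(on_config quad_b x 1 2 3 4)\<^sup>2 - 4 * on_config quad_a x 1 2 3 4 * on_config quad_c x 1 2 3 4 = (- (4 * all_edges x 1 2 3 4 * d))\<^sup>2"
    unfolding quad_disc by (simp add: power_mult_distrib d(1))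
  have Lnz: "all_edges x 1 2 3 4 \<noteq> 0" using nz by (simp add: all_edges_def)
  show "?P (- (4 * all_edges x 1 2 3 4 * d))"
  proof
    show "triangle x 1 2 3 * triangle x 1 2 4 * triangle x 1 3 4 * triangle x 2 3 4
      = circuit x 1 2 3 4 * circuit x 1 3 2 4 * circuit x 1 2 4 3" by (rule triangle_circuit_prod)
    show "y12 * y13 * y23 * (y12 * y14 * y24) * (y13 * y14 * y34) * (y23 * y24 * y34) =
      y12 * y14 * y23 * y34 * (y13 * y14 * y23 * y24) * (y12 * y13 * y24 * y34)" by algebra
    show "on_config quad_a x 1 2 3 4 = quad_a (triangle x 1 2 3) (triangle x 1 2 4) (triangle x 1 3 4) (triangle x 2 3 4)
        (circuit x 1 2 3 4) (circuit x 1 3 2 4) (circuit x 1 2 4 3)"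
      "on_config quad_b x 1 2 3 4 = quad_b (triangle x 1 2 3) (triangle x 1 2 4) (triangle x 1 3 4) (triangle x 2 3 4)
        (circuit x 1 2 3 4) (circuit x 1 3 2 4) (circuit x 1 2 4 3)"
      "on_config quad_c x 1 2 3 4 = quad_c (triangle x 1 2 3) (triangle x 1 2 4) (triangle x 1 3 4) (triangle x 2 3 4)
        (circuit x 1 2 3 4) (circuit x 1 3 2 4) (circuit x 1 2 4 3)"
      by (rule on_config_def)+
    show "y12 * y13 * y23 * (y12 * y14 * y24) \<noteq> y13 * y14 * y23 * y24"
    proof
      assume "y12 * y13 * y23 * (y12 * y14 * y24) = y13 * y14 * y23 * y24"
      then have "(y13 * y14 * y23 * y24) * y12\<^sup>2 = (y13 * y14 * y23 * y24) * 1" by algebra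
      then show False using y12 ynz by simp
    qed
  qed (use gen disc d(2) Lnz ynz face_minor_nzD(1)[OF C0(1)] face_minor_nzD(1)[OF C0(2)]
      face_minor_nzD(1)[OF C0(3)] face_minor_nzD(1)[OF C0(4)] tp cr1 cr2 cr3 in \<open>simp_all add: oc ae\<close>)
qed

end


section \<open>Cross-ratios on the double cover of an edge\<close>

lemma bil_add: "bil M (u + u') v = bil M u v + bil M u' v" "bil M u (v + v') = bil M u v + bil M u v'"
  by (simp_all add: bil_def matrix_vector_right_distrib algebra_simps sum.distrib)

lemma bil_diff: "bil M (u - u') v = bil M u v - bil M u' v" "bil M u (v - v') = bil M u v - bil M u v'"
  by (simp_all add: bil_def matrix_vector_mult_diff_distrib algebra_simps sum_subtractf)

lemma bil_scale: "bil M (k *s u) v = k * bil M u v" "bil M u (k *s v) = k * bil M u v"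
  by (simp_all add: bil_def vec.scale sum_distrib_left algebra_simps)

lemma bil_0 [simp]: "bil M 0 v = 0" "bil M u 0 = 0"
  by (simp_all add: bil_def)

lemmas bil_simps = bil_add bil_diff bil_scale bil_0

lemma bil_alt: "bil M u v = (\<Sum>i\<in>UNIV. \<Sum>j\<in>UNIV. M $ i $ j * u $ i * v $ j)"
  by (simp add: bil_def matrix_vector_mult_def sum_distrib_left algebra_simps)

lemma transpose_nth: "transpose M $ i $ j = M $ j $ i"
  by (simp add: transpose_def)

lemma bil_sym: "transpose M = M \<Longrightarrow> bil M u v = bil M v u"
proof -
  assume "transpose M = M"
  then have M: "M $ i $ j = M $ j $ i" for i j by (metis transpose_nth)
  have "bil M u v = (\<Sum>j\<in>UNIV. \<Sum>i\<in>UNIV. M $ i $ j * u $ i * v $ j)"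
    unfolding bil_alt by (rule sum.swap)
  also have "\<dots> = bil M v u" unfolding bil_alt by (intro sum.cong refl) (simp add: M mult.commute mult.left_commute)
  finally show ?thesis .
qed

lemma point_in_quadric: "v \<noteq> 0 \<Longrightarrow> point v \<in> quadric M \<longleftrightarrow> bil M v v = 0"
  unfolding quadric_def
  by (auto simp: Rep_point vec.span_singleton bil_simps)

definition lift_vec :: "complex \<Rightarrow> complex ^ 4 \<Rightarrow> complex ^ (4 option)" where
  "lift_vec w v = (\<chi> i. case i of None \<Rightarrow> w | Some j \<Rightarrow> v $ j)"

lemma lift_vec_nth [simp]: "lift_vec w v $ None = w" "x_part (lift_vec w v) = v"
  by (simp_all add: lift_vec_def x_part_def vec_eq_iff)

lemma lift_vec_collapse: "lift_vec (V $ None) (x_part V) = V"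
  by (simp add: lift_vec_def x_part_def vec_eq_iff split: option.splits)

lemma lift_vec_scale: "k *s lift_vec w v = lift_vec (k * w) (k *s v)"
  by (simp add: lift_vec_def vec_eq_iff split: option.splits)

lemma lift_vec_add: "lift_vec w v + lift_vec w' v' = lift_vec (w + w') (v + v')"
  by (simp add: lift_vec_def vec_eq_iff split: option.splits)

lemma lift_vec_eq_0: "lift_vec w v = 0 \<longleftrightarrow> w = 0 \<and> v = 0"
  by (metis lift_vec_nth lift_vec_collapse lift_vec_scale vec.scale_zero_left zero_index)

lemma x_part_linear: "x_part (U + V) = x_part U + x_part V" "x_part (k *s V) = k *s x_part V"
  by (simp_all add: x_part_def vec_eq_iff)

lemma point_in_double_cover:
  "V \<noteq> 0 \<Longrightarrow> point V \<in> double_cover M \<longleftrightarrow> (V $ None)\<^sup>2 = bil M (x_part V) (x_part V)"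
proof
  assume "V \<noteq> 0" "(V $ None)\<^sup>2 = bil M (x_part V) (x_part V)"
  then show "point V \<in> double_cover M"
    unfolding double_cover_def
    by (auto simp: Rep_point vec.span_singleton x_part_linear bil_simps power_mult_distrib power2_eq_square)
qed (simp add: double_cover_def Rep_point vec.span_base)

lemma cover_map_point: "V \<noteq> 0 \<Longrightarrow> cover_map (point V) = point (x_part V)"
  unfolding cover_map_def point_def[of "x_part V"]
  by (simp add: Rep_point vec.span_singleton image_image x_part_linear)

lemma x_part_nz: "V \<noteq> 0 \<Longrightarrow> (V $ None)\<^sup>2 = bil M (x_part V) (x_part V) \<Longrightarrow> x_part V \<noteq> 0"
  by (metis bil_0(1) lift_vec_collapse lift_vec_eq_0 power_eq_0_iff)

lemma ramification_pt_point: "u \<noteq> 0 \<Longrightarrow> ramification_pt (point u) = point (lift_vec 0 u)"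
proof -
  assume u: "u \<noteq> 0"
  have "{v. v $ None = 0 \<and> x_part v \<in> Rep_proj (point u)} = vec.span {lift_vec 0 u}"
  proof (intro set_eqI iffI)
    fix v assume "v \<in> {v. v $ None = 0 \<and> x_part v \<in> Rep_proj (point u)}"
    then obtain k where "v $ None = 0" "x_part v = k *s u" using u by (auto simp: Rep_point vec.span_singleton)
    then have "v = k *s lift_vec 0 u" using lift_vec_collapse[of v] by (simp add: lift_vec_scale)
    then show "v \<in> vec.span {lift_vec 0 u}" by (simp add: vec.span_base vec.span_scale)
  next
    fix v assume "v \<in> vec.span {lift_vec 0 u}"
    then show "v \<in> {v. v $ None = 0 \<and> x_part v \<in> Rep_proj (point u)}"
      using u by (auto simp: Rep_point vec.span_singleton x_part_linear)
  qed
  then show ?thesis unfolding ramification_pt_def point_def[of "lift_vec 0 u"] by simp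
qed

lemma span_pair: "vec.span {a, b :: complex ^ 'n} = {x *s a + y *s b |x y. True}"
proof (intro set_eqI iffI)
  fix u assume "u \<in> vec.span {a, b}"
  then obtain x where "u - x *s a \<in> vec.span {b}" by (auto simp: vec.span_insert)
  then obtain y where "u - x *s a = y *s b" by (auto simp: vec.span_singleton)
  then have "u = x *s a + y *s b" by (simp add: algebra_simps)
  then show "u \<in> {x *s a + y *s b |x y. True}" by blast
next
  fix u assume "u \<in> {x *s a + y *s b |x y. True}"
  then obtain x y where "u = x *s a + y *s b" by blast
  then show "u \<in> vec.span {a, b}"
    by (simp add: vec.span_add vec.span_scale vec.span_base)
qed

lemma dim_3_triple:
  assumes "vec.dim {A, B, C :: complex ^ 'n} = 3" "r *s A + s *s B + t *s C = 0"
  shows "r = 0 \<and> s = 0 \<and> t = 0"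
proof -
  obtain S where S: "S \<subseteq> {A, B, C}" "vec.independent S" "card S = 3"
    using vec.basis_exists[of "{A, B, C}"] assms(1) by metis
  have "card {A, B, C} \<le> 3" by (simp add: card_insert_le_m1)
  then have eq: "S = {A, B, C}" using S card_seteq[of "{A, B, C}" S] by simp
  have d: "A \<noteq> B" "A \<noteq> C" "B \<noteq> C" using S(3) unfolding eq by (auto simp: card_insert_if split: if_splits)
  have ind: "vec.independent {A, B, C}" using S eq by simp
  have u: "\<forall>v\<in>{A, B, C}. f v = 0" if "(\<Sum>v\<in>{A, B, C}. f v *s v) = 0" for f
    using ind that vec.independent_explicit_finite_subsets[of "{A, B, C}"] by auto
  define f where "f v = (if v = A then r else if v = B then s else t)" for v
  have "(\<Sum>v\<in>{A, B, C}. f v *s v) = r *s A + s *s B + t *s C"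
    using d by (simp add: f_def add.assoc)
  then have "\<forall>v\<in>{A, B, C}. f v = 0" using u[of f] assms(2) by simp
  then show ?thesis using d by (auto simp: f_def)
qed

lemma triple_dim_3:
  assumes "\<And>r s t. r *s A + s *s B + t *s C = 0 \<Longrightarrow> r = 0 \<and> s = 0 \<and> t = 0"
  shows "vec.dim {A, B, C :: complex ^ 'n} = 3"
proof -
  have d: "A \<noteq> B" "A \<noteq> C" "B \<noteq> C"
    using assms[of 1 "-1" 0] assms[of 1 0 "-1"] assms[of 0 1 "-1"] by auto
  have "vec.independent {A, B, C}"
    unfolding vec.independent_explicit_finite_subsets
  proof (intro allI impI ballI)
    fix S u v assume S: "S \<subseteq> {A, B, C}" "finite S" "(\<Sum>v\<in>S. u v *s v) = 0" "v \<in> S"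
    define f where "f v = (if v \<in> S then u v else 0)" for v
    have "(\<Sum>v\<in>S. u v *s v) = (\<Sum>v\<in>{A, B, C}. f v *s v)"
      using S(1) unfolding f_def by (intro sum.mono_neutral_cong_left) auto
    also have "\<dots> = f A *s A + f B *s B + f C *s C" using d by (simp add: add.assoc)
    finally have "f A = 0 \<and> f B = 0 \<and> f C = 0" using assms S(3) by simp
    then show "u v = 0" using S(1,4) unfolding f_def by auto
  qed
  then show ?thesis using d by (simp add: vec.dim_eq_card_independent card_insert_if)
qed

text \<open>Two vertices \<open>a\<close>, \<open>b\<close> normalized by \<open>q = 1\<close>, and the exponentiated length \<open>l\<close> of the edge.  The
  equation \<open>w\<^sup>2 = q\<close> of the preimage of the edge becomes \<open>w\<^sup>2 = (y + l * x) * (y + x / l)\<close> at the point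
  \<open>x *s a + y *s b\<close>, so the edge meets the quadric in \<open>a - l *s b\<close> and \<open>b - l *s a\<close>.\<close>

locale edge_line =
  fixes M :: "complex ^ 4 ^ 4" and a b :: "complex ^ 4" and l :: complex
  assumes sym: "transpose M = M"
    and aa: "bil M a a = 1" and bb: "bil M b b = 1" and ab: "bil M a b = (l + 1 / l) / 2"
    and l: "l \<noteq> 0" "l\<^sup>2 \<noteq> 1"
begin

lemma ba: "bil M b a = (l + 1 / l) / 2"
  using ab bil_sym[OF sym] by simp

abbreviation "edge_conic \<equiv> line_preimage M (vec.span {a, b})"

lemma orth_comb_zero:
  assumes "bil M a (x *s a + y *s b) = 0" "bil M b (x *s a + y *s b) = 0" shows "x = 0 \<and> y = 0"
proof -
  have "x + y * ((l + 1 / l) / 2) = 0" "x * ((l + 1 / l) / 2) + y = 0"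
    using assms by (simp_all add: bil_simps aa bb ab ba)
  then have "2 * l * x + y * (l\<^sup>2 + 1) = 0" "x * (l\<^sup>2 + 1) + 2 * l * y = 0"
    using l by (simp_all add: field_simps power2_eq_square)
  then have "x * (l\<^sup>2 - 1)\<^sup>2 = 0" "y * (l\<^sup>2 - 1)\<^sup>2 = 0" by algebra+
  moreover have "(l\<^sup>2 - 1)\<^sup>2 \<noteq> 0" using l(2) by (metis eq_iff_diff_eq_0 zero_eq_power2)
  ultimately show ?thesis by (metis mult_eq_0_iff)
qed

lemma comb_zero: "x *s a + y *s b = 0 \<Longrightarrow> x = 0 \<and> y = 0"
  by (rule orth_comb_zero) simp_all

lemma in_conic:
  assumes "V \<noteq> 0"
  shows "point V \<in> edge_conic \<longleftrightarrow> (V $ None)\<^sup>2 = bil M (x_part V) (x_part V) \<and> x_part V \<in> vec.span {a, b}"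
  unfolding line_preimage_def mem_Collect_eq point_in_double_cover[OF assms] cover_map_point[OF assms]
  using x_part_nz[OF assms, of M] point_in_pts[of "x_part V", OF _ vec.subspace_span] by blast

lemma bil_comb: "bil M (x *s a + y *s b) (x *s a + y *s b) = (y + l * x) * (y + x / l)"
  using l by (simp add: bil_simps aa bb ab ba field_simps power2_eq_square)

text \<open>The two linear factors of \<open>w\<^sup>2\<close> are proportional to the squares of the two parameters, and \<open>w\<close> to
  their product.\<close>

definition \<gamma> :: "2 proj \<Rightarrow> (4 option) proj" where
  "\<gamma> z = point ((coords z $ 1)\<^sup>2 *s lift_vec 0 (a - (1 / l) *s b)
     + (coords z $ 1 * coords z $ 2) *s lift_vec (l - 1 / l) 0
     + (coords z $ 2)\<^sup>2 *s lift_vec 0 (l *s b - a))"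

lemma \<gamma>_alt: "s\<^sup>2 *s lift_vec 0 (a - (1 / l) *s b) + (s * t) *s lift_vec (l - 1 / l) 0
     + t\<^sup>2 *s lift_vec 0 (l *s b - a)
   = lift_vec ((l - 1 / l) * s * t) ((s\<^sup>2 - t\<^sup>2) *s a + (l * t\<^sup>2 - s\<^sup>2 / l) *s b)"
  by (simp add: lift_vec_scale lift_vec_add vec_eq_iff algebra_simps)

lemma k_nz: "l - 1 / l \<noteq> 0"
  using l by (simp add: field_simps power2_eq_square)

lemma \<gamma>_parametrization: "conic_parametrization \<gamma> edge_conic"
proof -
  have "vec.dim {lift_vec 0 (a - (1 / l) *s b), lift_vec (l - 1 / l) 0, lift_vec 0 (l *s b - a)} = 3"
  proof (rule triple_dim_3)
    fix r s t
    assume "r *s lift_vec 0 (a - (1 / l) *s b) + s *s lift_vec (l - 1 / l) 0 + t *s lift_vec 0 (l *s b - a) = 0"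
    then have "lift_vec (s * (l - 1 / l)) ((r - t) *s a + (l * t - r / l) *s b) = 0"
      by (simp add: lift_vec_scale lift_vec_add vec_eq_iff algebra_simps)
    then have "s * (l - 1 / l) = 0" "r - t = 0 \<and> l * t - r / l = 0"
      unfolding lift_vec_eq_0 using comb_zero by blast+
    moreover from this have "(l - 1 / l) * t = 0" by (simp add: algebra_simps)
    ultimately show "r = 0 \<and> s = 0 \<and> t = 0" using k_nz by (metis eq_iff_diff_eq_0 mult_eq_0_iff)
  qed
  moreover have "range \<gamma> = edge_conic"
  proof (intro set_eqI iffI)
    fix p assume "p \<in> range \<gamma>"
    then obtain z where p: "p = \<gamma> z" by blast
    define s t where st: "s = coords z $ 1" "t = coords z $ 2"
    have nz: "s \<noteq> 0 \<or> t \<noteq> 0" using coords(1)[of z] unfolding st vec2_nz_iff .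
    define V where "V = lift_vec ((l - 1 / l) * s * t) ((s\<^sup>2 - t\<^sup>2) *s a + (l * t\<^sup>2 - s\<^sup>2 / l) *s b)"
    have V: "V \<noteq> 0"
    proof
      assume "V = 0"
      then have "(l - 1 / l) * s * t = 0" "s\<^sup>2 - t\<^sup>2 = 0 \<and> l * t\<^sup>2 - s\<^sup>2 / l = 0"
        unfolding V_def lift_vec_eq_0 using comb_zero by blast+
      then show False using nz k_nz by (auto simp: power2_eq_square)
    qed
    have "p = point V" unfolding p \<gamma>_def V_def \<gamma>_alt st ..
    moreover have "(V $ None)\<^sup>2 = bil M (x_part V) (x_part V)"
      unfolding V_def lift_vec_nth bil_comb using l by (simp add: field_simps) algebra
    moreover have "x_part V \<in> vec.span {a, b}" unfolding V_def lift_vec_nth span_pair by blast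
    ultimately show "p \<in> edge_conic" using in_conic[OF V] by simp
  next
    fix p assume p: "p \<in> edge_conic"
    obtain V where V: "V \<noteq> 0" "p = point V" by (rule proj_cases)
    then obtain x y where xy: "(V $ None)\<^sup>2 = bil M (x_part V) (x_part V)" "x_part V = x *s a + y *s b"
      using p in_conic[OF V(1)] unfolding span_pair by auto
    define w where "w = V $ None"
    have w: "w\<^sup>2 = (y + l * x) * (y + x / l)" using xy(1) unfolding w_def xy(2) bil_comb .
    define s where "s = csqrt (y + l * x)"
    obtain t where t: "t\<^sup>2 = y + x / l" "s * t = w"
    proof (cases "y + l * x = 0")
      case True
      then have "w = 0" "s = 0" using w by (simp_all add: s_def)
      then show thesis using that[of "csqrt (y + x / l)"] by simp
    next
      case False
      then have "s \<noteq> 0" "s\<^sup>2 = y + l * x" unfolding s_def by auto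
      then have "(w / s)\<^sup>2 = y + x / l" "s * (w / s) = w" using w False by (simp_all add: power_divide)
      then show thesis by (rule that)
    qed
    have s: "s\<^sup>2 = y + l * x" unfolding s_def by simp
    define k where "k = l - 1 / l"
    have e: "k * s * t = k * w" "s\<^sup>2 - t\<^sup>2 = k * x" "l * t\<^sup>2 - s\<^sup>2 / l = k * y"
      using l unfolding s t by (simp_all add: k_def t(2)[symmetric] field_simps)
    then have eq: "lift_vec (k * s * t) ((s\<^sup>2 - t\<^sup>2) *s a + (l * t\<^sup>2 - s\<^sup>2 / l) *s b) = k *s V"
      unfolding e by (subst lift_vec_collapse[of V, symmetric])
        (simp add: lift_vec_scale xy(2) w_def vec.scale_right_distrib vector_smult_assoc)
    have nz: "vector [s, t] \<noteq> (0 :: complex ^ 2)"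
    proof
      assume "vector [s, t] = (0 :: complex ^ 2)"
      then have "s = 0" "t = 0" using vec2_nz by blast+
      then have "k *s V = 0" using eq[symmetric] by (simp add: lift_vec_eq_0)
      then show False using V(1) k_nz unfolding k_def by simp
    qed
    define z where "z = point (vector [s, t] :: complex ^ 2)"
    obtain m where m: "m \<noteq> 0" "coords z = m *s vector [s, t]"
      using coords_point[OF nz] unfolding z_def by blast
    have "\<gamma> z = point (lift_vec (k * (m * s) * (m * t)) (((m * s)\<^sup>2 - (m * t)\<^sup>2) *s a + (l * (m * t)\<^sup>2 - (m * s)\<^sup>2 / l) *s b))"
      unfolding \<gamma>_def \<gamma>_alt m(2) k_def by simp
    also have "\<dots> = point (m\<^sup>2 *s lift_vec (k * s * t) ((s\<^sup>2 - t\<^sup>2) *s a + (l * t\<^sup>2 - s\<^sup>2 / l) *s b))"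
      by (rule arg_cong[of _ _ point])
        (simp add: lift_vec_scale vec_eq_iff algebra_simps power2_eq_square lift_vec_def split: option.splits)
    also have "\<dots> = p" using m(1) k_nz unfolding eq V(2) k_def[symmetric] by (simp add: point_scale)
    finally show "p \<in> range \<gamma>" by blast
  qed
  ultimately show ?thesis unfolding conic_parametrization_def \<gamma>_def[abs_def]
    by blast
qed

text \<open>The coordinate \<open>w\<close> and the products with \<open>a\<close> and \<open>b\<close> are linear coordinates on the span of the
  conic.\<close>

definition det3 :: "complex ^ (4 option) \<Rightarrow> complex ^ (4 option) \<Rightarrow> complex ^ (4 option) \<Rightarrow> complex" where
  "det3 U V W =
     U $ None * (bil M a (x_part V) * bil M b (x_part W) - bil M b (x_part V) * bil M a (x_part W))
   - V $ None * (bil M a (x_part U) * bil M b (x_part W) - bil M b (x_part U) * bil M a (x_part W))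
   + W $ None * (bil M a (x_part U) * bil M b (x_part V) - bil M b (x_part U) * bil M a (x_part V))"

lemma det3_scale: "det3 (k *s U) (k' *s V) (k'' *s W) = k * k' * k'' * det3 U V W"
  unfolding det3_def by (simp add: x_part_linear bil_simps algebra_simps)

text \<open>A Vandermonde determinant.  So the cross-ratio of four points of the conic can be computed from
  \<open>det3\<close> with the help of a fifth point, and does not depend on the parametrization.\<close>

lemma det3_veronese:
  fixes A B C :: "complex ^ (4 option)"
  defines "q \<equiv> \<lambda>s t. s\<^sup>2 *s A + (s * t) *s B + t\<^sup>2 *s C"
  shows "det3 (q s t) (q s' t') (q s'' t'') =
    det3 A B C * (s * t' - t * s') * (s * t'' - t * s'') * (s' * t'' - t' * s'')"
proof -
  have n: "q s t $ None = s\<^sup>2 * A $ None + s * t * B $ None + t\<^sup>2 * C $ None"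
    "bil M u (x_part (q s t)) = s\<^sup>2 * bil M u (x_part A) + s * t * bil M u (x_part B) + t\<^sup>2 * bil M u (x_part C)" for s t u
    unfolding q_def by (simp_all add: x_part_linear bil_simps)
  show ?thesis unfolding det3_def n by algebra
qed

lemma conic_cross_ratio:
  "cross_ratio_on_conic edge_conic (point (lift_vec 1 a)) (point (lift_vec 0 (a - l *s b)))
     (point (lift_vec 1 b)) (point (lift_vec 0 (b - l *s a))) = affine_pt l"
proof -
  define V1 where "V1 = lift_vec 1 a"
  define V2 where "V2 = lift_vec 0 (a - l *s b)"
  define V3 where "V3 = lift_vec 1 b"
  define V4 where "V4 = lift_vec 0 (b - l *s a)"
  \<comment> \<open>The auxiliary fifth point of the conic is the other lift of \<open>b\<close>.\<close>
  define V5 where "V5 = lift_vec (- 1) b"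
  have comb: "1 *s a + (- l) *s b = a - l *s b" "(- l) *s a + 1 *s b = b - l *s a"
    "1 *s a + 0 *s b = a" by simp_all
  have nz2: "a - l *s b \<noteq> 0" "b - l *s a \<noteq> 0"
    using comb_zero[of 1 "- l"] comb_zero[of "- l" 1] unfolding comb by (metis zero_neq_one)+
  have nz: "V1 \<noteq> 0" "V2 \<noteq> 0" "V3 \<noteq> 0" "V4 \<noteq> 0" "V5 \<noteq> 0"
    using nz2 unfolding V1_def V2_def V3_def V4_def V5_def lift_vec_eq_0 by auto
  have sp: "a \<in> vec.span {a, b}" "b \<in> vec.span {a, b}" "a - l *s b \<in> vec.span {a, b}" "b - l *s a \<in> vec.span {a, b}"
    by (intro vec.span_diff vec.span_scale vec.span_base; simp)+
  have iso: "bil M (a - l *s b) (a - l *s b) = 0" "bil M (b - l *s a) (b - l *s a) = 0"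
    using l by (simp_all add: bil_simps aa bb ab ba field_simps)
  have on: "point V1 \<in> edge_conic" "point V2 \<in> edge_conic" "point V3 \<in> edge_conic" "point V4 \<in> edge_conic" "point V5 \<in> edge_conic"
    unfolding in_conic[OF nz(1)] in_conic[OF nz(2)] in_conic[OF nz(3)] in_conic[OF nz(4)] in_conic[OF nz(5)]
    unfolding V1_def V2_def V3_def V4_def V5_def lift_vec_nth
    using sp iso by (simp_all add: aa bb)
  have uniq: "cross_ratio z1 z2 z3 z4 = affine_pt l"
    if g: "conic_parametrization g edge_conic" and z: "g z1 = point V1" "g z2 = point V2" "g z3 = point V3" "g z4 = point V4"
    for g z1 z2 z3 z4
  proof -
    obtain A B C where ABC: "vec.dim {A, B, C} = 3"
      "\<And>z. g z = point ((coords z $ 1)\<^sup>2 *s A + (coords z $ 1 * coords z $ 2) *s B + (coords z $ 2)\<^sup>2 *s C)"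
      "range g = edge_conic"
      using g unfolding conic_parametrization_def by blast
    define q where "q s t = s\<^sup>2 *s A + (s * t) *s B + t\<^sup>2 *s C" for s t
    obtain z5 where z5: "g z5 = point V5" using on(5) ABC(3) by (metis rangeE)
    have q_nz: "q (coords z $ 1) (coords z $ 2) \<noteq> 0" for z :: "2 proj"
      using dim_3_triple[OF ABC(1)] coords(1)[of z] unfolding q_def vec2_nz_iff by (metis power_eq_0_iff)
    have ex: "\<exists>k. k \<noteq> 0 \<and> q (coords z $ 1) (coords z $ 2) = k *s V" if "g z = point V" "V \<noteq> 0" for z :: "2 proj" and V
      using point_eqD[of V "q (coords z $ 1) (coords z $ 2)"] that q_nz ABC(2)[of z] unfolding q_def by metis
    obtain k1 where k1: "k1 \<noteq> 0" "q (coords z1 $ 1) (coords z1 $ 2) = k1 *s V1" using ex[OF z(1) nz(1)] by blast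
    obtain k2 where k2: "k2 \<noteq> 0" "q (coords z2 $ 1) (coords z2 $ 2) = k2 *s V2" using ex[OF z(2) nz(2)] by blast
    obtain k3 where k3: "k3 \<noteq> 0" "q (coords z3 $ 1) (coords z3 $ 2) = k3 *s V3" using ex[OF z(3) nz(3)] by blast
    obtain k4 where k4: "k4 \<noteq> 0" "q (coords z4 $ 1) (coords z4 $ 2) = k4 *s V4" using ex[OF z(4) nz(4)] by blast
    obtain k5 where k5: "k5 \<noteq> 0" "q (coords z5 $ 1) (coords z5 $ 2) = k5 *s V5" using ex[OF z5 nz(5)] by blast
    note dv = det3_veronese[where A = A and B = B and C = C, folded q_def]
    define d where "d = det3 A B C"
    have e125: "k1 * k2 * k5 * det3 V1 V2 V5 = d * bracket z1 z2 * bracket z1 z5 * bracket z2 z5"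
      unfolding d_def bracket_def det3_scale[symmetric] k1(2)[symmetric] k2(2)[symmetric] k5(2)[symmetric] dv ..
    have e345: "k3 * k4 * k5 * det3 V3 V4 V5 = d * bracket z3 z4 * bracket z3 z5 * bracket z4 z5"
      unfolding d_def bracket_def det3_scale[symmetric] k3(2)[symmetric] k4(2)[symmetric] k5(2)[symmetric] dv ..
    have e145: "k1 * k4 * k5 * det3 V1 V4 V5 = d * bracket z1 z4 * bracket z1 z5 * bracket z4 z5"
      unfolding d_def bracket_def det3_scale[symmetric] k1(2)[symmetric] k4(2)[symmetric] k5(2)[symmetric] dv ..
    have e325: "k3 * k2 * k5 * det3 V3 V2 V5 = d * bracket z3 z2 * bracket z3 z5 * bracket z2 z5"
      unfolding d_def bracket_def det3_scale[symmetric] k3(2)[symmetric] k2(2)[symmetric] k5(2)[symmetric] dv ..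
    have D: "det3 V1 V4 V5 * det3 V3 V2 V5 \<noteq> 0"
      "det3 V1 V2 V5 * det3 V3 V4 V5 = l * (det3 V1 V4 V5 * det3 V3 V2 V5)"
    proof -
      have lin: "bil M a (x_part V1) = 1" "bil M b (x_part V1) = (l + 1 / l) / 2"
        "bil M a (x_part V2) = 1 - l * ((l + 1 / l) / 2)" "bil M b (x_part V2) = (l + 1 / l) / 2 - l"
        "bil M a (x_part V3) = (l + 1 / l) / 2" "bil M b (x_part V3) = 1"
        "bil M a (x_part V4) = (l + 1 / l) / 2 - l" "bil M b (x_part V4) = 1 - l * ((l + 1 / l) / 2)"
        "bil M a (x_part V5) = (l + 1 / l) / 2" "bil M b (x_part V5) = 1"
        unfolding V1_def V2_def V3_def V4_def V5_def by (simp_all add: bil_simps aa bb ab ba)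
      have N: "V1 $ None = 1" "V2 $ None = 0" "V3 $ None = 1" "V4 $ None = 0" "V5 $ None = - 1"
        unfolding V1_def V2_def V3_def V4_def V5_def by simp_all
      have d145: "det3 V1 V4 V5 = (l\<^sup>2 - 1)\<^sup>2 / (4 * l\<^sup>2) * (l + 1)"
        unfolding det3_def lin N using l by (simp add: field_simps) algebra
      have d325: "det3 V3 V2 V5 = - ((l\<^sup>2 - 1)\<^sup>2 / (4 * l\<^sup>2) * 2)"
        unfolding det3_def lin N using l by (simp add: field_simps) algebra
      have d125: "det3 V1 V2 V5 = (l\<^sup>2 - 1)\<^sup>2 / (4 * l\<^sup>2) * (- l - 1)"
        unfolding det3_def lin N using l by (simp add: field_simps) algebra
      have d345: "det3 V3 V4 V5 = (l\<^sup>2 - 1)\<^sup>2 / (4 * l\<^sup>2) * (2 * l)"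
        unfolding det3_def lin N using l by (simp add: field_simps) algebra
      have "l + 1 \<noteq> 0" using l by (metis add_eq_0_iff2 power2_minus power_one)
      then show "det3 V1 V4 V5 * det3 V3 V2 V5 \<noteq> 0" unfolding d145 d325 using l by simp
      show "det3 V1 V2 V5 * det3 V3 V4 V5 = l * (det3 V1 V4 V5 * det3 V3 V2 V5)"
        unfolding d145 d325 d125 d345 by algebra
    qed
    define k where "k = k1 * k2 * k3 * k4 * k5\<^sup>2"
    define E where "E = d\<^sup>2 * bracket z1 z5 * bracket z2 z5 * bracket z3 z5 * bracket z4 z5"
    have p1: "k * (det3 V1 V4 V5 * det3 V3 V2 V5) = E * (bracket z1 z4 * bracket z3 z2)"
      using e145 e325 unfolding k_def E_def by algebra
    have p2: "k * (det3 V1 V2 V5 * det3 V3 V4 V5) = E * (bracket z1 z2 * bracket z3 z4)"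
      using e125 e345 unfolding k_def E_def by algebra
    have "k \<noteq> 0" using k1 k2 k3 k4 k5 unfolding k_def by simp
    then have E: "E \<noteq> 0" "bracket z1 z4 * bracket z3 z2 \<noteq> 0" using p1 D(1) by (metis mult_eq_0_iff)+
    have "E * (bracket z1 z2 * bracket z3 z4) = E * (l * (bracket z1 z4 * bracket z3 z2))"
      using p1 p2 D(2) by algebra
    then have "bracket z1 z2 * bracket z3 z4 = bracket z1 z4 * bracket z3 z2 * l" using E(1) by simp
    then have "cross_ratio z1 z2 z3 z4 = point ((bracket z1 z4 * bracket z3 z2) *s vector [l, 1])"
      unfolding cross_ratio_def by (simp add: vec2_scale)
    then show ?thesis unfolding affine_pt_def point_scale[OF E(2)] .
  qed
  have "\<exists>z. \<gamma> z = p" if "p \<in> edge_conic" for p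
    using that \<gamma>_parametrization unfolding conic_parametrization_def by (metis rangeE)
  then obtain z1 z2 z3 z4 where z: "\<gamma> z1 = point V1" "\<gamma> z2 = point V2" "\<gamma> z3 = point V3" "\<gamma> z4 = point V4"
    using on by metis
  show ?thesis
    unfolding cross_ratio_on_conic_def V1_def[symmetric] V2_def[symmetric] V3_def[symmetric] V4_def[symmetric]
  proof (rule the_equality)
    show "\<exists>\<gamma> z1 z2 z3 z4. conic_parametrization \<gamma> edge_conic \<and> \<gamma> z1 = point V1 \<and> \<gamma> z2 = point V2 \<and>
      \<gamma> z3 = point V3 \<and> \<gamma> z4 = point V4 \<and> affine_pt l = cross_ratio z1 z2 z3 z4"
      using \<gamma>_parametrization z uniq[OF \<gamma>_parametrization z] by metis
  next
    fix r assume "\<exists>\<gamma> z1 z2 z3 z4. conic_parametrization \<gamma> edge_conic \<and> \<gamma> z1 = point V1 \<and> \<gamma> z2 = point V2 \<and>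
      \<gamma> z3 = point V3 \<and> \<gamma> z4 = point V4 \<and> r = cross_ratio z1 z2 z3 z4"
    then show "r = affine_pt l" using uniq by blast
  qed
qed

end

lemma affine_coord_affine_pt: "affine_coord (affine_pt z) = z"
proof -
  have "vector [z, 1] \<noteq> (0 :: complex ^ 2)" by (simp add: vec2_nz)
  then obtain k where "k \<noteq> 0" "coords (affine_pt z) = k *s vector [z, 1]"
    using coords_point unfolding affine_pt_def by blast
  then show ?thesis by (simp add: affine_coord_def)
qed


section \<open>Determinants of four vectors\<close>

lemma vector_4 [simp]:
  "(vector [a, b, c, d] :: 'a :: zero ^ 4) $ 1 = a" "(vector [a, b, c, d] :: 'a ^ 4) $ 2 = b"
  "(vector [a, b, c, d] :: 'a ^ 4) $ 3 = c" "(vector [a, b, c, d] :: 'a ^ 4) $ 4 = d"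
  unfolding vector_def by simp_all

lemma det_4:
  "det (A :: 'a :: comm_ring_1 ^ 4 ^ 4) =
     A $ 1 $ 1 * (A $ 2 $ 2 * (A $ 3 $ 3 * A $ 4 $ 4 - A $ 3 $ 4 * A $ 4 $ 3)
       - A $ 2 $ 3 * (A $ 3 $ 2 * A $ 4 $ 4 - A $ 3 $ 4 * A $ 4 $ 2)
       + A $ 2 $ 4 * (A $ 3 $ 2 * A $ 4 $ 3 - A $ 3 $ 3 * A $ 4 $ 2))
   - A $ 1 $ 2 * (A $ 2 $ 1 * (A $ 3 $ 3 * A $ 4 $ 4 - A $ 3 $ 4 * A $ 4 $ 3)
       - A $ 2 $ 3 * (A $ 3 $ 1 * A $ 4 $ 4 - A $ 3 $ 4 * A $ 4 $ 1)
       + A $ 2 $ 4 * (A $ 3 $ 1 * A $ 4 $ 3 - A $ 3 $ 3 * A $ 4 $ 1))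
   + A $ 1 $ 3 * (A $ 2 $ 1 * (A $ 3 $ 2 * A $ 4 $ 4 - A $ 3 $ 4 * A $ 4 $ 2)
       - A $ 2 $ 2 * (A $ 3 $ 1 * A $ 4 $ 4 - A $ 3 $ 4 * A $ 4 $ 1)
       + A $ 2 $ 4 * (A $ 3 $ 1 * A $ 4 $ 2 - A $ 3 $ 2 * A $ 4 $ 1))
   - A $ 1 $ 4 * (A $ 2 $ 1 * (A $ 3 $ 2 * A $ 4 $ 3 - A $ 3 $ 3 * A $ 4 $ 2)
       - A $ 2 $ 2 * (A $ 3 $ 1 * A $ 4 $ 3 - A $ 3 $ 3 * A $ 4 $ 1)
       + A $ 2 $ 3 * (A $ 3 $ 1 * A $ 4 $ 2 - A $ 3 $ 2 * A $ 4 $ 1))"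
proof -
  have f: "finite {2::4, 3, 4}" "1 \<notin> {2::4, 3, 4}" "finite {3::4, 4}" "2 \<notin> {3::4, 4}"
    "finite {4::4}" "3 \<notin> {4::4}" by auto
  show ?thesis
    unfolding det_def UNIV_4
    unfolding sum_over_permutations_insert[OF f(1,2)] sum_over_permutations_insert[OF f(3,4)]
      sum_over_permutations_insert[OF f(5,6)]
    unfolding permutes_sing
    by (simp add: sign_swap_id permutation_swap_id sign_compose sign_id swap_id_eq permutation_compose algebra_simps)
qed

definition det4 :: "complex ^ 4 \<Rightarrow> complex ^ 4 \<Rightarrow> complex ^ 4 \<Rightarrow> complex ^ 4 \<Rightarrow> complex" where
  "det4 u v x y = det (vector [u, v, x, y] :: complex ^ 4 ^ 4)"

definition comb4 :: "complex ^ 4 \<Rightarrow> complex ^ 4 \<Rightarrow> complex ^ 4 \<Rightarrow> complex ^ 4 \<Rightarrow> complex ^ 4 \<Rightarrow> complex ^ 4" where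
  "comb4 k u v x y = k $ 1 *s u + k $ 2 *s v + k $ 3 *s x + k $ 4 *s y"

lemma comb4_mv: "transpose (vector [u, v, x, y] :: complex ^ 4 ^ 4) *v k = comb4 k u v x y"
  by (simp add: comb4_def vec_eq_iff forall_4 matrix_vector_mult_def sum_4 transpose_def mult.commute)

lemma det4_comb: "det4 (comb4 k1 u v x y) (comb4 k2 u v x y) (comb4 k3 u v x y) (comb4 k4 u v x y)
  = det4 k1 k2 k3 k4 * det4 u v x y"
  unfolding det4_def comb4_def det_mul[symmetric]
  by (rule arg_cong[of _ _ det]) (simp add: vec_eq_iff forall_4 matrix_matrix_mult_def sum_4)

lemma det4_nz_comb:
  assumes "det4 u v x y \<noteq> 0" obtains k where "z = comb4 k u v x y"
proof -
  let ?R = "transpose (vector [u, v, x, y] :: complex ^ 4 ^ 4)"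
  have "invertible ?R" using assms unfolding det4_def invertible_det_nz det_transpose .
  then obtain S where "?R ** S = mat 1" unfolding invertible_def by blast
  then have "z = ?R *v (S *v z)" by (simp add: matrix_vector_mul_assoc)
  also have "\<dots> = comb4 (S *v z) u v x y"
    by (rule comb4_mv)
  finally show thesis by (rule that)
qed

lemma det4_zero_comb:
  assumes "det4 u v x y = 0" obtains k where "k \<noteq> 0" "comb4 k u v x y = 0"
proof -
  let ?R = "transpose (vector [u, v, x, y] :: complex ^ 4 ^ 4)"
  have "\<not> invertible ?R" using assms unfolding det4_def invertible_det_nz det_transpose by simp
  then obtain k where "k \<noteq> 0" "?R *v k = 0"
    using invertible_left_inverse matrix_left_invertible_ker by blast
  moreover have "?R *v k = comb4 k u v x y"
    by (rule comb4_mv)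
  ultimately show thesis using that by metis
qed

lemma det4_gram:
  "det M * (det4 u v x y)\<^sup>2 = det4
     (vector [bil M u u, bil M u v, bil M u x, bil M u y]) (vector [bil M v u, bil M v v, bil M v x, bil M v y])
     (vector [bil M x u, bil M x v, bil M x x, bil M x y]) (vector [bil M y u, bil M y v, bil M y x, bil M y y])"
proof -
  let ?R = "vector [u, v, x, y] :: complex ^ 4 ^ 4"
  have "det M * (det4 u v x y)\<^sup>2 = det (?R ** (M ** transpose ?R))"
    by (simp add: det_mul det_transpose det4_def power2_eq_square)
  also have "?R ** (M ** transpose ?R) = (vector
     [(vector [bil M u u, bil M u v, bil M u x, bil M u y]), (vector [bil M v u, bil M v v, bil M v x, bil M v y]),
     (vector [bil M x u, bil M x v, bil M x x, bil M x y]), (vector [bil M y u, bil M y v, bil M y x, bil M y y])])"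
    unfolding vec_eq_iff forall_4
    by (simp add: matrix_matrix_mult_def transpose_def bil_def matrix_vector_mult_def)
  finally show ?thesis unfolding det4_def .
qed

lemma complete_basis:
  assumes "\<And>s t. s *s u + t *s v = 0 \<Longrightarrow> s = 0 \<and> t = 0"
  obtains x y where "det4 u v x y \<noteq> 0"
proof -
  have "\<exists>i j. u $ i * v $ j - u $ j * v $ i \<noteq> 0"
  proof (rule ccontr)
    assume "\<not> ?thesis"
    then have z: "u $ i * v $ j = u $ j * v $ i" for i j by simp
    have "v $ i *s u + (- u $ i) *s v = 0" for i
      by (simp add: vec_eq_iff z mult.commute)
    then have "v $ i = 0" "u $ i = 0" for i using assms[of "v $ i" "- u $ i"] by simp_all
    then have "1 *s u + 0 *s v = 0" by (simp add: vec_eq_iff)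
    then show False using assms[of 1 0] by simp
  qed
  then obtain i j where ij: "u $ i * v $ j - u $ j * v $ i \<noteq> 0" by blast
  have "\<exists>k l. det4 u v (axis k 1) (axis l 1) \<noteq> 0"
  proof (rule ccontr)
    assume "\<not> ?thesis"
    then have z: "det4 u v (axis k 1) (axis l 1) = 0" for k l by simp
    have "\<forall>i j. u $ i * v $ j - u $ j * v $ i = 0"
      using z[of 1 2] z[of 1 3] z[of 1 4] z[of 2 3] z[of 2 4] z[of 3 4]
      unfolding forall_4 det4_def det_4 by (simp add: axis_def algebra_simps)
    then show False using ij by blast
  qed
  then show thesis using that by blast
qed


section \<open>The two families of generators\<close>

definition nondegenerate :: "complex ^ 4 ^ 4 \<Rightarrow> bool" where
  "nondegenerate M \<longleftrightarrow> transpose M = M \<and> (\<forall>v. (\<forall>u. bil M v u = 0) \<longrightarrow> v = 0)"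

lemma nondegenerate_det: "nondegenerate M \<Longrightarrow> det M \<noteq> 0"
proof
  assume M: "nondegenerate M" "det M = 0"
  then obtain k where k: "k \<noteq> 0" "M *v k = 0"
    using invertible_det_nz invertible_left_inverse matrix_left_invertible_ker by metis
  have "bil M k u = 0" for u
    using M(1) bil_sym[of M k u] k(2) by (simp add: nondegenerate_def) (simp add: bil_def)
  then show False using M(1) k(1) by (simp add: nondegenerate_def)
qed

text \<open>A form of linear independence that does not identify the two vectors when they are equal, as
  independence of a set would.\<close>

definition indep2 :: "complex ^ 4 \<Rightarrow> complex ^ 4 \<Rightarrow> bool" where
  "indep2 u v \<longleftrightarrow> (\<forall>s t. s *s u + t *s v = 0 \<longrightarrow> s = 0 \<and> t = 0)"

lemma indep2_iff: "indep2 u v \<longleftrightarrow> u \<noteq> v \<and> vec.independent {u, v}"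
proof
  assume i: "indep2 u v"
  have "1 *s u + (- 1) *s v = u - v" "1 *s u + 0 *s v = u" "0 *s u + 1 *s v = v" by simp_all
  then have ne: "u \<noteq> v" "u \<noteq> 0" "v \<noteq> 0"
    using i unfolding indep2_def by (metis eq_iff_diff_eq_0 zero_neq_one)+
  have "u \<notin> vec.span {v}"
  proof
    assume "u \<in> vec.span {v}"
    then obtain k where "u = k *s v" by (auto simp: vec.span_singleton)
    then have "1 *s u + (- k) *s v = 0" by simp
    then show False using i unfolding indep2_def by (metis zero_neq_one)
  qed
  then show "u \<noteq> v \<and> vec.independent {u, v}" using ne by (simp add: vec.independent_insert)
next
  assume "u \<noteq> v \<and> vec.independent {u, v}"
  then have uv: "u \<notin> vec.span {v}" "v \<noteq> 0" by (auto simp: vec.independent_insert split: if_splits)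
  show "indep2 u v" unfolding indep2_def
  proof (intro allI impI)
    fix s t assume st: "s *s u + t *s v = 0"
    have "s = 0"
    proof (rule ccontr)
      assume s: "s \<noteq> 0"
      have "s *s u = (- t) *s v" using st by (simp add: eq_neg_iff_add_eq_0)
      then have "inverse s *s (s *s u) = (inverse s * - t) *s v" by (simp add: vector_smult_assoc)
      then have "u = (inverse s * - t) *s v" using s by (simp add: vector_smult_assoc)
      then show False using uv(1) by (metis vec.span_base vec.span_scale singletonI)
    qed
    then show "s = 0 \<and> t = 0" using st uv(2) by simp
  qed
qed

lemma indep2_dim: "indep2 u v \<Longrightarrow> vec.dim (vec.span {u, v}) = 2"
  unfolding indep2_iff by (simp add: vec.dim_span vec.dim_eq_card_independent)

lemma dim_2_basis:
  assumes "vec.subspace l" "vec.dim l = 2" "u \<in> l" "u \<noteq> 0"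
  obtains v where "l = vec.span {u, v}" "indep2 u v"
proof -
  have "vec.independent {u}" using assms(4) by (simp add: vec.independent_insert)
  then obtain B where B: "{u} \<subseteq> B" "B \<subseteq> l" "vec.independent B" "l \<subseteq> vec.span B"
    using vec.maximal_independent_subset_extend[of "{u}" l] assms(3) by auto
  have "card B = 2" using vec.dim_eq_card[of B l] B assms(1,2) vec.span_minimal[of B l]
    by (metis vec.span_eq_iff subset_antisym)
  then obtain v where v: "B = {u, v}" "u \<noteq> v" using B(1) by (auto simp: card_2_iff doubleton_eq_iff)
  have "l = vec.span {u, v}" using B(2,4) assms(1) vec.span_minimal[of B l] unfolding v(1) by blast
  then show thesis using that[of v] v B(3) unfolding indep2_iff by simp
qed

lemma generator_iff: "l \<in> generators M \<longleftrightarrow> vec.subspace l \<and> vec.dim l = 2 \<and> (\<forall>w\<in>l. bil M w w = 0)"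
proof -
  have "pts l \<subseteq> quadric M \<longleftrightarrow> (\<forall>w\<in>l. bil M w w = 0)" if l: "vec.subspace l"
  proof
    assume a: "pts l \<subseteq> quadric M"
    show "\<forall>w\<in>l. bil M w w = 0"
    proof
      fix w assume "w \<in> l"
      then show "bil M w w = 0"
        using a l point_in_pts[of w l] point_in_quadric[of w M] by (cases "w = 0") auto
    qed
  next
    assume "\<forall>w\<in>l. bil M w w = 0"
    then show "pts l \<subseteq> quadric M" by (auto simp: pts_def quadric_def)
  qed
  then show ?thesis unfolding generators_def by blast
qed

lemma generator_orthogonal:
  assumes "transpose M = M" "l \<in> generators M" "u \<in> l" "v \<in> l" shows "bil M u v = 0"
proof -
  have "u + v \<in> l" using assms by (simp add: generator_iff vec.subspace_add)
  then have "bil M (u + v) (u + v) = 0" "bil M u u = 0" "bil M v v = 0"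
    using assms by (auto simp: generator_iff)
  then show ?thesis using bil_sym[OF assms(1), of u v] by (simp add: bil_simps)
qed

lemma generator_basis:
  assumes "l \<in> generators M" obtains u v where "l = vec.span {u, v}" "indep2 u v"
proof -
  have l: "vec.subspace l" "vec.dim l = 2" using assms by (auto simp: generator_iff)
  then have "\<not> l \<subseteq> {0}" using vec.dim_eq_0[of l] by simp
  then obtain u where "u \<in> l" "u \<noteq> 0" by auto
  then show thesis using dim_2_basis[OF l] that by metis
qed

text \<open>The quadric and the volume form define a Hodge operator on bivectors, with square \<open>det M\<close>.  The
  condition says that the bivector of \<open>l\<close> is an eigenvector with eigenvalue \<open>k\<close>.  The two families of
  generators are the two eigenspaces; this gives a sign to each generator that can be compared between
  different points of the quadric.\<close>

definition hodge :: "complex ^ 4 ^ 4 \<Rightarrow> complex \<Rightarrow> (complex ^ 4) set \<Rightarrow> bool" where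
  "hodge M k l \<longleftrightarrow> (\<forall>u\<in>l. \<forall>v\<in>l. \<forall>x y. bil M u x * bil M v y - bil M u y * bil M v x = k * det4 u v x y)"

lemma det4_comb_pair:
  "det4 (p *s u + q *s v) (r *s u + s *s v) (comb4 k u v x y) (comb4 k' u v x y)
   = (p * s - q * r) * (k $ 3 * k' $ 4 - k $ 4 * k' $ 3) * det4 u v x y"
proof -
  have "p *s u + q *s v = comb4 (vector [p, q, 0, 0]) u v x y" "r *s u + s *s v = comb4 (vector [r, s, 0, 0]) u v x y"
    by (simp_all add: comb4_def)
  then have "det4 (p *s u + q *s v) (r *s u + s *s v) (comb4 k u v x y) (comb4 k' u v x y)
    = det4 (vector [p, q, 0, 0]) (vector [r, s, 0, 0]) k k' * det4 u v x y" by (simp add: det4_comb)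
  also have "det4 (vector [p, q, 0, 0]) (vector [r, s, 0, 0]) k k' = (p * s - q * r) * (k $ 3 * k' $ 4 - k $ 4 * k' $ 3)"
    unfolding det4_def det_4 by (simp add: algebra_simps)
  finally show ?thesis .
qed

text \<open>A generator is its own polar line, so both sides of the eigenvalue equation are alternating forms on
  the two-dimensional quotient by the generator, and proportional.  The factor is found from the Gram determinant of a
  basis that extends a basis of the generator.\<close>

lemma hodge_exists:
  assumes M: "transpose M = M" and l: "l \<in> generators M"
  obtains k where "k\<^sup>2 = det M" "hodge M k l"
proof -
  obtain u v where uv: "l = vec.span {u, v}" "indep2 u v" using generator_basis[OF l] by blast
  obtain x y where xy: "det4 u v x y \<noteq> 0" using complete_basis[of u v] uv(2) unfolding indep2_def by metis
  have uvl: "u \<in> l" "v \<in> l" unfolding uv(1) by (simp_all add: vec.span_base)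
  have z: "bil M u u = 0" "bil M u v = 0" "bil M v u = 0" "bil M v v = 0"
    using generator_orthogonal[OF M l] uvl by auto
  define m where "m = bil M u x * bil M v y - bil M u y * bil M v x"
  define k where "k = m / det4 u v x y"
  have k: "k * det4 u v x y = m" using xy by (simp add: k_def)
  have "det M * (det4 u v x y)\<^sup>2 = m\<^sup>2"
    unfolding det4_gram z bil_sym[OF M, of x u] bil_sym[OF M, of x v] bil_sym[OF M, of y u] bil_sym[OF M, of y v] m_def
    unfolding det4_def det_4 by simp algebra
  then have "k\<^sup>2 = det M" unfolding k_def using xy by (simp add: power_divide field_simps)
  moreover have "hodge M k l" unfolding hodge_def
  proof (intro ballI allI)
    fix u' v' x' y' assume "u' \<in> l" "v' \<in> l"
    then obtain p q r s where uv': "u' = p *s u + q *s v" "v' = r *s u + s *s v"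
      unfolding uv(1) span_pair by blast
    obtain i j where xy': "x' = comb4 i u v x y" "y' = comb4 j u v x y" using det4_nz_comb[OF xy] by metis
    have "bil M u' x' * bil M v' y' - bil M u' y' * bil M v' x' = (p * s - q * r) * (i $ 3 * j $ 4 - i $ 4 * j $ 3) * m"
      unfolding uv' xy' comb4_def m_def by (simp add: bil_simps z) algebra
    also have "\<dots> = k * det4 u' v' x' y'" unfolding uv' xy' det4_comb_pair k[symmetric] by simp
    finally show "bil M u' x' * bil M v' y' - bil M u' y' * bil M v' x' = k * det4 u' v' x' y'" .
  qed
  ultimately show thesis by (rule that)
qed

lemma span_from_det4:
  assumes "indep2 u v" "\<And>y. det4 u v w y = 0" shows "w \<in> vec.span {u, v}"
proof -
  obtain x y where xy: "det4 u v x y \<noteq> 0" using complete_basis[of u v] assms(1) unfolding indep2_def by metis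
  obtain k where k: "w = comb4 k u v x y" using det4_nz_comb[OF xy] by metis
  have x: "x = comb4 (vector [0, 0, 1, 0]) u v x y" and y: "y = comb4 (vector [0, 0, 0, 1]) u v x y"
    by (simp_all add: comb4_def)
  have "det4 u v w z = (k $ 3 * j $ 4 - k $ 4 * j $ 3) * det4 u v x y" if "z = comb4 j u v x y" for z j
    using det4_comb_pair[of 1 u 0 v 0 1 k x y j] unfolding k that by simp
  from this[OF x] this[OF y] have "k $ 3 = 0" "k $ 4 = 0" using assms(2) xy by simp_all
  then show ?thesis unfolding k comb4_def span_pair by auto
qed

lemma det4_swap: "det4 u v x y = - det4 v u x y" "det4 u v x y = - det4 u x v y"
  unfolding det4_def det_4 by (simp_all add: algebra_simps)

text \<open>For spanning vectors \<open>u, v\<close> and \<open>u, v'\<close> of the two generators, the two eigenvalue equations, each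
  evaluated on the other generator, express \<open>bil M u y * bil M v v'\<close> by the same determinant with opposite
  signs.  So \<open>v\<close> and \<open>v'\<close> are orthogonal, and then the equation
  says that \<open>v\<close> depends linearly on \<open>u\<close> and \<open>v'\<close>.\<close>

lemma hodge_same:
  assumes M: "nondegenerate M" and l: "l \<in> generators M" "l' \<in> generators M"
    and k: "k \<noteq> 0" "hodge M k l" "hodge M k l'" and u: "u \<in> l" "u \<in> l'" "u \<noteq> 0"
  shows "l \<subseteq> l'"
proof
  fix v assume v: "v \<in> l"
  have sym: "transpose M = M" using M by (simp add: nondegenerate_def)
  obtain v' where v': "l' = vec.span {u, v'}" "indep2 u v'"
    using dim_2_basis[of l' u] l(2) u by (auto simp: generator_iff)
  have v'l: "v' \<in> l'" unfolding v'(1) by (simp add: vec.span_base)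
  have o: "bil M u v = 0" "bil M u v' = 0" using generator_orthogonal[OF sym] l u v v'l by blast+
  have e1: "- (bil M u y * bil M v v') = k * det4 u v v' y" for y
    using k(2) u(1) v o unfolding hodge_def by (metis mult_zero_left diff_0)
  have e2: "- (bil M u y * bil M v' v) = k * det4 u v' v y" for y
    using k(3) u(2) v'l o unfolding hodge_def by (metis mult_zero_left diff_0)
  have "bil M u y * bil M v v' = 0" for y
    using e1[of y] e2[of y] det4_swap(2)[of u v v' y] bil_sym[OF sym, of v v'] by auto
  moreover obtain y where "bil M u y \<noteq> 0" using M u(3) unfolding nondegenerate_def by blast
  ultimately have "bil M v' v = 0" using bil_sym[OF sym, of v v'] by (metis mult_eq_0_iff)
  then have "det4 u v' v y = 0" for y using e2[of y] k(1) by simp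
  then show "v \<in> l'" unfolding v'(1) by (rule span_from_det4[OF v'(2)])
qed

text \<open>Evaluated on the two generators, the eigenvalue equations give \<open>k\<close> times and \<open>- k\<close> times the same
  determinant, which is therefore 0.\<close>

lemma hodge_opposite:
  assumes M: "transpose M = M" and l: "l \<in> generators M" "l' \<in> generators M"
    and k: "k \<noteq> 0" "hodge M k l" "hodge M (- k) l'"
  shows "l \<inter> l' \<noteq> {0}" "l \<noteq> l'"
proof -
  obtain u v where uv: "l = vec.span {u, v}" "indep2 u v" using generator_basis[OF l(1)] by blast
  obtain u' v' where uv': "l' = vec.span {u', v'}" "indep2 u' v'" using generator_basis[OF l(2)] by blast
  have m: "u \<in> l" "v \<in> l" "u' \<in> l'" "v' \<in> l'" unfolding uv(1) uv'(1) by (simp_all add: vec.span_base)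
  have "bil M u u' * bil M v v' - bil M u v' * bil M v u' = k * det4 u v u' v'"
    using k(2) m unfolding hodge_def by blast
  moreover have "bil M u' u * bil M v' v - bil M u' v * bil M v' u = - k * det4 u' v' u v"
    using k(3) m unfolding hodge_def by blast
  moreover have "det4 u' v' u v = det4 u v u' v'" unfolding det4_def det_4 by (simp add: algebra_simps)
  ultimately have "det4 u v u' v' = 0"
    using k(1) bil_sym[OF M, of u' u] bil_sym[OF M, of v' v] bil_sym[OF M, of u' v] bil_sym[OF M, of v' u]
    by (simp add: mult.commute)
  then obtain c where c: "c \<noteq> 0" "comb4 c u v u' v' = 0" by (rule det4_zero_comb)
  define w where "w = c $ 1 *s u + c $ 2 *s v"
  have w2: "w = (- c $ 3) *s u' + (- c $ 4) *s v'"
    using c(2) unfolding w_def comb4_def by (simp add: algebra_simps eq_neg_iff_add_eq_0)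
  have "w \<in> l" unfolding uv(1) span_pair w_def by blast
  moreover have "w \<in> l'" unfolding uv'(1) span_pair w2 by blast
  moreover have "w \<noteq> 0"
  proof
    assume "w = 0"
    then have "c $ 1 = 0" "c $ 2 = 0" "- c $ 3 = 0" "- c $ 4 = 0"
      using uv(2) uv'(2) w_def w2 unfolding indep2_def by metis+
    then have "c = 0" by (simp add: vec_eq_iff forall_4)
    then show False using c(1) by simp
  qed
  ultimately show "l \<inter> l' \<noteq> {0}" by blast
  show "l \<noteq> l'"
  proof
    assume "l = l'"
    obtain x y where xy: "det4 u v x y \<noteq> 0" using complete_basis[of u v] uv(2) unfolding indep2_def by metis
    have "k * det4 u v x y = - k * det4 u v x y"
      using k(2,3) m(1,2) \<open>l = l'\<close> unfolding hodge_def by metis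
    then show False using k(1) xy by simp
  qed
qed

definition hodge_family :: "complex ^ 4 ^ 4 \<Rightarrow> complex \<Rightarrow> (complex ^ 4) set set" where
  "hodge_family M k = {l \<in> generators M. hodge M k l}"

lemma generator_family_class:
  assumes M: "nondegenerate M" and F: "F \<in> generator_families M"
  obtains k where "k\<^sup>2 = det M" "F = hodge_family M k"
proof -
  have sym: "transpose M = M" using M by (simp add: nondegenerate_def)
  obtain l0 where l0: "l0 \<in> generators M"
    "F = {(l, l'). l \<in> generators M \<and> l' \<in> generators M \<and> (l = l' \<or> l \<inter> l' = {0})} `` {l0}"
    using F unfolding generator_families_def by (auto elim!: quotientE)
  obtain k where k: "k\<^sup>2 = det M" "hodge M k l0" using hodge_exists[OF sym l0(1)] by blast
  have k0: "k \<noteq> 0" using k(1) nondegenerate_det[OF M] by auto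
  have "F = hodge_family M k"
  proof (intro set_eqI iffI)
    fix l assume "l \<in> F"
    then have l: "l \<in> generators M" "l0 = l \<or> l0 \<inter> l = {0}" unfolding l0(2) by auto
    obtain k' where k': "k'\<^sup>2 = det M" "hodge M k' l" using hodge_exists[OF sym l(1)] by blast
    then have "k' = k \<or> k' = - k" using k(1) by (metis power2_eq_iff)
    then have "hodge M k l" using l(2) k' hodge_opposite[OF sym l0(1) l(1) k0 k(2)] by auto
    then show "l \<in> hodge_family M k" using l(1) by (simp add: hodge_family_def)
  next
    fix l assume "l \<in> hodge_family M k"
    then have l: "l \<in> generators M" "hodge M k l" by (simp_all add: hodge_family_def)
    have "l0 = l \<or> l0 \<inter> l = {0}"
    proof (rule ccontr)
      assume n: "\<not> ?thesis"
      have "0 \<in> l0" "0 \<in> l" using l0(1) l(1) by (simp_all add: generator_iff vec.subspace_0)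
      then obtain u where u: "u \<in> l0" "u \<in> l" "u \<noteq> 0" using n by blast
      have "l0 \<subseteq> l" "l \<subseteq> l0"
        using hodge_same[OF M l0(1) l(1) k0 k(2) l(2) u] hodge_same[OF M l(1) l0(1) k0 l(2) k(2) u(2,1,3)] .
      then show False using n by blast
    qed
    then show "l \<in> F" unfolding l0(2) using l0(1) l(1) by blast
  qed
  then show thesis by (rule that[OF k(1)])
qed

lemma gen_through_hodge:
  assumes M: "nondegenerate M" and k: "k \<noteq> 0" and l: "l \<in> hodge_family M k" "p \<in> pts l"
  shows "gen_through (hodge_family M k) p = l"
  unfolding gen_through_def
proof (rule the_equality)
  show "l \<in> hodge_family M k \<and> p \<in> pts l" using l by blast
  fix l' assume l': "l' \<in> hodge_family M k \<and> p \<in> pts l'"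
  have u: "coords p \<in> l" "coords p \<in> l'" "coords p \<noteq> 0"
    using l(2) l' coords[of p] unfolding pts_def by auto
  show "l' = l"
    using hodge_same[OF M _ _ k, of l l' "coords p"] hodge_same[OF M _ _ k, of l' l "coords p"] l(1) l' u
    unfolding hodge_family_def by blast
qed

lemma span_in_generators:
  assumes "transpose M = M" "indep2 e f" "bil M e e = 0" "bil M e f = 0" "bil M f f = 0"
  shows "vec.span {e, f} \<in> generators M"
  unfolding generator_iff
proof (intro conjI ballI)
  show "vec.dim (vec.span {e, f}) = 2" by (rule indep2_dim[OF assms(2)])
  fix w assume "w \<in> vec.span {e, f}"
  then show "bil M w w = 0" unfolding span_pair using assms bil_sym[OF assms(1), of f e] by (auto simp: bil_simps)
qed (simp add: vec.subspace_span)

context edge_line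
begin

lemma reversed: "edge_line M b a l"
  using sym aa bb ba l by unfold_locales auto

lemma isotropic: "bil M (a - l *s b) (a - l *s b) = 0"
  using l by (simp add: bil_simps aa bb ab ba field_simps)

text \<open>The generator of sign \<open>k\<close> through the point \<open>a - l *s b\<close> of the edge meets the polar line of the edge in
  the point \<open>f\<close> that satisfies a linear condition.  As the eigenvalue of the generator is known up to
  sign, a single nonzero coefficient of the eigenvalue equation is enough.  Exchanging \<open>a\<close> and \<open>b\<close> changes
  the sign of the determinant, so the same \<open>f\<close> lies on the generator of sign \<open>- k\<close> through the other point
  of the edge.\<close>

lemma generator_to_polar:
  assumes M: "nondegenerate M" and k: "k\<^sup>2 = det M"
    and f: "bil M f a = 0" "bil M f b = 0" "bil M f f = 0" "bil M f c \<noteq> 0"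
    and c: "k * det4 a b f c = (l - 1 / l) / 2 * bil M f c"
  shows "vec.span {a - l *s b, f} \<in> hodge_family M k"
proof -
  define e where "e = a - l *s b"
  have f0: "f \<noteq> 0" using f(4) by auto
  have fa: "bil M a f = 0" "bil M b f = 0" using f bil_sym[OF sym] by metis+
  have ef: "indep2 e f" unfolding indep2_def
  proof (intro allI impI)
    fix s t assume st: "s *s e + t *s f = 0"
    have "bil M u (s *s e) = 0" if "bil M u f = 0" for u
    proof -
      have "bil M u (s *s e + t *s f) = 0" unfolding st by simp
      then show ?thesis using that by (simp add: bil_simps)
    qed
    moreover have "s *s e = s *s a + (- (s * l)) *s b" unfolding e_def by (simp add: vec_eq_iff algebra_simps)
    ultimately have "s = 0" using orth_comb_zero[of s "- (s * l)"] fa by metis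
    then show "s = 0 \<and> t = 0" using st f0 by simp
  qed
  have "bil M e f = 0" unfolding e_def by (simp add: bil_simps fa)
  then have gen: "vec.span {e, f} \<in> generators M"
    using span_in_generators[OF sym ef] isotropic f(3) unfolding e_def by blast
  obtain k' where k': "hodge M k' (vec.span {e, f})" using hodge_exists[OF sym gen] by blast
  have "bil M e a * bil M f c - bil M e c * bil M f a = k' * det4 e f a c"
    using k' unfolding hodge_def by (simp add: vec.span_base)
  moreover have "bil M e a = - l * ((l - 1 / l) / 2)"
    unfolding e_def using l by (simp add: bil_simps aa ba field_simps power2_eq_square)
  moreover have "det4 e f a c = - l * det4 a b f c"
    unfolding e_def det4_def det_4 by (simp add: algebra_simps)
  ultimately have "- l * ((l - 1 / l) / 2 * bil M f c) = - l * (k' * det4 a b f c)"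
    using f(1) by simp
  then have "(l - 1 / l) / 2 * bil M f c = k' * det4 a b f c" using l(1) by (metis mult_cancel_left neg_equal_0_iff_equal)
  then have "k * det4 a b f c = k' * det4 a b f c" "k * det4 a b f c \<noteq> 0"
    using c f(4) k_nz by auto
  then have "k' = k" by auto
  then show ?thesis using k' gen unfolding hodge_family_def e_def by simp
qed

lemma polar_generators_meet:
  assumes f: "bil M f a = 0" "bil M f b = 0"
  shows "vec.span {a - l *s b, f} \<inter> vec.span {b - l *s a, f} = vec.span {f}"
proof (intro set_eqI iffI)
  have fa: "bil M a f = 0" "bil M b f = 0" using f bil_sym[OF sym] by metis+
  fix z assume "z \<in> vec.span {a - l *s b, f} \<inter> vec.span {b - l *s a, f}"
  then obtain p q r s where z: "z = p *s (a - l *s b) + q *s f" "z = r *s (b - l *s a) + s *s f"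
    unfolding span_pair by blast
  have eq: "(p + r * l) *s a + (- (p * l) - r) *s b = (s - q) *s f"
  proof -
    have "p *s (a - l *s b) - r *s (b - l *s a) = (s - q) *s f" using z by (simp add: algebra_simps)
    moreover have "p *s (a - l *s b) - r *s (b - l *s a) = (p + r * l) *s a + (- (p * l) - r) *s b"
      by (simp add: vec_eq_iff algebra_simps)
    ultimately show ?thesis by simp
  qed
  have "p + r * l = 0 \<and> - (p * l) - r = 0"
    by (rule orth_comb_zero) (unfold eq, simp_all add: bil_simps fa)
  then have "p * (l\<^sup>2 - 1) = 0" by algebra
  then have "p = 0" using l(2) by simp
  then show "z \<in> vec.span {f}" using z(1) by (simp add: vec.span_base vec.span_scale)
next
  fix z assume "z \<in> vec.span {f}"
  then show "z \<in> vec.span {a - l *s b, f} \<inter> vec.span {b - l *s a, f}"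
    using vec.span_mono[of "{f}" "{a - l *s b, f}"] vec.span_mono[of "{f}" "{b - l *s a, f}"] by blast
qed

end


section \<open>Vertices, faces and markings of a tetrahedron\<close>

lemma det4_zero_kernel:
  assumes "det4 a b c d = 0" obtains y where "y \<noteq> 0" "\<forall>r\<in>{a, b, c, d}. (\<Sum>i\<in>UNIV. r $ i * y $ i) = 0"
proof -
  let ?R = "vector [a, b, c, d] :: complex ^ 4 ^ 4"
  have "\<not> invertible ?R" using assms unfolding det4_def invertible_det_nz by simp
  then obtain y where y: "y \<noteq> 0" "?R *v y = 0"
    using invertible_left_inverse matrix_left_invertible_ker by blast
  have "(?R *v y) $ 1 = (\<Sum>i\<in>UNIV. a $ i * y $ i)" "(?R *v y) $ 2 = (\<Sum>i\<in>UNIV. b $ i * y $ i)"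
    "(?R *v y) $ 3 = (\<Sum>i\<in>UNIV. c $ i * y $ i)" "(?R *v y) $ 4 = (\<Sum>i\<in>UNIV. d $ i * y $ i)"
    by (simp_all add: matrix_vector_mult_def)
  then show thesis using that[of y] y by auto
qed

lemma bil_dot: "bil M u v = (\<Sum>i\<in>UNIV. (M *v v) $ i * u $ i)"
  by (simp add: bil_def mult.commute)

text \<open>A vector orthogonal to a basis of \<open>V\<close> exists since the 4 by 4 matrix with rows 0 and the images of
  the three basis vectors under \<open>M\<close> is singular.\<close>

lemma hyperplane_polar:
  assumes M: "nondegenerate M" and V: "vec.subspace V" "vec.dim V = 3"
  obtains n where "V = {x. bil M n x = 0}"
proof -
  obtain B where B: "B \<subseteq> V" "vec.independent B" "V \<subseteq> vec.span B" "card B = 3"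
    using vec.basis_exists[of V] V(2) by metis
  then obtain a b c where abc: "B = {a, b, c}" by (auto simp: card_3_iff)
  have "det4 (M *v a) (M *v b) (M *v c) 0 = 0"
    unfolding det4_def det_4 by simp
  then obtain n where n: "n \<noteq> 0" "\<forall>r\<in>{M *v a, M *v b, M *v c, 0}. (\<Sum>i\<in>UNIV. r $ i * n $ i) = 0"
    by (rule det4_zero_kernel)
  define K where "K = {x. bil M n x = 0}"
  have K: "vec.subspace K" unfolding vec.subspace_def K_def by (auto simp: bil_simps)
  have "B \<subseteq> K" using n(2) unfolding abc K_def bil_dot by auto
  then have VK: "V \<subseteq> K" using B(3) vec.span_minimal[OF _ K] by blast
  obtain u where "bil M n u \<noteq> 0" using M n(1) unfolding nondegenerate_def by blast
  then have "u \<notin> K" by (simp add: K_def)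
  then have "vec.span K \<noteq> UNIV" using K vec.span_eq_iff[of K] by (metis UNIV_I)
  then have "vec.dim K \<noteq> 4" using vec.dim_eq_full[of K] by (simp add: vec.dimension_def card_cart_basis)
  moreover have "vec.dim K \<le> 4" using vec.dim_subset_UNIV[of K] by (simp add: vec.dimension_def card_cart_basis)
  ultimately have "vec.dim K \<le> vec.dim V" using V(2) by simp
  then have "V = K" using vec.subspace_dim_equal[OF V(1) K VK] by simp
  then show thesis using that unfolding K_def by blast
qed

text \<open>The bases \<open>n\<close> and \<open>v\<close>, indexed by the vertices, are dual for the bilinear form.  For a tetrahedron, \<open>v\<close>
  represents the vertices and \<open>n\<close> the poles of the faces, which are the vertices of the dual
  tetrahedron.  Condition \<open>total\<close> says that \<open>n\<close> spans the space.\<close>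

locale dual_bases =
  fixes M :: "complex ^ 4 ^ 4" and n v :: "nat \<Rightarrow> complex ^ 4"
  assumes nd: "nondegenerate M"
    and dual: "i \<in> Idx \<Longrightarrow> j \<in> Idx \<Longrightarrow> bil M (n i) (v j) = (if i = j then 1 else 0)"
    and total: "(\<And>i. i \<in> Idx \<Longrightarrow> bil M (n i) x = 0) \<Longrightarrow> x = 0"
begin

lemma symM: "transpose M = M"
  using nd by (simp add: nondegenerate_def)

lemma expand: "x = bil M (n 1) x *s v 1 + bil M (n 2) x *s v 2 + bil M (n 3) x *s v 3 + bil M (n 4) x *s v 4"
proof -
  have "x - (bil M (n 1) x *s v 1 + bil M (n 2) x *s v 2 + bil M (n 3) x *s v 3 + bil M (n 4) x *s v 4) = 0"
    by (rule total) (auto simp: bil_simps dual)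
  then show ?thesis by simp
qed

lemma intersection:
  assumes "i \<in> Idx" shows "{x. \<forall>j\<in>Idx - {i}. bil M (n j) x = 0} = vec.span {v i}"
proof (intro set_eqI iffI)
  fix x assume "x \<in> {x. \<forall>j\<in>Idx - {i}. bil M (n j) x = 0}"
  then have x: "bil M (n j) x = 0" if "j \<in> Idx" "j \<noteq> i" for j using that by blast
  have "x - bil M (n i) x *s v i = 0"
  proof (rule total)
    fix j assume "j \<in> Idx"
    then show "bil M (n j) (x - bil M (n i) x *s v i) = 0"
      using x[of j] assms by (cases "j = i") (simp_all add: bil_simps dual)
  qed
  then have "x = bil M (n i) x *s v i" by simp
  then show "x \<in> vec.span {v i}" by (metis vec.span_base vec.span_scale singletonI)
next
  fix x assume "x \<in> vec.span {v i}"
  then show "x \<in> {x. \<forall>j\<in>Idx - {i}. bil M (n j) x = 0}"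
    using assms by (auto simp: vec.span_singleton bil_simps dual)
qed

lemma total': assumes "\<And>i. i \<in> Idx \<Longrightarrow> bil M (v i) x = 0" shows "x = 0"
proof -
  have "bil M x y = 0" for y
    unfolding bil_sym[OF symM, of x y] by (subst expand[of y]) (simp add: bil_simps assms)
  then show ?thesis using nd unfolding nondegenerate_def by blast
qed

lemma det4_nz: "det4 (v 1) (v 2) (v 3) (v 4) \<noteq> 0"
proof
  assume "det4 (v 1) (v 2) (v 3) (v 4) = 0"
  then obtain k where k: "k \<noteq> 0" "comb4 k (v 1) (v 2) (v 3) (v 4) = 0" by (rule det4_zero_comb)
  have "bil M (n i) (comb4 k (v 1) (v 2) (v 3) (v 4)) = 0" for i unfolding k(2) by simp
  from this[of 1] this[of 2] this[of 3] this[of 4] have "k = 0"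
    unfolding comb4_def by (simp add: bil_simps dual vec_eq_iff forall_4)
  then show False using k(1) by simp
qed

lemma bases_nz: "i \<in> Idx \<Longrightarrow> v i \<noteq> 0" "i \<in> Idx \<Longrightarrow> n i \<noteq> 0"
  using dual[of i i] by auto

lemma rescale:
  assumes "\<And>i. i \<in> Idx \<Longrightarrow> c i \<noteq> 0"
  shows "dual_bases M (\<lambda>i. inverse (c i) *s n i) (\<lambda>i. c i *s v i)"
proof
  show "nondegenerate M" by (rule nd)
  show "bil M (inverse (c i) *s n i) (c j *s v j) = (if i = j then 1 else 0)" if "i \<in> Idx" "j \<in> Idx" for i j
    using dual[OF that] assms[OF that(1)] by (cases "i = j") (simp_all add: bil_simps)
  show "x = 0" if "\<And>i. i \<in> Idx \<Longrightarrow> bil M (inverse (c i) *s n i) x = 0" for x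
  proof (rule total)
    fix i assume i: "i \<in> Idx"
    show "bil M (n i) x = 0" using that[OF i] assms[OF i] by (simp add: bil_simps)
  qed
qed

lemma swap: "dual_bases M v n"
proof
  show "nondegenerate M" by (rule nd)
  show "bil M (v i) (n j) = (if i = j then 1 else 0)" if "i \<in> Idx" "j \<in> Idx" for i j
    using dual[OF that(2,1)] bil_sym[OF symM, of "v i" "n j"] by auto
qed (rule total')

end

lemma dual_bases_exist:
  assumes M: "nondegenerate M" and t: "\<And>x. (\<And>i. i \<in> Idx \<Longrightarrow> bil M (n i) x = 0) \<Longrightarrow> x = 0"
  obtains v where "dual_bases M n v"
proof -
  let ?R = "vector [n 1, n 2, n 3, n 4] ** M :: complex ^ 4 ^ 4"
  have R: "(?R *v x) $ 1 = bil M (n 1) x" "(?R *v x) $ 2 = bil M (n 2) x"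
    "(?R *v x) $ 3 = bil M (n 3) x" "(?R *v x) $ 4 = bil M (n 4) x" for x
    unfolding matrix_vector_mul_assoc[symmetric] by (simp_all add: matrix_vector_mult_def bil_def)
  have "x = 0" if "?R *v x = 0" for x
  proof (rule t)
    fix i assume "i \<in> Idx"
    then show "bil M (n i) x = 0" using R[of x] unfolding that by auto
  qed
  then have "invertible ?R" unfolding invertible_left_inverse matrix_left_invertible_ker by blast
  then obtain S where S: "?R ** S = mat 1" unfolding invertible_def by blast
  define v where "v j = S *v axis (of_nat j :: 4) 1" for j
  have Rv: "?R *v v j = axis (of_nat j) 1" for j
    unfolding v_def matrix_vector_mul_assoc S by simp
  have "dual_bases M n v"
  proof
    show "bil M (n i) (v j) = (if i = j then 1 else 0)" if ij: "i \<in> Idx" "j \<in> Idx" for i j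
      using R[of "v j"] ij unfolding Rv by (auto simp: axis_def)
  qed (use M t in auto)
  then show thesis by (rule that)
qed

text \<open>A face is smooth iff its pole does not lie on the quadric, which is the last conclusion.\<close>

lemma projective_tetrahedron_bases:
  assumes T: "projective_tetrahedron T"
  obtains n v where "dual_bases (eqn T) n v"
    "\<And>i. i \<in> Idx \<Longrightarrow> vertex T i = point (v i)"
    "\<And>i. i \<in> Idx \<Longrightarrow> bil (eqn T) (v i) (v i) \<noteq> 0"
    "\<And>i. i \<in> Idx \<Longrightarrow> bil (eqn T) (n i) (n i) \<noteq> 0"
proof -
  define M where "M = eqn T"
  have sym: "transpose M = M" and sm: "smooth_section M UNIV"
    and F: "\<And>i. i \<in> Idx \<Longrightarrow> vec.subspace (face T i) \<and> vec.dim (face T i) = 3"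
    and Int: "(\<Inter>i\<in>Idx. face T i) = {0}"
    and smF: "\<And>i. i \<in> Idx \<Longrightarrow> smooth_section M (face T i)"
    and vq: "\<And>i. i \<in> Idx \<Longrightarrow> vertex T i \<notin> quadric M"
    using T unfolding projective_tetrahedron_def M_def by blast+
  have M: "nondegenerate M" unfolding nondegenerate_def
  proof (intro conjI allI impI sym)
    fix v assume v: "\<forall>u. bil M v u = 0"
    show "v = 0"
    proof (rule ccontr)
      assume "v \<noteq> 0"
      then show False using sm v unfolding smooth_section_def by blast
    qed
  qed
  have "\<exists>n. face T i = {x. bil M n x = 0}" if "i \<in> Idx" for i
    using hyperplane_polar[OF M, of "face T i"] F[OF that] by metis
  then obtain n where n: "\<And>i. i \<in> Idx \<Longrightarrow> face T i = {x. bil M (n i) x = 0}" by metis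
  have total: "x = 0" if "\<And>i. i \<in> Idx \<Longrightarrow> bil M (n i) x = 0" for x
  proof -
    have "x \<in> (\<Inter>i\<in>Idx. face T i)" using that n by blast
    then show ?thesis unfolding Int by simp
  qed
  obtain v where nv: "dual_bases M n v" using dual_bases_exist[OF M total] by blast
  interpret dual_bases M n v by (rule nv)
  have vert: "vertex T i = point (v i)" if i: "i \<in> Idx" for i
  proof -
    have "(\<Inter>j\<in>Idx - {i}. face T j) = {x. \<forall>j\<in>Idx - {i}. bil M (n j) x = 0}" using n by auto
    then show ?thesis unfolding vertex_def intersection[OF i] point_def by simp
  qed
  have qv: "bil M (v i) (v i) \<noteq> 0" if i: "i \<in> Idx" for i
    using vq[OF i] vert[OF i] point_in_quadric[OF bases_nz(1)[OF i], of M] by simp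
  have qn: "bil M (n i) (n i) \<noteq> 0" if i: "i \<in> Idx" for i
  proof
    assume z: "bil M (n i) (n i) = 0"
    then have "n i \<in> face T i" using n[OF i] by simp
    then obtain u where "u \<in> face T i" "bil M (n i) u \<noteq> 0"
      using smF[OF i] bases_nz(2)[OF i] z unfolding smooth_section_def by blast
    then show False using n[OF i] by simp
  qed
  show thesis using that[of n v] nv vert qv qn unfolding M_def by blast
qed

lemma join_points: "a \<noteq> 0 \<Longrightarrow> b \<noteq> 0 \<Longrightarrow> join (point a) (point b) = vec.span {a, b}"
proof -
  assume "a \<noteq> 0" "b \<noteq> 0"
  then have "join (point a) (point b) = vec.span (vec.span {a} \<union> vec.span {b})"
    by (simp add: join_def Rep_point)
  also have "\<dots> = vec.span {a, b}"
  proof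
    have "vec.span {a} \<subseteq> vec.span {a, b}" "vec.span {b} \<subseteq> vec.span {a, b}" by (simp_all add: vec.span_mono)
    then show "vec.span (vec.span {a} \<union> vec.span {b}) \<subseteq> vec.span {a, b}"
      by (intro vec.span_minimal) (auto simp: vec.subspace_span)
    show "vec.span {a, b} \<subseteq> vec.span (vec.span {a} \<union> vec.span {b})"
      by (intro vec.span_minimal) (auto simp: vec.subspace_span intro!: vec.span_base)
  qed
  finally show ?thesis .
qed

text \<open>The parameters of the two points are the roots of a quadratic equation with product 1.  So the second
  point, \<open>a - (1 / l) *s b\<close>, is \<open>b - l *s a\<close>, and \<open>l\<close> depends on the two vertices symmetrically.\<close>

lemma quadric_points_on_edge:
  assumes sym: "transpose M = M" and a: "bil M a a = 1" and b: "bil M b b = 1" and i: "indep2 a b"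
    and E: "E \<noteq> E'" "pts (vec.span {a, b}) \<inter> quadric M = {E, E'}"
  obtains l where "l \<noteq> 0" "l\<^sup>2 \<noteq> 1" "bil M a b = (l + 1 / l) / 2" "E = point (a - l *s b)" "E' = point (b - l *s a)"
proof -
  define g where "g = bil M a b"
  have g: "bil M b a = g" using bil_sym[OF sym, of b a] by (simp add: g_def)
  have comb: "1 *s a + (- l) *s b = a - l *s b" "(- l) *s a + 1 *s b = b - l *s a" for l by simp_all
  have nz: "a - l *s b \<noteq> 0" "b - l *s a \<noteq> 0" for l
    using i unfolding indep2_def comb[symmetric] by (metis zero_neq_one)+
  have sp: "a - l *s b \<in> vec.span {a, b}" "b - l *s a \<in> vec.span {a, b}" for l
    by (intro vec.span_diff vec.span_scale vec.span_base; simp)+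
  have q: "bil M (a - l *s b) (a - l *s b) = 1 - 2 * g * l + l\<^sup>2" "bil M (b - l *s a) (b - l *s a) = 1 - 2 * g * l + l\<^sup>2" for l
    using a b g by (simp_all add: bil_simps g_def[symmetric] power2_eq_square algebra_simps)
  have on: "point (a - l *s b) \<in> {E, E'} \<longleftrightarrow> 1 - 2 * g * l + l\<^sup>2 = 0" "point (b - l *s a) \<in> {E, E'} \<longleftrightarrow> 1 - 2 * g * l + l\<^sup>2 = 0" for l
    unfolding E(2)[symmetric] Int_iff point_in_quadric[OF nz(1)] point_in_quadric[OF nz(2)] q
      point_in_pts[OF nz(1) vec.subspace_span] point_in_pts[OF nz(2) vec.subspace_span] using sp by simp_all
  have ex: "\<exists>l. p = point (a - l *s b)" if "p \<in> {E, E'}" for p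
  proof -
    have p: "p \<in> pts (vec.span {a, b})" "p \<in> quadric M" using that E(2) by blast+
    obtain w where w: "w \<noteq> 0" "p = point w" by (rule proj_cases)
    then have "w \<in> vec.span {a, b}" "bil M w w = 0"
      using p point_in_pts[OF w(1) vec.subspace_span] point_in_quadric[OF w(1)] by blast+
    then obtain x y where xy: "w = x *s a + y *s b" "bil M w w = 0" unfolding span_pair by blast
    have "x \<noteq> 0"
    proof
      assume "x = 0"
      then have "y * y = 0" using xy b by (simp add: bil_simps)
      then show False using w(1) xy(1) \<open>x = 0\<close> by simp
    qed
    then have "w = x *s (a - (- y / x) *s b)" unfolding xy(1) by (simp add: vec_eq_iff field_simps)
    then have "p = point (a - (- y / x) *s b)" unfolding w(2) by (metis point_scale \<open>x \<noteq> 0\<close>)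
    then show ?thesis by blast
  qed
  obtain l where l: "E = point (a - l *s b)" using ex by blast
  obtain l' where l': "E' = point (a - l' *s b)" using ex by blast
  have r: "1 - 2 * g * l + l\<^sup>2 = 0" "1 - 2 * g * l' + l'\<^sup>2 = 0" using on(1)[of l] on(1)[of l'] l l' by simp_all
  have "l \<noteq> l'" using E(1) l l' by blast
  moreover have "(l - l') * (l + l' - 2 * g) = 0" using r by algebra
  ultimately have s: "l + l' = 2 * g" by simp
  then have p: "l * l' = 1" using r by algebra
  then have l0: "l \<noteq> 0" by auto
  have l'l: "l' = 1 / l" using p l0 by (simp add: field_simps)
  have "l\<^sup>2 \<noteq> 1"
  proof
    assume "l\<^sup>2 = 1"
    then have "l * l' = l * l" using p by (simp add: power2_eq_square)
    then show False using l0 \<open>l \<noteq> l'\<close> by simp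
  qed
  moreover have "bil M a b = (l + 1 / l) / 2" using s unfolding l'l g_def by simp
  moreover have "E' = point (b - l *s a)"
  proof -
    have "a - l' *s b = (- l') *s (b - l *s a)" using p by (simp add: vec_eq_iff algebra_simps)
    moreover have "- l' \<noteq> 0" using p by auto
    ultimately show ?thesis unfolding l' by (metis point_scale)
  qed
  ultimately show thesis using that l0 l by blast
qed

text \<open>A lift of a vertex amounts to a choice of the sign of its representative with \<open>q = 1\<close>.\<close>

lemma normalized_lift:
  assumes v: "v \<noteq> 0" "bil M v v \<noteq> 0" and A: "A \<in> double_cover M" "cover_map A = point v"
  obtains c where "c \<noteq> 0" "bil M (c *s v) (c *s v) = 1" "A = point (lift_vec 1 (c *s v))"
proof -
  obtain V where V: "V \<noteq> 0" "A = point V" by (rule proj_cases)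
  have q: "(V $ None)\<^sup>2 = bil M (x_part V) (x_part V)" using A(1) unfolding V(2) point_in_double_cover[OF V(1)] .
  have "point v = point (x_part V)" using A(2) unfolding V(2) cover_map_point[OF V(1)] by simp
  then obtain k where k: "k \<noteq> 0" "x_part V = k *s v"
    using point_eqD[of v "x_part V"] v(1) x_part_nz[OF V(1) q] by blast
  define w where "w = V $ None"
  have w: "w\<^sup>2 = k\<^sup>2 * bil M v v" using q unfolding w_def k(2) by (simp add: bil_simps power2_eq_square)
  then have w0: "w \<noteq> 0" using k(1) v(2) by auto
  have "lift_vec 1 ((k / w) *s v) = (1 / w) *s V"
    by (subst lift_vec_collapse[of V, symmetric])
      (use w0 in \<open>simp add: lift_vec_scale k(2) w_def[symmetric] vector_smult_assoc\<close>)
  then have "A = point (lift_vec 1 ((k / w) *s v))" using w0 by (simp add: point_scale V(2))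
  moreover have "bil M ((k / w) *s v) ((k / w) *s v) = 1"
    using w w0 k(1) v(2) by (simp add: bil_simps power2_eq_square field_simps)
  ultimately show thesis using that[of "k / w"] k(1) w0 by simp
qed

lemma chosen_lift_normalized:
  assumes u: "\<And>j. j \<in> Idx \<Longrightarrow> vertex T j = point (u j)" "\<And>j. j \<in> Idx \<Longrightarrow> bil (eqn T) (u j) (u j) \<noteq> 0"
    and i: "i \<in> Idx"
  shows "\<exists>c. c \<noteq> 0 \<and> bil (eqn T) (c *s u i) (c *s u i) = 1 \<and> (SOME A. is_lift T A) i = point (lift_vec 1 (c *s u i))"
proof -
  have nz: "u j \<noteq> 0" if "j \<in> Idx" for j using u(2)[OF that] by auto
  define V where "V j = lift_vec (csqrt (bil (eqn T) (u j) (u j))) (u j)" for j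
  have "V j \<noteq> 0" if "j \<in> Idx" for j using nz[OF that] unfolding V_def lift_vec_eq_0 by simp
  then have "is_lift T (\<lambda>j. point (V j))"
    unfolding is_lift_def
    by (simp add: point_in_double_cover cover_map_point u(1)) (simp add: V_def)
  then have "is_lift T (SOME A. is_lift T A)" by (rule someI[where P = "is_lift T"])
  then have "(SOME A. is_lift T A) i \<in> double_cover (eqn T)" "cover_map ((SOME A. is_lift T A) i) = point (u i)"
    using i u(1)[OF i] unfolding is_lift_def by auto
  then show ?thesis using normalized_lift[OF nz[OF i] u(2)[OF i]] by metis
qed

lemma edge_cross_ratio_normal:
  assumes "edge_line (eqn T) a b l" "a \<noteq> 0" "b \<noteq> 0"
    and "edge T i j = vec.span {a, b}" "A i = point (lift_vec 1 a)" "A j = point (lift_vec 1 b)"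
    and "edge_pt T i j = point (a - l *s b)" "edge_pt T j i = point (b - l *s a)"
  shows "edge_cross_ratio T A i j = l"
proof -
  interpret edge_line "eqn T" a b l by fact
  have comb: "1 *s a + (- l) *s b = a - l *s b" "(- l) *s a + 1 *s b = b - l *s a" by simp_all
  have nz: "a - l *s b \<noteq> 0" "b - l *s a \<noteq> 0"
    using comb_zero unfolding comb[symmetric] by (metis zero_neq_one)+
  show ?thesis
    unfolding edge_cross_ratio_def assms(4-) ramification_pt_point[OF nz(1)] ramification_pt_point[OF nz(2)]
      conic_cross_ratio by (rule affine_coord_affine_pt)
qed

text \<open>The other arrangement with the same \<open>k\<close> and \<open>l\<close> differs by a transposition.\<close>

lemma even_arrangement_left_unique:
  assumes "even_arrangement i j k l" "even_arrangement i' j' k l" shows "i = i' \<and> j = j'"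
proof (rule ccontr)
  assume n: "\<not> ?thesis"
  obtain p where p: "p permutes Idx" "evenperm p" "p 1 = i" "p 2 = j" "p 3 = k" "p 4 = l"
    using assms(1) unfolding even_arrangement_def by blast
  obtain q where q: "q permutes Idx" "evenperm q" "q 1 = i'" "q 2 = j'" "q 3 = k" "q 4 = l"
    using assms(2) unfolding even_arrangement_def by blast
  have "{i, j, k, l} = Idx" "{i', j', k, l} = Idx"
    using permutes_image[OF p(1)] permutes_image[OF q(1)] p(3-) q(3-) by simp_all
  moreover have "inj p" "inj q" using p(1) q(1) by (simp_all add: permutes_inj)
  then have "i \<noteq> j" "i \<noteq> k" "i \<noteq> l" "j \<noteq> k" "j \<noteq> l" "k \<noteq> l" "i' \<noteq> j'" "i' \<noteq> k" "i' \<noteq> l" "j' \<noteq> k" "j' \<noteq> l"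
    using p(3-) q(3-) unfolding inj_def by (metis numeral_eq_iff numeral_eq_one_iff one_eq_numeral_iff semiring_norm)+
  ultimately have sw: "i' = j" "j' = i" using n by (metis insertE insertI1 insert_iff singletonD)+
  have "q = p \<circ> Transposition.transpose 1 2"
  proof
    fix m
    show "q m = (p \<circ> Transposition.transpose 1 2) m"
    proof (cases "m \<in> Idx")
      case True
      then show ?thesis using p(3-) q(3-) sw by (auto simp: Transposition.transpose_def)
    next
      case False
      then show ?thesis using p(1) q(1) by (auto simp: Transposition.transpose_def permutes_def)
    qed
  qed
  moreover have "permutation p" using p(1) by (auto simp: permutation_permutes intro: exI[of _ Idx])
  ultimately have "evenperm q = (evenperm p = evenperm (Transposition.transpose 1 (2 :: nat)))"
    by (simp add: evenperm_comp permutation_swap_id)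
  then show False using p(2) q(2) by (simp add: evenperm_swap)
qed

text \<open>A double transposition and a 3-cycle, which generate the alternating group.\<close>

lemma even_arrangement_step:
  assumes "even_arrangement i j k l" shows "even_arrangement j i l k" "even_arrangement j k i l"
proof -
  obtain p where p: "p permutes Idx" "evenperm p" "p 1 = i" "p 2 = j" "p 3 = k" "p 4 = l"
    using assms unfolding even_arrangement_def by blast
  have pp: "permutation p" using p(1) by (auto simp: permutation_permutes intro: exI[of _ Idx])
  have tr: "Transposition.transpose a b permutes Idx" if "a \<in> Idx" "b \<in> Idx" for a b :: nat
    using that by (rule permutes_swap_id)
  have *: "even_arrangement (p (r 1)) (p (r 2)) (p (r 3)) (p (r 4))"
    if "r = Transposition.transpose a b \<circ> Transposition.transpose c d" "a \<in> Idx" "b \<in> Idx" "c \<in> Idx" "d \<in> Idx" "a \<noteq> b" "c \<noteq> d" for r a b c d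
    unfolding even_arrangement_def
  proof (intro exI[of _ "p \<circ> r"] conjI)
    show "p \<circ> r permutes Idx" unfolding that(1) using p(1) tr that(2-5) by (intro permutes_compose) auto
    have "permutation r" "evenperm r"
      unfolding that(1) using that(6,7) by (simp_all add: permutation_compose permutation_swap_id evenperm_comp evenperm_swap)
    then show "evenperm (p \<circ> r)" using p(2) pp by (simp add: evenperm_comp)
  qed simp_all
  show "even_arrangement j i l k"
    using *[OF refl, of 1 2 3 4] p(3-) by (simp add: Transposition.transpose_def)
  show "even_arrangement j k i l"
    using *[OF refl, of 1 2 2 3] p(3-) by (simp add: Transposition.transpose_def)
qed

lemma even_arrangements:
  "even_arrangement 1 2 3 4" "even_arrangement 2 3 1 4" "even_arrangement 3 1 2 4"
  "even_arrangement 1 4 2 3" "even_arrangement 4 2 1 3" "even_arrangement 3 4 1 2"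
proof -
  show a: "even_arrangement 1 2 3 4"
    unfolding even_arrangement_def by (rule exI[of _ id]) (simp add: permutes_id)
  show b: "even_arrangement 2 3 1 4" "even_arrangement 3 1 2 4"
    using even_arrangement_step(2) a by blast+
  show c: "even_arrangement 1 4 2 3" "even_arrangement 4 2 1 3"
    using even_arrangement_step a by blast+
  show "even_arrangement 3 4 1 2"
    using even_arrangement_step b by blast
qed


section \<open>Lengths, and the points of the dual edges\<close>

lemma lifted_length_explicit:
  "lifted_length T A y =
     edge_cross_ratio T A 1 2 powi \<lfloor>2 * y {1, 2}\<rfloor> * edge_cross_ratio T A 1 3 powi \<lfloor>2 * y {1, 3}\<rfloor>
   * edge_cross_ratio T A 1 4 powi \<lfloor>2 * y {1, 4}\<rfloor> * edge_cross_ratio T A 2 3 powi \<lfloor>2 * y {2, 3}\<rfloor>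
   * edge_cross_ratio T A 2 4 powi \<lfloor>2 * y {2, 4}\<rfloor> * edge_cross_ratio T A 3 4 powi \<lfloor>2 * y {3, 4}\<rfloor>"
proof -
  have "{(i, j). i \<in> Idx \<and> j \<in> Idx \<and> i < j} = {(1, 2), (1, 3), (1, 4), (2, 3), (2, 4), (3, 4)}" by auto
  then show ?thesis unfolding lifted_length_def by (simp add: mult.assoc)
qed

lemma pair_ne_Idx: "{i, j} \<noteq> Idx"
proof
  assume "{i, j} = Idx"
  then have "card Idx = card {i, j}" by simp
  also have "\<dots> \<le> 2" by (simp add: card_insert_if)
  finally have "card Idx \<le> 2" .
  then show False by simp
qed

lemma complement_pairs:
  "Idx - {1, 2} = {3, 4}" "Idx - {1, 3} = {2, 4}" "Idx - {1, 4} = {2, 3}"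
  "Idx - {2, 3} = {1, 4}" "Idx - {2, 4} = {1, 3}" "Idx - {3, 4} = {1, 2}"
  by auto

lemma lifted_length_values:
  fixes T A defines "e \<equiv> edge_cross_ratio T A"
  shows
    "lifted_length T A (half_sum {1, 2} {1, 3} {2, 3} {}) = e 1 2 * e 1 3 * e 2 3"
    "lifted_length T A (half_sum {1, 2} {1, 4} {2, 4} {}) = e 1 2 * e 1 4 * e 2 4"
    "lifted_length T A (half_sum {1, 3} {1, 4} {3, 4} {}) = e 1 3 * e 1 4 * e 3 4"
    "lifted_length T A (half_sum {2, 3} {2, 4} {3, 4} {}) = e 2 3 * e 2 4 * e 3 4"
    "lifted_length T A (half_sum {1, 2} {1, 4} {2, 3} {3, 4}) = e 1 2 * e 1 4 * e 2 3 * e 3 4"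
    "lifted_length T A (half_sum {1, 3} {1, 4} {2, 3} {2, 4}) = e 1 3 * e 1 4 * e 2 3 * e 2 4"
    "lifted_length T A (half_sum {1, 2} {1, 3} {2, 4} {3, 4}) = e 1 2 * e 1 3 * e 2 4 * e 3 4"
    "lifted_length T A (\<lambda>s. half_sum {1, 4} {2, 4} {3, 4} Idx (Idx - s)) = e 1 2 * e 1 3 * e 2 3"
    "lifted_length T A (\<lambda>s. half_sum {1, 3} {2, 3} {4, 3} Idx (Idx - s)) = e 1 2 * e 1 4 * e 2 4"
    "lifted_length T A (\<lambda>s. half_sum {1, 2} {3, 2} {4, 2} Idx (Idx - s)) = e 1 3 * e 1 4 * e 3 4"
    "lifted_length T A (\<lambda>s. half_sum {2, 1} {3, 1} {4, 1} Idx (Idx - s)) = e 2 3 * e 2 4 * e 3 4"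
    "lifted_length T A (\<lambda>s. half_sum {1, 2} {1, 4} {2, 3} {3, 4} (Idx - s)) = e 1 2 * e 1 4 * e 2 3 * e 3 4"
    "lifted_length T A (\<lambda>s. half_sum {1, 3} {1, 4} {2, 3} {2, 4} (Idx - s)) = e 1 3 * e 1 4 * e 2 3 * e 2 4"
    "lifted_length T A (\<lambda>s. half_sum {1, 2} {1, 3} {2, 4} {3, 4} (Idx - s)) = e 1 2 * e 1 3 * e 2 4 * e 3 4"
  unfolding lifted_length_explicit complement_pairs half_sum_def unit_vec_def e_def
  by (simp_all add: doubleton_eq_iff pair_ne_Idx)

lemma det4_gram_matrix:
  "det4 (vector [1, a, b, c]) (vector [a, 1, d, e]) (vector [b, d, 1, f]) (vector [c, e, f, 1]) = gram a b c d e f"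
  unfolding det4_def det_4 gram_def vector_4 by algebra

lemma det4_third: "det4 a b (p *s e + q *s c + r *s b + t *s a) c = - p * det4 a b c e"
  unfolding det4_def det_4 vector_4 vector_add_component vector_smult_component by algebra

text \<open>A marked tetrahedron with representatives \<open>v\<close> of the vertices fixed by the lifts, the dual basis \<open>W\<close>
  of poles of the faces, the exponentiated lengths \<open>x\<close>, and the sign \<open>k\<close> of the left generators.\<close>

locale normal_tetrahedron = dual_bases M W v + edge_values x
  for M W v x +
  fixes T :: marked_tetrahedron and k :: complex
  assumes M: "eqn T = M"
    and unit: "i \<in> Idx \<Longrightarrow> bil M (v i) (v i) = 1"
    and qW: "i \<in> Idx \<Longrightarrow> bil M (W i) (W i) \<noteq> 0"
    and vert: "i \<in> Idx \<Longrightarrow> vertex T i = point (v i)"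
    and lift: "i \<in> Idx \<Longrightarrow> (SOME A. is_lift T A) i = point (lift_vec 1 (v i))"
    and g: "i \<in> Idx \<Longrightarrow> j \<in> Idx \<Longrightarrow> i \<noteq> j \<Longrightarrow> bil M (v i) (v j) = ch (x i j)"
    and sq: "i \<in> Idx \<Longrightarrow> j \<in> Idx \<Longrightarrow> i \<noteq> j \<Longrightarrow> (x i j)\<^sup>2 \<noteq> 1"
    and E: "i \<in> Idx \<Longrightarrow> j \<in> Idx \<Longrightarrow> i \<noteq> j \<Longrightarrow> edge_pt T i j = point (v i - x i j *s v j)"
    and k: "k\<^sup>2 = det M" "left_gens T = hodge_family M k" "right_gens T = hodge_family M (- k)"
begin

lemma k_nz: "k \<noteq> 0" "- k \<noteq> 0"
  using k(1) nondegenerate_det[OF nd] by auto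

lemma line: "i \<in> Idx \<Longrightarrow> j \<in> Idx \<Longrightarrow> i \<noteq> j \<Longrightarrow> edge_line M (v i) (v j) (x i j)"
  using symM unit[of i] unit[of j] g[of i j] nz[of i j] sq[of i j] unfolding ch_def
  by unfold_locales auto

lemma edge_length:
  assumes "i \<in> Idx" "j \<in> Idx" "i \<noteq> j"
  shows "edge_cross_ratio T (SOME A. is_lift T A) i j = x i j"
proof (rule edge_cross_ratio_normal[of T "v i" "v j"])
  have n: "v i \<noteq> 0" "v j \<noteq> 0" using unit assms by (metis bil_0(1) zero_neq_one)+
  then show "v i \<noteq> 0" "v j \<noteq> 0" .
  show "edge_line (eqn T) (v i) (v j) (x i j)" unfolding M by (rule line[OF assms])
  show "edge T i j = vec.span {v i, v j}"
    unfolding edge_def vert[OF assms(1)] vert[OF assms(2)] by (rule join_points[OF n])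
  show "edge_pt T j i = point (v j - x i j *s v i)" using E[OF assms(2,1)] assms(3) sym[of j i] by simp
qed (use assms lift E in auto)

lemma length_values:
  "length_config T = [1, triangle x 1 2 3, triangle x 1 2 4, triangle x 1 3 4, triangle x 2 3 4,
     circuit x 1 2 3 4, circuit x 1 3 2 4, circuit x 1 2 4 3]"
  unfolding length_config_def four_cycles_def L3_def length_fun_def lifted_length_values
  by (simp add: edge_length triangle_def circuit_def sym[of 3 2] sym[of 4 1] sym[of 4 2] sym[of 4 3] sym[of 3 1] mult_ac)

text \<open>A square root of the Gram determinant.  Its sign records the order of the two families of generators,
  since \<open>k\<close> changes sign when they are exchanged.\<close>

definition d :: complex where "d = k * det4 (v 1) (v 2) (v 3) (v 4)"

lemma gram_entries:
  assumes "{i, j, l, m} = Idx" "distinct [i, j, l, m]"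
  shows "bil M (v i) (v i) = 1" "bil M (v j) (v j) = 1" "bil M (v l) (v l) = 1" "bil M (v m) (v m) = 1"
    "bil M (v i) (v j) = ch (x i j)" "bil M (v j) (v i) = ch (x i j)"
    "bil M (v i) (v l) = ch (x i l)" "bil M (v l) (v i) = ch (x i l)"
    "bil M (v i) (v m) = ch (x i m)" "bil M (v m) (v i) = ch (x i m)"
    "bil M (v j) (v l) = ch (x j l)" "bil M (v l) (v j) = ch (x j l)"
    "bil M (v j) (v m) = ch (x j m)" "bil M (v m) (v j) = ch (x j m)"
    "bil M (v l) (v m) = ch (x l m)" "bil M (v m) (v l) = ch (x l m)"
proof -
  have I: "i \<in> Idx" "j \<in> Idx" "l \<in> Idx" "m \<in> Idx" using assms(1) by blast+
  have ne: "i \<noteq> j" "i \<noteq> l" "i \<noteq> m" "j \<noteq> l" "j \<noteq> m" "l \<noteq> m" using assms(2) by auto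
  show "bil M (v i) (v i) = 1" "bil M (v j) (v j) = 1" "bil M (v l) (v l) = 1" "bil M (v m) (v m) = 1"
    by (rule unit[OF I(1)] unit[OF I(2)] unit[OF I(3)] unit[OF I(4)])+
  show e: "bil M (v i) (v j) = ch (x i j)" "bil M (v i) (v l) = ch (x i l)" "bil M (v i) (v m) = ch (x i m)"
    "bil M (v j) (v l) = ch (x j l)" "bil M (v j) (v m) = ch (x j m)" "bil M (v l) (v m) = ch (x l m)"
    by (rule g[OF I(1,2) ne(1)] g[OF I(1,3) ne(2)] g[OF I(1,4) ne(3)] g[OF I(2,3) ne(4)] g[OF I(2,4) ne(5)] g[OF I(3,4) ne(6)])+
  show "bil M (v j) (v i) = ch (x i j)" "bil M (v l) (v i) = ch (x i l)" "bil M (v m) (v i) = ch (x i m)"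
    "bil M (v l) (v j) = ch (x j l)" "bil M (v m) (v j) = ch (x j m)" "bil M (v m) (v l) = ch (x l m)"
    unfolding e[symmetric] by (rule bil_sym[OF symM])+
qed

lemma gram_det_square:
  assumes "{i, j, l, m} = Idx" "distinct [i, j, l, m]"
  shows "(k * det4 (v i) (v j) (v l) (v m))\<^sup>2 = gram_det x i j l m"
proof -
  have "(k * det4 (v i) (v j) (v l) (v m))\<^sup>2 = det M * (det4 (v i) (v j) (v l) (v m))\<^sup>2"
    by (simp add: power_mult_distrib k(1))
  also have "\<dots> = gram_det x i j l m"
    unfolding det4_gram gram_entries[OF assms] det4_gram_matrix gram_det_def ..
  finally show ?thesis .
qed

lemma d_nz: "d \<noteq> 0" using k_nz det4_nz unfolding d_def by simp

text \<open>Cramer's rule for the inverse of the Gram matrix.\<close>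

lemma dual_expansion:
  assumes "{i, j, l, m} = Idx" "distinct [i, j, l, m]"
  shows "gram_det x i j l m *s W m =
    face_minor x i j l *s v m + dihedral x 0 i j l m *s v l + dihedral x 0 i l j m *s v j + dihedral x 0 j l i m *s v i"
proof -
  have I: "i \<in> Idx" "j \<in> Idx" "l \<in> Idx" "m \<in> Idx" using assms(1) by blast+
  have ne: "i \<noteq> j" "i \<noteq> l" "i \<noteq> m" "j \<noteq> l" "j \<noteq> m" "l \<noteq> m" using assms(2) by auto
  interpret sw: dual_bases M v W by (rule swap)
  have vW: "bil M (v i) (W m) = 0" "bil M (v j) (W m) = 0" "bil M (v l) (W m) = 0" "bil M (v m) (W m) = 1"
    using I ne sw.dual by simp_all
  define z where "z = gram_det x i j l m *s W m -
    (face_minor x i j l *s v m + dihedral x 0 i j l m *s v l + dihedral x 0 i l j m *s v j + dihedral x 0 j l i m *s v i)"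
  note s = sym[of j i] sym[of l i] sym[of m i] sym[of l j] sym[of m j] sym[of m l]
  have "bil M (v i) z = 0"
    unfolding z_def gram_det_def gram_def face_minor_def cof_diag_def dihedral_def cof_off_def
    unfolding bil_simps vW s gram_entries[OF assms] by algebra
  moreover have "bil M (v j) z = 0"
    unfolding z_def gram_det_def gram_def face_minor_def cof_diag_def dihedral_def cof_off_def
    unfolding bil_simps vW s gram_entries[OF assms] by algebra
  moreover have "bil M (v l) z = 0"
    unfolding z_def gram_det_def gram_def face_minor_def cof_diag_def dihedral_def cof_off_def
    unfolding bil_simps vW s gram_entries[OF assms] by algebra
  moreover have "bil M (v m) z = 0"
    unfolding z_def gram_det_def gram_def face_minor_def cof_diag_def dihedral_def cof_off_def
    unfolding bil_simps vW s gram_entries[OF assms] by algebra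
  ultimately have "bil M (v a) z = 0" if "a \<in> {i, j, l, m}" for a using that by blast
  then have "z = 0" unfolding assms(1) by (rule sw.total)
  then show ?thesis unfolding z_def by simp
qed

lemma dual_gram:
  assumes "{i, j, l, m} = Idx" "distinct [i, j, l, m]"
  shows "gram_det x i j l m * bil M (W m) (W m) = face_minor x i j l"
    "gram_det x i j l m * bil M (W l) (W m) = dihedral x 0 i j l m"
proof -
  have I: "i \<in> Idx" "j \<in> Idx" "l \<in> Idx" "m \<in> Idx" using assms(1) by blast+
  have ne: "i \<noteq> j" "i \<noteq> l" "i \<noteq> m" "j \<noteq> l" "j \<noteq> m" "l \<noteq> m" using assms(2) by auto
  have "bil M (W m) (gram_det x i j l m *s W m) = face_minor x i j l"
    unfolding dual_expansion[OF assms] using I ne by (simp add: bil_simps dual)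
  then show "gram_det x i j l m * bil M (W m) (W m) = face_minor x i j l" by (simp add: bil_simps)
  have "bil M (W l) (gram_det x i j l m *s W m) = dihedral x 0 i j l m"
    unfolding dual_expansion[OF assms] using I ne by (simp add: bil_simps dual)
  then show "gram_det x i j l m * bil M (W l) (W m) = dihedral x 0 i j l m" by (simp add: bil_simps)
qed

text \<open>The combination of \<open>W l\<close> and \<open>W m\<close> on the right is orthogonal to the edge \<open>ij\<close>, and isotropic by
  \<open>dihedral_norm\<close>.  The sign of \<open>d\<close> in \<open>dihedral\<close> decides which of the two isotropic points of the polar line
  it is; by \<open>generator_to_polar\<close>, it is the one that is joined to the two points of the edge by a left and
  by a right generator.\<close>

lemma dual_edge_pt_eq:
  assumes p: "{i, j, l, m} = Idx" "distinct [i, j, l, m]" and d: "k * det4 (v i) (v j) (v l) (v m) = d"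
  shows "dual_edge_pt T i j = point (face_minor x i j l *s W l - dihedral x d i j l m *s W m)"
proof -
  have I: "i \<in> Idx" "j \<in> Idx" "l \<in> Idx" "m \<in> Idx" using p(1) by blast+
  have ne: "i \<noteq> j" "i \<noteq> l" "i \<noteq> m" "j \<noteq> l" "j \<noteq> m" "l \<noteq> m" using p(2) by auto
  interpret sw: dual_bases M v W by (rule swap)
  interpret l: edge_line M "v i" "v j" "x i j" by (rule line[OF I(1,2) ne(1)])
  interpret l': edge_line M "v j" "v i" "x i j" by (rule l.reversed)
  define G where "G = gram_det x i j l m"
  have G: "G = d\<^sup>2" unfolding G_def d[symmetric] by (rule gram_det_square[OF p, symmetric])
  define C where "C = face_minor x i j l"
  define C0 where "C0 = dihedral x 0 i j l m"
  define s where "s = sh (x i j)"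
  define P where "P = dihedral x d i j l m"
  have P: "P = C0 + d * s" unfolding P_def C0_def s_def dihedral_def by simp
  have P': "dihedral x (- d) i j l m = C0 - d * s" unfolding C0_def s_def dihedral_def by simp
  define f where "f = C *s W l - P *s W m"
  define Wl Wm Wlm where "Wl = bil M (W l) (W l)" and "Wm = bil M (W m) (W m)" and "Wlm = bil M (W l) (W m)"
  have Wm: "G * Wm = C" "G * Wlm = C0" unfolding G_def Wm_def Wlm_def C_def C0_def by (rule dual_gram[OF p])+
  have "{i, j, m, l} = Idx" "distinct [i, j, m, l]" using p by auto
  from dual_gram(1)[OF this] have Wl: "G * Wl = face_minor x i j m"
    unfolding G_def Wl_def gram_det_sym(3)[of i j l m] .
  have norm: "(C0 + d * s) * (C0 - d * s) = C * (G * Wl)"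
    using dihedral_norm[of d i j l m] G unfolding G_def[symmetric] P_def[symmetric] P' Wl C_def[symmetric] P by simp
  have Gnz: "G \<noteq> 0" unfolding G using d_nz by simp
  have Cnz: "C \<noteq> 0" using qW[OF I(4)] Gnz unfolding Wm(1)[symmetric] Wm_def by simp
  have fa: "bil M f (v i) = 0" "bil M f (v j) = 0" "bil M f (v l) = C"
    unfolding f_def using I ne by (simp_all add: bil_simps dual)
  have ff: "bil M f f = 0"
  proof -
    have "bil M f f = C\<^sup>2 * Wl - 2 * C * P * Wlm + P\<^sup>2 * Wm"
      unfolding f_def Wl_def Wm_def Wlm_def using bil_sym[OF symM, of "W m" "W l"]
      by (simp add: bil_simps power2_eq_square algebra_simps)
    then have "G * bil M f f = 0" using Wm norm P by algebra
    then show ?thesis using Gnz by simp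
  qed
  have det: "k * det4 (v i) (v j) f (v l) = (x i j - 1 / x i j) / 2 * bil M f (v l)"
  proof -
    \<comment> \<open>Only the coefficient of \<open>v m\<close> contributes to the determinant.\<close>
    have Gf: "G *s f = (- (C * d * s)) *s v m + (C * (G * Wl) - P * C0) *s v l
       + (C * dihedral x 0 i m j l - P * dihedral x 0 i l j m) *s v j
       + (C * dihedral x 0 j m i l - P * dihedral x 0 j l i m) *s v i"
    proof -
      have "G *s f = C *s (gram_det x i j m l *s W l) - P *s (gram_det x i j l m *s W m)"
        unfolding f_def G_def gram_det_sym(3)[of i j m l] by (simp add: vec_eq_iff algebra_simps)
      also have "\<dots> = C *s (face_minor x i j m *s v l + dihedral x 0 i j m l *s v m + dihedral x 0 i m j l *s v j + dihedral x 0 j m i l *s v i)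
        - P *s (C *s v m + C0 *s v l + dihedral x 0 i l j m *s v j + dihedral x 0 j l i m *s v i)"
        unfolding C_def C0_def using p dual_expansion[OF p] dual_expansion[of i j m l] by (simp add: insert_commute)
      also have "dihedral x 0 i j m l = C0" unfolding C0_def by (rule dihedral_sym(2))
      finally show ?thesis unfolding Wl P by (simp add: vec_eq_iff algebra_simps)
    qed
    have "det4 (v i) (v j) (G *s f) (v l) = C * d * s * det4 (v i) (v j) (v l) (v m)"
      unfolding Gf det4_third by simp
    moreover have "det4 (v i) (v j) (G *s f) (v l) = G * det4 (v i) (v j) f (v l)"
      unfolding det4_def det_4 by (simp add: algebra_simps)
    ultimately have "G * (k * det4 (v i) (v j) f (v l)) = C * d * s * (k * det4 (v i) (v j) (v l) (v m))"
      by (simp add: mult_ac)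
    then have "G * (k * det4 (v i) (v j) f (v l)) = G * (C * s)" unfolding d G by (simp add: power2_eq_square mult_ac)
    then show ?thesis using Gnz unfolding fa(3) s_def sh_def by (simp add: mult.commute)
  qed
  have fl: "bil M f (v l) \<noteq> 0" unfolding fa(3) by (rule Cnz)
  have L: "vec.span {v i - x i j *s v j, f} \<in> hodge_family M k"
    by (rule l.generator_to_polar[OF nd k(1) fa(1,2) ff fl det])
  have det': "- k * det4 (v j) (v i) f (v l) = (x i j - 1 / x i j) / 2 * bil M f (v l)"
    using det det4_swap(1)[of "v j" "v i" f "v l"] by simp
  have k2: "(- k)\<^sup>2 = det M" using k(1) by simp
  have R: "vec.span {v j - x i j *s v i, f} \<in> hodge_family M (- k)"
    by (rule l'.generator_to_polar[OF nd k2 fa(2,1) ff fl det'])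
  have comb: "1 *s v i + (- x i j) *s v j = v i - x i j *s v j" "(- x i j) *s v i + 1 *s v j = v j - x i j *s v i" by simp_all
  have enz: "v i - x i j *s v j \<noteq> 0" "v j - x i j *s v i \<noteq> 0"
    using l.comb_zero unfolding comb[symmetric] by (metis zero_neq_one)+
  have gl: "gen_through (left_gens T) (edge_pt T i j) = vec.span {v i - x i j *s v j, f}"
    unfolding k(2) E[OF I(1,2) ne(1)]
    by (rule gen_through_hodge[OF nd k_nz(1) L]) (simp add: point_in_pts[OF enz(1) vec.subspace_span] vec.span_base)
  have gr: "gen_through (right_gens T) (edge_pt T j i) = vec.span {v j - x i j *s v i, f}"
    unfolding k(3) E[OF I(2,1) ne(1)[symmetric]] sym[of j i]
    by (rule gen_through_hodge[OF nd k_nz(2) R]) (simp add: point_in_pts[OF enz(2) vec.subspace_span] vec.span_base)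
  show ?thesis
    unfolding dual_edge_pt_def gl gr l.polar_generators_meet[OF fa(1,2)]
    unfolding f_def C_def P_def point_def ..
qed

end


section \<open>The dual tetrahedron and the theorem\<close>

lemma det4_even:
  "det4 b a d c = det4 a b c d" "det4 b c a d = det4 a b c d"
  unfolding det4_def det_4 vector_4 by algebra+

context normal_tetrahedron
begin

text \<open>Even permutations of the vertices preserve the determinant.  So the parity rule in the marking of the
  dual tetrahedron selects the same sign of \<open>d\<close> for all edges.\<close>

definition oriented :: "nat \<Rightarrow> nat \<Rightarrow> nat \<Rightarrow> nat \<Rightarrow> bool" where
  "oriented i j l m \<longleftrightarrow> even_arrangement i j l m \<and> {i, j, l, m} = Idx \<and> distinct [i, j, l, m] \<and>
     k * det4 (v i) (v j) (v l) (v m) = d"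

lemma oriented_step: "oriented i j l m \<Longrightarrow> oriented j i m l" "oriented i j l m \<Longrightarrow> oriented j l i m"
  unfolding oriented_def using even_arrangement_step[of i j l m] det4_even(1)[of "v j" "v i" "v m" "v l"] det4_even(2)[of "v j" "v l" "v i" "v m"]
  by (auto simp: insert_commute)

lemma oriented_arrangements:
  "oriented 1 2 3 4" "oriented 2 3 1 4" "oriented 3 1 2 4" "oriented 1 4 2 3" "oriented 4 2 1 3" "oriented 3 4 1 2"
proof -
  show a: "oriented 1 2 3 4" unfolding oriented_def d_def using even_arrangements(1) by simp
  show b: "oriented 2 3 1 4" by (rule oriented_step(2)[OF a])
  show c: "oriented 3 1 2 4" by (rule oriented_step(2)[OF b])
  show d: "oriented 1 4 2 3" by (rule oriented_step(2)[OF oriented_step(1)[OF a]])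
  show "oriented 4 2 1 3" by (rule oriented_step(2)[OF d])
  show "oriented 3 4 1 2" by (rule oriented_step(2)[OF oriented_step(1)[OF c]])
qed

lemma dual_edge_pt_oriented:
  assumes o: "oriented i j l m"
  shows "edge_pt (dual T) l m = point (face_minor x i j l *s W l - dihedral x d i j l m *s W m)"
proof -
  have e: "even_arrangement i j l m" using o unfolding oriented_def by blast
  have "edge_pt (dual T) l m = (THE p. \<exists>i j. even_arrangement i j l m \<and> p = dual_edge_pt T i j)"
    by (simp add: dual_def)
  also have "\<dots> = dual_edge_pt T i j"
  proof (rule the_equality)
    show "\<exists>i' j'. even_arrangement i' j' l m \<and> dual_edge_pt T i j = dual_edge_pt T i' j'" using e by blast
    fix p assume "\<exists>i' j'. even_arrangement i' j' l m \<and> p = dual_edge_pt T i' j'"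
    then show "p = dual_edge_pt T i j" using even_arrangement_left_unique[OF e] by blast
  qed
  finally have "edge_pt (dual T) l m = dual_edge_pt T i j" .
  then show ?thesis using dual_edge_pt_eq[of i j l m] o unfolding oriented_def by simp
qed

lemma dual_vertex: assumes i: "i \<in> Idx" shows "vertex (dual T) i = point (W i)"
proof -
  interpret sw: dual_bases M v W by (rule swap)
  have "polar M (Rep_proj (vertex T j)) = {u. bil M (v j) u = 0}" if j: "j \<in> Idx" for j
    unfolding vert[OF j] Rep_point[OF bases_nz(1)[OF j]] polar_def vec.span_singleton
    by (auto simp: bil_simps dest: spec[of _ 1])
  then have "(\<Inter>j\<in>Idx - {i}. face (dual T) j) = {u. \<forall>j\<in>Idx - {i}. bil M (v j) u = 0}"
    unfolding dual_def by (auto simp: M)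
  then show ?thesis unfolding vertex_def sw.intersection[OF i] point_def by simp
qed

text \<open>In the dual tetrahedron, the edge \<open>lm\<close> has the exponentiated length \<open>y\<close>, that is, the normalized
  exponentiated dihedral angle of the original tetrahedron at the opposite edge \<open>ij\<close>.\<close>

lemma dual_edge_length:
  assumes o: "oriented i j l m"
    and r: "r \<noteq> 0" "bil M (W l) (W l) = r\<^sup>2" "A l = point (lift_vec 1 (inverse r *s W l))"
    and s: "s \<noteq> 0" "bil M (W m) (W m) = s\<^sup>2" "A m = point (lift_vec 1 (inverse s *s W m))"
  defines "y \<equiv> dihedral x d i j l m / (d\<^sup>2 * r * s)"
  shows "edge_cross_ratio (dual T) A l m = y" "y\<^sup>2 \<noteq> 1"
proof -
  have p: "{i, j, l, m} = Idx" "distinct [i, j, l, m]" and kd: "k * det4 (v i) (v j) (v l) (v m) = d"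
    using o unfolding oriented_def by auto
  have p': "{j, i, m, l} = Idx" "distinct [j, i, m, l]" using oriented_step(1)[OF o] unfolding oriented_def by auto
  have I: "i \<in> Idx" "j \<in> Idx" "l \<in> Idx" "m \<in> Idx" using p(1) by blast+
  have ne: "i \<noteq> j" using p(2) by auto
  define P where "P = dihedral x d i j l m"
  define C0 where "C0 = dihedral x 0 i j l m"
  define t where "t = sh (x i j)"
  have P: "P = C0 + d * t" "dihedral x (- d) i j l m = C0 - d * t"
    unfolding P_def C0_def t_def dihedral_def by simp_all
  have G: "gram_det x i j l m = d\<^sup>2" unfolding gram_det_square[OF p, symmetric] kd ..
  have G': "gram_det x j i m l = d\<^sup>2" unfolding G[symmetric] using gram_det_sym by metis
  have Cl: "face_minor x i j l = d\<^sup>2 * s\<^sup>2" using dual_gram(1)[OF p] G s(2) by simp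
  have Cm: "face_minor x j i m = d\<^sup>2 * r\<^sup>2" using dual_gram(1)[OF p'] G' r(2) by simp
  have Cm': "face_minor x i j m = d\<^sup>2 * r\<^sup>2" using Cm face_minor_sym(1)[of j i m] by simp
  have lm: "d\<^sup>2 * bil M (W l) (W m) = C0" using dual_gram(2)[OF p] G unfolding C0_def by simp
  have norm: "P * (C0 - d * t) = (d\<^sup>2 * r * s)\<^sup>2"
    using dihedral_norm[of d i j l m] G P(2) unfolding P_def[symmetric] Cl Cm' by (simp add: power2_eq_square mult_ac)
  define N where "N = d\<^sup>2 * r * s"
  have N: "N \<noteq> 0" unfolding N_def using d_nz r(1) s(1) by simp
  have Pnz: "P \<noteq> 0" using norm N unfolding N_def[symmetric] by auto
  have y: "y = P / N" unfolding y_def P_def N_def ..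
  have y0: "y \<noteq> 0" unfolding y using Pnz N by simp
  \<comment> \<open>The inverse of \<open>y\<close> is its conjugate for \<open>d \<mapsto> - d\<close>.  So \<open>(y + 1 / y) / 2\<close> is the normalized
    cofactor, which is the Gram entry of the dual tetrahedron, and the difference with \<open>1 / y\<close> is not 0.\<close>
  have inv: "1 / y = (C0 - d * t) / N"
    using norm N Pnz unfolding y N_def[symmetric] by (simp add: field_simps power2_eq_square)
  have tnz: "t \<noteq> 0"
    unfolding t_def sh_def using sq[OF I(1,2) ne] nz[of i j]
    by (simp add: field_simps power2_eq_square)
  have "y - 1 / y = 2 * d * t / N" unfolding inv unfolding y P(1) by (simp flip: diff_divide_distrib)
  then have "y - 1 / y \<noteq> 0" using d_nz tnz N by simp
  then show y1: "y\<^sup>2 \<noteq> 1" using y0 by (auto simp: field_simps power2_eq_square)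
  have sum: "y + 1 / y = 2 * C0 / N" unfolding inv unfolding y P(1) by (simp flip: add_divide_distrib)
  define a where "a = inverse r *s W l"
  define b where "b = inverse s *s W m"
  have aa: "bil M a a = 1" "bil M b b = 1" unfolding a_def b_def using r(1,2) s(1,2) by (simp_all add: bil_simps power2_eq_square field_simps)
  have "bil M a b = d\<^sup>2 * bil M (W l) (W m) / N"
    unfolding a_def b_def N_def using d_nz r(1) s(1) by (simp add: bil_simps field_simps)
  then have ab: "bil M a b = (y + 1 / y) / 2" unfolding lm sum by simp
  have line: "edge_line M a b y" using symM aa ab y0 y1 by unfold_locales auto
  have nza: "a \<noteq> 0" "b \<noteq> 0" using aa by auto
  have W: "W l = r *s a" "W m = s *s b" unfolding a_def b_def using r(1) s(1) by (simp_all add: vector_smult_assoc)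
  have yN: "P = y * N" unfolding y using N by simp
  have E1: "edge_pt (dual T) l m = point (a - y *s b)"
  proof -
    have "face_minor x i j l *s W l - dihedral x d i j l m *s W m = (d\<^sup>2 * s\<^sup>2 * r) *s (a - y *s b)"
      unfolding Cl P_def[symmetric] W yN N_def by (simp add: vec_eq_iff power2_eq_square algebra_simps)
    moreover have "d\<^sup>2 * s\<^sup>2 * r \<noteq> 0" using d_nz r(1) s(1) by simp
    ultimately show ?thesis unfolding dual_edge_pt_oriented[OF o] by (simp only: point_scale not_False_eq_True)
  qed
  have E2: "edge_pt (dual T) m l = point (b - y *s a)"
  proof -
    have "dihedral x d j i m l = P" unfolding P_def using dihedral_sym by metis
    then have "face_minor x j i m *s W m - dihedral x d j i m l *s W l = (d\<^sup>2 * r\<^sup>2 * s) *s (b - y *s a)"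
      unfolding Cm W by (simp add: yN N_def vec_eq_iff power2_eq_square algebra_simps)
    moreover have "d\<^sup>2 * r\<^sup>2 * s \<noteq> 0" using d_nz r(1) s(1) by simp
    ultimately show ?thesis unfolding dual_edge_pt_oriented[OF oriented_step(1)[OF o]] by (simp only: point_scale not_False_eq_True)
  qed
  have eqn: "eqn (dual T) = M" unfolding dual_def by (simp add: M)
  have edge: "edge (dual T) l m = vec.span {a, b}"
  proof -
    have "point (W l) = point a" "point (W m) = point b" unfolding W using r(1) s(1) by (simp_all add: point_scale)
    then show ?thesis unfolding edge_def dual_vertex[OF I(3)] dual_vertex[OF I(4)] by (simp add: join_points[OF nza])
  qed
  show "edge_cross_ratio (dual T) A l m = y"
    using edge_cross_ratio_normal[of "dual T" a b y l m A] line nza edge E1 E2 r(3) s(3)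
    unfolding eqn a_def b_def by simp
qed

lemma dual_lift_normal:
  assumes i: "i \<in> Idx"
  obtains r where "r \<noteq> 0" "bil M (W i) (W i) = r\<^sup>2" "(SOME A. is_lift (dual T) A) i = point (lift_vec 1 (inverse r *s W i))"
proof -
  have "eqn (dual T) = M" by (simp add: dual_def M)
  then obtain c where c: "c \<noteq> 0" "bil M (c *s W i) (c *s W i) = 1" "(SOME A. is_lift (dual T) A) i = point (lift_vec 1 (c *s W i))"
    using chosen_lift_normalized[of "dual T" W, OF dual_vertex _ i] qW by metis
  have "bil M (W i) (W i) = (inverse c)\<^sup>2" using c(1,2) by (simp add: bil_simps field_simps power2_eq_square)
  then show thesis using that[of "inverse c"] c by simp
qed

text \<open>The angle configuration is the length configuration of the dual tetrahedron.  Complementation of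
  subsets replaces an edge by the opposite one: it takes the three edges at a vertex to the opposite face, and
  permutes the edges of each circuit.\<close>

lemma angle_values:
  defines "e \<equiv> edge_cross_ratio (dual T) (SOME A. is_lift (dual T) A)"
  shows "angle_config T = [1, e 1 2 * e 1 3 * e 2 3, e 1 2 * e 1 4 * e 2 4, e 1 3 * e 1 4 * e 3 4, e 2 3 * e 2 4 * e 3 4,
     e 1 2 * e 1 4 * e 2 3 * e 3 4, e 1 3 * e 1 4 * e 2 3 * e 2 4, e 1 2 * e 1 3 * e 2 4 * e 3 4]"
  unfolding angle_config_def four_cycles_def A3_def angle_fun_def length_fun_def lifted_length_values e_def by simp

lemma configurations_cho_kim_pair:
  "\<exists>n1 n2 n3 n4 d1 d2 d3 m1 m2 m3 m4 e1 e2 e3 a b c D.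
     cho_kim_pair n1 n2 n3 n4 d1 d2 d3 m1 m2 m3 m4 e1 e2 e3 a b c D \<and>
     length_config T = [1, n1, n2, n3, n4, d1, d2, d3] \<and> angle_config T = [1, m1, m2, m3, m4, e1, e2, e3]"
proof -
  obtain r1 where r1: "r1 \<noteq> 0" "bil M (W 1) (W 1) = r1\<^sup>2" "(SOME A. is_lift (dual T) A) 1 = point (lift_vec 1 (inverse r1 *s W 1))"
    by (rule dual_lift_normal[of 1]) simp
  obtain r2 where r2: "r2 \<noteq> 0" "bil M (W 2) (W 2) = r2\<^sup>2" "(SOME A. is_lift (dual T) A) 2 = point (lift_vec 1 (inverse r2 *s W 2))"
    by (rule dual_lift_normal[of 2]) simp
  obtain r3 where r3: "r3 \<noteq> 0" "bil M (W 3) (W 3) = r3\<^sup>2" "(SOME A. is_lift (dual T) A) 3 = point (lift_vec 1 (inverse r3 *s W 3))"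
    by (rule dual_lift_normal[of 3]) simp
  obtain r4 where r4: "r4 \<noteq> 0" "bil M (W 4) (W 4) = r4\<^sup>2" "(SOME A. is_lift (dual T) A) 4 = point (lift_vec 1 (inverse r4 *s W 4))"
    by (rule dual_lift_normal[of 4]) simp
  note o = oriented_arrangements
  have G: "gram_det x 1 2 3 4 = d\<^sup>2" using gram_det_square[of 1 2 3 4] unfolding d_def by simp
  have C: "face_minor x i j l = d\<^sup>2 * bil M (W m) (W m)" if "oriented i j l m" for i j l m
    using that dual_gram(1)[of i j l m] gram_det_square[of i j l m] unfolding oriented_def by auto
  have C: "face_minor x 2 3 4 = d\<^sup>2 * r1\<^sup>2" "face_minor x 1 3 4 = d\<^sup>2 * r2\<^sup>2"
    "face_minor x 1 2 4 = d\<^sup>2 * r3\<^sup>2" "face_minor x 1 2 3 = d\<^sup>2 * r4\<^sup>2"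
    using C[OF o(1)] C[OF oriented_step(1)[OF o(1)]] C[OF oriented_step(1)[OF o(2)]] C[OF oriented_step(1)[OF o(3)]]
      face_minor_sym(1)[of 2 1 4] face_minor_sym(1)[of 3 2 4] face_minor_sym(1)[of 1 3 4]
    unfolding r1(2) r2(2) r3(2) r4(2) by simp_all
  note e12 = dual_edge_length[OF o(6) r1 r2] and e13 = dual_edge_length[OF o(5) r1 r3]
    and e14 = dual_edge_length[OF o(2) r1 r4] and e23 = dual_edge_length[OF o(4) r2 r3]
    and e24 = dual_edge_length[OF o(3) r2 r4] and e34 = dual_edge_length[OF o(1) r3 r4]
  have ds: "dihedral x d 4 2 1 3 = dihedral x d 2 4 1 3" "dihedral x d 3 1 2 4 = dihedral x d 1 3 2 4"
    by (rule dihedral_sym(1))+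
  from cho_kim_pair_dual[OF G[symmetric] d_nz C r1(1) r2(1) r3(1) r4(1) e12(2)] show ?thesis
    unfolding length_values angle_values e12(1) e13(1) e14(1) e23(1) e24(1) e34(1) ds by blast
qed

end

text \<open>The lifts determine the scaling of the vertices; the poles of the faces are scaled inversely.\<close>

lemma normal_tetrahedron_exists:
  assumes T: "marked_projective_tetrahedron T"
  shows "\<exists>M W v x k. normal_tetrahedron M W v x T k"
proof -
  define M where "M = eqn T"
  have pt: "projective_tetrahedron T" and lr: "left_gens T \<noteq> right_gens T"
    and fam: "generator_families M = {left_gens T, right_gens T}"
    and ep: "\<And>i j. i \<in> Idx \<Longrightarrow> j \<in> Idx \<Longrightarrow> i \<noteq> j \<Longrightarrow> edge_pt T i j \<noteq> edge_pt T j i \<and>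
        pts (edge T i j) \<inter> quadric M = {edge_pt T i j, edge_pt T j i}"
    using T unfolding marked_projective_tetrahedron_def M_def by blast+
  obtain n u where nu: "dual_bases M n u" "\<And>i. i \<in> Idx \<Longrightarrow> vertex T i = point (u i)"
    "\<And>i. i \<in> Idx \<Longrightarrow> bil M (u i) (u i) \<noteq> 0" "\<And>i. i \<in> Idx \<Longrightarrow> bil M (n i) (n i) \<noteq> 0"
    using projective_tetrahedron_bases[OF pt] unfolding M_def by metis
  interpret u: dual_bases M n u by (rule nu(1))
  have "\<exists>c. c \<noteq> 0 \<and> bil M (c *s u i) (c *s u i) = 1 \<and> (SOME A. is_lift T A) i = point (lift_vec 1 (c *s u i))"
    if i: "i \<in> Idx" for i
    unfolding M_def by (rule chosen_lift_normalized[OF nu(2) nu(3)[unfolded M_def] i])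
  then have "\<forall>i\<in>Idx. \<exists>c. c \<noteq> 0 \<and> bil M (c *s u i) (c *s u i) = 1 \<and> (SOME A. is_lift T A) i = point (lift_vec 1 (c *s u i))"
    by blast
  from bchoice[OF this] obtain c where c': "\<forall>i\<in>Idx. c i \<noteq> 0 \<and> bil M (c i *s u i) (c i *s u i) = 1 \<and>
      (SOME A. is_lift T A) i = point (lift_vec 1 (c i *s u i))" ..
  have c: "c i \<noteq> 0" "bil M (c i *s u i) (c i *s u i) = 1" "(SOME A. is_lift T A) i = point (lift_vec 1 (c i *s u i))"
    if "i \<in> Idx" for i
    using bspec[OF c' that] by simp_all
  define v where "v i = c i *s u i" for i
  define W where "W i = inverse (c i) *s n i" for i
  have db: "dual_bases M W v" unfolding v_def[abs_def] W_def[abs_def] by (rule u.rescale) (rule c(1))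
  interpret v: dual_bases M W v by (rule db)
  have vert: "vertex T i = point (v i)" if "i \<in> Idx" for i
    unfolding v_def using nu(2)[OF that] c(1)[OF that] by (simp add: point_scale)
  have qW: "bil M (W i) (W i) \<noteq> 0" if "i \<in> Idx" for i
    unfolding W_def using nu(4)[OF that] c(1)[OF that] by (simp add: bil_simps)
  have ind: "indep2 (v i) (v j)" if ij: "i \<in> Idx" "j \<in> Idx" "i \<noteq> j" for i j
    unfolding indep2_def
  proof (intro allI impI)
    fix s t assume z: "s *s v i + t *s v j = 0"
    have "bil M (W i) (s *s v i + t *s v j) = 0" "bil M (W j) (s *s v i + t *s v j) = 0" unfolding z by simp_all
    then show "s = 0 \<and> t = 0" using v.dual ij by (simp add: bil_simps)
  qed
  define Q where "Q i j l \<longleftrightarrow> l \<noteq> 0 \<and> l\<^sup>2 \<noteq> 1 \<and> bil M (v i) (v j) = ch l \<and>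
      edge_pt T i j = point (v i - l *s v j) \<and> edge_pt T j i = point (v j - l *s v i)" for i j l
  have "\<exists>l. Q i j l"
    if ij: "i \<in> Idx" "j \<in> Idx" "i < j" for i j
  proof -
    have ne: "i \<noteq> j" using ij(3) by simp
    have "edge T i j = vec.span {v i, v j}"
      unfolding edge_def vert[OF ij(1)] vert[OF ij(2)] by (rule join_points) (use v.bases_nz ij in auto)
    then show ?thesis
      using quadric_points_on_edge[OF v.symM c(2)[OF ij(1), folded v_def] c(2)[OF ij(2), folded v_def] ind[OF ij(1,2) ne],
        of "edge_pt T i j" "edge_pt T j i"] ep[OF ij(1,2) ne]
      unfolding Q_def ch_def by metis
  qed
  note l_ex = this
  define l where "l i j = (SOME l. Q i j l)" for i j
  have l: "Q i j (l i j)" if "i \<in> Idx" "j \<in> Idx" "i < j" for i j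
    unfolding l_def by (rule someI_ex[OF l_ex[OF that]])
  define x where "x i j = (if i \<in> Idx \<and> j \<in> Idx \<and> i \<noteq> j then l (min i j) (max i j) else 1)" for i j
  have x: "x i j \<noteq> 0 \<and> (x i j)\<^sup>2 \<noteq> 1 \<and> bil M (v i) (v j) = ch (x i j) \<and> edge_pt T i j = point (v i - x i j *s v j)"
    if ij: "i \<in> Idx" "j \<in> Idx" "i \<noteq> j" for i j
  proof (cases "i < j")
    case True
    then have "x i j = l i j" using ij by (simp add: x_def min_def max_def)
    then show ?thesis using l[OF ij(1,2) True] by (simp add: Q_def)
  next
    case False
    then have "j < i" using ij(3) by simp
    then have "x i j = l j i" using ij by (simp add: x_def min_def max_def)
    then show ?thesis using l[OF ij(2,1) \<open>j < i\<close>] bil_sym[OF v.symM, of "v i" "v j"] by (simp add: Q_def)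
  qed
  have xs: "x i j = x j i" for i j by (auto simp: x_def min.commute max.commute)
  have x0: "x i j \<noteq> 0" for i j
  proof (cases "i \<in> Idx \<and> j \<in> Idx \<and> i \<noteq> j")
    case True
    then show ?thesis using x by blast
  next
    case False
    then have "x i j = 1" unfolding x_def by (rule if_not_P)
    then show ?thesis by simp
  qed
  obtain k where k: "k\<^sup>2 = det M" "left_gens T = hodge_family M k"
    using generator_family_class[OF v.nd, of "left_gens T"] fam by auto
  obtain k' where k': "k'\<^sup>2 = det M" "right_gens T = hodge_family M k'"
    using generator_family_class[OF v.nd, of "right_gens T"] fam by auto
  have "k' = - k" using k k' lr by (metis power2_eq_iff)
  then have "normal_tetrahedron M W v x T k"
  proof (intro normal_tetrahedron.intro db edge_values.intro normal_tetrahedron_axioms.intro)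
  qed (use xs x0 x vert qW k k' c(2,3) in \<open>auto simp: M_def v_def\<close>)
  then show ?thesis by blast
qed

theorem theorem1p7:
  fixes T :: marked_tetrahedron
  assumes "marked_projective_tetrahedron T"
  shows "(\<exists>!\<psi>. \<psi> \<in> PSL2 \<and>
            (\<forall>t. CK_L T t = CK_A T (\<psi> t)) \<and>
            (\<exists>p1 p2. principal_parameters T p1 p2 \<and> (\<forall>t. \<psi> t = cross_ratio t p1 (affine_pt 1) p2)) \<and>
            (\<forall>k<8. \<psi> (affine_pt (length_config T ! k)) = affine_pt (angle_config T ! k))) \<and>
         ((\<exists>!\<psi>. \<psi> \<in> PSL2 \<and> (\<forall>t. CK_L T t = CK_A T (\<psi> t))) \<longleftrightarrow>
            (\<forall>\<sigma>\<in>PSL2. (\<forall>t. CK_L T (\<sigma> t) = CK_L T t) \<longrightarrow> \<sigma> = id))"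
proof -
  obtain M W v x k where "normal_tetrahedron M W v x T k" using normal_tetrahedron_exists[OF assms] by blast
  then interpret normal_tetrahedron M W v x T k .
  obtain n1 n2 n3 n4 d1 d2 d3 m1 m2 m3 m4 e1 e2 e3 a b c D where
    ck: "cho_kim_pair n1 n2 n3 n4 d1 d2 d3 m1 m2 m3 m4 e1 e2 e3 a b c D"
    and L: "length_config T = [1, n1, n2, n3, n4, d1, d2, d3]" and A: "angle_config T = [1, m1, m2, m3, m4, e1, e2, e3]"
    using configurations_cho_kim_pair by blast
  have pp: "principal_parameters T p1 p2 \<longleftrightarrow> principal_pair (length_config T) p1 p2" for p1 p2
    unfolding principal_parameters_def principal_pair_def ..
  show ?thesis unfolding pp L A by (rule cho_kim_pair.moebius_equivalence[OF ck])
qed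

end
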